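(* Let $n\ge1$ and $y\ge0$ be fixed integers and $\kappa>0$. As $t\to\infty$ through integers with $t\equiv y\pmod2$: if $\kappa<2$, then $\bar M^{(n)}_t(y;\kappa)=1+C+O(t^{-1})$, where $$C=\kappa\Big(\sum_{h=0}^{n}\frac{(2n-h)\binom nh\binom{y+h-2}h}{\binom{2n}h}\frac1{(2-\kappa)^{2n-h+1}}\Big)\Big/\Big(\sum_{h=0}^{n}\frac{\binom nh\binom{y+h-2}h}{\binom{2n}h}\frac1{(2-\kappa)^{2n-h}}\Big);$$ if $\kappa=2$, then $$\bar M^{(n)}_t(y;2)=2^{\frac12-2n}n\binom{2n}n\sqrt{\pi t}-2n-y+2+O(t^{-1/2});$$ if $\kappa>2$, then $$\bar M^{(n)}_t(y;\kappa)=\frac{\kappa-2}{\kappa-1}\cdot\frac t2+\frac{\kappa((2-\kappa)y+4n-2)}{2(\kappa-1)(\kappa-2)}+1+O(t^{-1}).$$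
   Context: A walk is a lattice path in $\mathbb Z^2$ with steps $(1,1)$ and $(1,-1)$ never going below the $x$-axis. A family of walks is vicious if no two of its walks share a lattice point. A contact is a lattice point on the $x$-axis lying on one of the walks (starting and end points included); $c(\mathbf P)$ is the total number of contacts of a family $\mathbf P$. $Z^{(n)}_t(y;\kappa)=\sum_{\mathbf P}\kappa^{c(\mathbf P)}$, summed over vicious families $(P_1,\dots,P_n)$ with $P_i$ running from $(0,2i-2)$ to $(t,y+2i-2)$. The normalized mean number of contacts is $\bar M^{(n)}_t(y;\kappa)=\kappa\frac{d}{d\kappa}Z^{(n)}_t(y;\kappa)\big/Z^{(n)}_t(y;\kappa)$. Binomials: $\binom mk=m(m-1)\cdots(m-k+1)/k!$ for integers $k\ge0$. *)

theory Defs
  imports "HOL-Analysis.Analysis" "HOL-Library.Landau_Symbols"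
begin

text \<open>A walk is the list of lattice points that it visits, in order.\<close>

definition is_walk :: "(int \<times> int) list \<Rightarrow> bool" where
  "is_walk p \<longleftrightarrow> p \<noteq> [] \<and>
     (\<forall>i. Suc i < length p \<longrightarrow>
        (fst (p ! Suc i) - fst (p ! i), snd (p ! Suc i) - snd (p ! i)) \<in> {(1, 1), (1, -1)}) \<and>
     (\<forall>v\<in>set p. snd v \<ge> 0)"

definition walks :: "int \<times> int \<Rightarrow> int \<times> int \<Rightarrow> (int \<times> int) list set" where
  "walks a b = {p. is_walk p \<and> hd p = a \<and> last p = b}"

definition vicious :: "nat \<Rightarrow> (nat \<Rightarrow> (int \<times> int) list) \<Rightarrow> bool" where
  "vicious n P \<longleftrightarrow> (\<forall>i\<in>{1..n}. \<forall>j\<in>{1..n}. i \<noteq> j \<longrightarrow> set (P i) \<inter> set (P j) = {})"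

text \<open>Families are extensional functions on \<open>{1..n}\<close>, so that each family is counted exactly once
  in the partition function.\<close>

definition vicious_families :: "nat \<Rightarrow> nat \<Rightarrow> nat \<Rightarrow> (nat \<Rightarrow> (int \<times> int) list) set" where
  "vicious_families n t y =
     {P \<in> (\<Pi>\<^sub>E i\<in>{1..n}. walks (0, 2 * int i - 2) (int t, int y + 2 * int i - 2)). vicious n P}"

definition contacts :: "nat \<Rightarrow> (nat \<Rightarrow> (int \<times> int) list) \<Rightarrow> nat" where
  "contacts n P = card {v. (\<exists>i\<in>{1..n}. v \<in> set (P i)) \<and> snd v = 0}"

definition Z :: "nat \<Rightarrow> nat \<Rightarrow> nat \<Rightarrow> real \<Rightarrow> real" where
  "Z n t y \<kappa> = (\<Sum>P\<in>vicious_families n t y. \<kappa> ^ contacts n P)"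

definition mean_contacts :: "nat \<Rightarrow> nat \<Rightarrow> nat \<Rightarrow> real \<Rightarrow> real" where
  "mean_contacts n t y \<kappa> = \<kappa> * deriv (Z n t y) \<kappa> / Z n t y \<kappa>"

definition parity_at_top :: "nat \<Rightarrow> nat filter" where
  "parity_at_top y = inf at_top (principal {t. t mod 2 = y mod 2})"

lemma finite_walks: "finite (walks a b)"
proof -
  define R where "R = {fst a..fst b} \<times> {snd a - (fst b - fst a)..snd a + (fst b - fst a)}"
  have pos: "fst (p ! i) = fst (p ! 0) + int i \<and> \<bar>snd (p ! i) - snd (p ! 0)\<bar> \<le> int i"
    if "is_walk p" "i < length p" for p i
    using that(2)
  proof (induction i)
    case (Suc i)
    have "(fst (p ! Suc i) - fst (p ! i), snd (p ! Suc i) - snd (p ! i)) \<in> {(1, 1), (1, -1)}"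
      using that(1) Suc.prems unfolding is_walk_def by blast
    with Suc show ?case by auto
  qed simp
  have "walks a b \<subseteq> {p. set p \<subseteq> R \<and> length p = nat (fst b - fst a) + 1}"
  proof
    fix p assume "p \<in> walks a b"
    hence w: "is_walk p" and ne: "p \<noteq> []" and "hd p = a" "last p = b"
      by (auto simp: walks_def is_walk_def)
    hence a: "p ! 0 = a" and b: "p ! (length p - 1) = b"
      by (simp_all add: hd_conv_nth last_conv_nth)
    have len: "fst b = fst a + int (length p - 1)"
      using pos[OF w, of "length p - 1"] a b ne by simp
    have "p ! i \<in> R" if "i < length p" for i
    proof -
      have "int i \<le> fst b - fst a" using len that by linarith
      thus ?thesis using pos[OF w that] a by (auto simp: R_def mem_Times_iff)
    qed
    hence "set p \<subseteq> R" by (metis in_set_conv_nth subsetI)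
    moreover have "length p = nat (fst b - fst a) + 1" using len ne by (cases p) auto
    ultimately show "p \<in> {p. set p \<subseteq> R \<and> length p = nat (fst b - fst a) + 1}" by simp
  qed
  moreover have "finite {p. set p \<subseteq> R \<and> length p = nat (fst b - fst a) + 1}"
    by (rule finite_lists_length_eq) (simp add: R_def)
  ultimately show ?thesis by (rule finite_subset)
qed

lemma finite_vicious_families: "finite (vicious_families n t y)"
  unfolding vicious_families_def
  by (rule finite_Collect_conjI) (intro disjI1, simp only: Collect_mem_eq, intro finite_PiE finite_walks, simp)

end

theory Submission
  imports Defs
begin

text \<open>Stepping all endpoints back by one gives a product recursion for the weight of vicious families.
  A determinant of single-walk weights solves the same recursion, because it vanishes when two endpoints
  coincide or the lowest one is negative. Since a single-walk weight \<open>w\<^sub>\<kappa>\<close> satisfies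
  \<open>w\<^sub>\<kappa>(x) = w\<^sub>1(x) + (\<kappa> - 1) w\<^sub>\<kappa>(x + 2)\<close>, column operations remove \<open>\<kappa>\<close> from all columns but the last.
  The entries are then ballot numbers, and the determinant with last column shifted by \<open>2k\<close> is a polynomial
  in \<open>k (k + a)\<close> with known roots, where \<open>a = y + 2n - 1\<close>. For \<open>t = 2M + y\<close> this yields
  \<open>Z = const \<cdot> \<kappa> \<Sum>\<^sub>k (\<kappa> - 1)\<^sup>k (2k + a) p(k) binom(2M + a, M - k)\<close>.

  For \<open>\<kappa> < 2\<close> the sum is dominated by bounded \<open>k\<close>: the ratio of the binomial to its value at \<open>k = 0\<close> tends to 1,
  and a Vandermonde convolution evaluates the limiting power series. For \<open>\<kappa> > 2\<close> the sum is, up to an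
  exponentially small tail, an expectation of a polynomial in a binomial variable with mean away from the
  centre. At \<open>\<kappa> = 2\<close> the denominator telescopes to a closed product, the numerator is half of a symmetric
  binomial moment up to a bounded number of central terms, and Wallis' product compares the two.\<close>

subsection \<open>Determinants in Leibniz form\<close>

text \<open>Only a logarithmic derivative in \<kappa> is wanted, so the determinant has to be known
  merely up to a factor free of \<kappa> and k; this is why locating its roots suffices and its
  normalization can stay open. In the centred variable z = k + a/2 the polynomial factor in Z is
  odd, while the numerator is an even one minus a/2 times the sum in Z. This parity decides how far
  a sum over half of a binomial row can be completed to the whole row. For \<kappa> > 2 both sums
  can be completed, but the constant term of the answer needs the two highest coefficients of every
  moment, since the leading ones only yield the term linear in t. At \<kappa> = 2 the completed sum
  in Z is zero by oddness, so completion helps for the even part only, and Z itself needs an exact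
  evaluation. For \<kappa> < 2 nothing is completed, because the weights concentrate near the centre
  of the row.\<close>

text \<open>The first argument of \<open>c\<close> is the column index.\<close>

definition cdet :: "nat \<Rightarrow> (nat \<Rightarrow> nat \<Rightarrow> real) \<Rightarrow> real" where
  "cdet n c = (\<Sum>p | p permutes {1..n}. of_int (sign p) * (\<Prod>j=1..n. c j (p j)))"

lemma cdet_cong:
  assumes "\<And>i j. i \<in> {1..n} \<Longrightarrow> j \<in> {1..n} \<Longrightarrow> c j i = d j i"
  shows "cdet n c = cdet n d"
  unfolding cdet_def
  by (intro sum.cong refl arg_cong2[of _ _ _ _ "(*)"] prod.cong assms) (auto dest: permutes_in_image)

lemma cdet_zero_column:
  assumes "j \<in> {1..n}" "\<And>i. i \<in> {1..n} \<Longrightarrow> c j i = 0"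
  shows "cdet n c = 0"
  unfolding cdet_def
proof (rule sum.neutral, safe)
  fix p assume "p permutes {1..n}"
  hence "p j \<in> {1..n}" using assms(1) permutes_in_image by metis
  hence "(\<Prod>j=1..n. c j (p j)) = 0" using assms by (intro prod_zero bexI[of _ j]) auto
  thus "of_int (sign p) * (\<Prod>j=1..n. c j (p j)) = 0" by simp
qed

text \<open>Composing with the transposition of j and k flips the sign of a permutation and, the
  columns being equal, keeps its product; so the sum equals its own negative.\<close>

lemma cdet_equal_columns:
  assumes jk: "j \<in> {1..n}" "k \<in> {1..n}" "j \<noteq> k" and eq: "\<And>i. i \<in> {1..n} \<Longrightarrow> c j i = c k i"
  shows "cdet n c = 0"
proof -
  let ?\<tau> = "Transposition.transpose j k"
  have \<tau>: "?\<tau> permutes {1..n}" by (rule permutes_swap_id[OF jk(1,2)])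
  have "cdet n c = (\<Sum>p | p permutes {1..n}. of_int (sign (p \<circ> ?\<tau>)) * (\<Prod>l=1..n. c l ((p \<circ> ?\<tau>) l)))"
    unfolding cdet_def by (rule sum_permutations_compose_right[OF \<tau>])
  also have "\<dots> = (\<Sum>p | p permutes {1..n}. - (of_int (sign p) * (\<Prod>l=1..n. c l (p l))))"
  proof (rule sum.cong[OF refl], clarify)
    fix p assume p: "p permutes {1..n}"
    have "sign (p \<circ> ?\<tau>) = - sign p"
      using p \<tau> jk by (subst sign_compose) (auto simp: sign_swap_id permutation_permutes)
    moreover have "(\<Prod>l=1..n. c l ((p \<circ> ?\<tau>) l)) = (\<Prod>l=1..n. c (?\<tau> l) (p (?\<tau> l)))"
    proof (rule prod.cong[OF refl])
      fix l assume "l \<in> {1..n}"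
      have "p j \<in> {1..n}" "p k \<in> {1..n}" using p jk permutes_in_image by metis+
      thus "c l ((p \<circ> ?\<tau>) l) = c (?\<tau> l) (p (?\<tau> l))"
        using eq by (auto simp: Transposition.transpose_def)
    qed
    moreover have "\<dots> = (\<Prod>l=1..n. c l (p l))"
      by (rule prod.permute[OF \<tau>, symmetric, of "\<lambda>l. c l (p l)", unfolded comp_def])
    ultimately show "of_int (sign (p \<circ> ?\<tau>)) * (\<Prod>l=1..n. c l ((p \<circ> ?\<tau>) l))
        = - (of_int (sign p) * (\<Prod>l=1..n. c l (p l)))" by simp
  qed
  also have "\<dots> = - cdet n c" unfolding cdet_def by (rule sum_negf)
  finally show ?thesis by simp
qed

text \<open>The replaced column enters each summand through the single factor
  \<open>u (p j)\<close>, which reduces linearity in that column to rearranging sums.\<close>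

lemma cdet_column:
  assumes "j \<in> {1..n}"
  shows "cdet n (c(j := u)) =
    (\<Sum>p | p permutes {1..n}. of_int (sign p) * (\<Prod>l\<in>{1..n} - {j}. c l (p l)) * u (p j))"
  unfolding cdet_def
proof (rule sum.cong[OF refl])
  fix p
  have "(\<Prod>l=1..n. (c(j := u)) l (p l)) = u (p j) * (\<Prod>l\<in>{1..n} - {j}. (c(j := u)) l (p l))"
    using assms by (subst prod.remove[of _ j]) auto
  also have "(\<Prod>l\<in>{1..n} - {j}. (c(j := u)) l (p l)) = (\<Prod>l\<in>{1..n} - {j}. c l (p l))"
    by (rule prod.cong) auto
  finally show "of_int (sign p) * (\<Prod>l=1..n. (c(j := u)) l (p l)) =
      of_int (sign p) * (\<Prod>l\<in>{1..n} - {j}. c l (p l)) * u (p j)" by simp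
qed

lemma cdet_column_sum:
  assumes "j \<in> {1..n}"
  shows "cdet n (c(j := (\<lambda>i. \<Sum>k\<in>K. x k * u k i))) = (\<Sum>k\<in>K. x k * cdet n (c(j := u k)))"
  unfolding cdet_column[OF assms] sum_distrib_left by (subst sum.swap) (simp add: mult_ac)

lemma cdet_column_add:
  assumes "j \<in> {1..n}"
  shows "cdet n (c(j := (\<lambda>i. u i + x * v i))) = cdet n (c(j := u)) + x * cdet n (c(j := v))"
  unfolding cdet_column[OF assms]
  by (simp add: algebra_simps sum.distrib sum_distrib_left)

lemma cdet_column_scale:
  assumes "j \<in> {1..n}"
  shows "cdet n (c(j := (\<lambda>i. x * v i))) = x * cdet n (c(j := v))"
  unfolding cdet_column[OF assms] by (simp add: algebra_simps sum_distrib_left)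

lemma cdet_scale_columns: "cdet n (\<lambda>j i. b j * c j i) = (\<Prod>j=1..n. b j) * cdet n c"
  unfolding cdet_def by (simp add: prod.distrib sum_distrib_left mult_ac)

text \<open>Multilinearity in all columns at once. With \<open>E\<close> = {-1, 1} the choice
  functions \<open>g\<close> are exactly those over which \<open>weight_Suc\<close> sums.\<close>

lemma cdet_sum_columns:
  assumes "finite E"
  shows "cdet n (\<lambda>j i. \<Sum>\<epsilon>\<in>E. f j \<epsilon> i) = (\<Sum>g\<in>(\<Pi>\<^sub>E j\<in>{1..n}. E). cdet n (\<lambda>j. f j (g j)))"
proof -
  have "cdet n (\<lambda>j i. \<Sum>\<epsilon>\<in>E. f j \<epsilon> i) = (\<Sum>p | p permutes {1..n}. of_int (sign p) *
      (\<Sum>g\<in>(\<Pi>\<^sub>E j\<in>{1..n}. E). \<Prod>j=1..n. f j (g j) (p j)))"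
    unfolding cdet_def using assms by (subst prod_sum_PiE) auto
  thus ?thesis unfolding cdet_def by (simp add: sum_distrib_left) (rule sum.swap)
qed

text \<open>Every permutation of {1..n} other than the identity moves some j to a smaller value, and
  that factor is zero.\<close>

lemma cdet_triangular:
  assumes "\<And>i j. i \<in> {1..n} \<Longrightarrow> j \<in> {1..n} \<Longrightarrow> i < j \<Longrightarrow> c j i = 0"
  shows "cdet n c = (\<Prod>j=1..n. c j j)"
proof -
  have "cdet n c = (\<Sum>p\<in>{id}. of_int (sign p) * (\<Prod>j=1..n. c j (p j)))"
    unfolding cdet_def
  proof (rule sum.mono_neutral_right)
    show "finite {p. p permutes {1..n}}" by (rule finite_permutations) simp
    show "\<forall>p\<in>{p. p permutes {1..n}} - {id}. of_int (sign p) * (\<Prod>j=1..n. c j (p j)) = 0"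
    proof
      fix p assume p: "p \<in> {p. p permutes {1..n}} - {id}"
      hence perm: "p permutes {1..n}" and "p \<noteq> id" by auto
      hence "\<not> (\<forall>j\<in>{1..n}. p j \<ge> j)" using permutes_natset_ge by blast
      then obtain j where j: "j \<in> {1..n}" "p j < j" by (meson not_le)
      moreover have "p j \<in> {1..n}" using permutes_in_image[OF perm, of j] j(1) by blast
      ultimately have "c j (p j) = 0" using assms by blast
      hence "(\<Prod>j=1..n. c j (p j)) = 0" using j by (intro prod_zero) auto
      thus "of_int (sign p) * (\<Prod>j=1..n. c j (p j)) = 0" by simp
    qed
  qed (auto simp: permutes_id)
  thus ?thesis by simp
qed

subsection \<open>Vicious families and their transfer recursion\<close>

lemma is_walk_snoc:
  assumes "q \<noteq> []"
  shows "is_walk (q @ [v]) \<longleftrightarrow> is_walk q \<and> snd v \<ge> 0 \<and>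
    fst v = fst (last q) + 1 \<and> snd v - snd (last q) \<in> {1, -1}"
proof
  assume w: "is_walk (q @ [v])"
  have "is_walk q"
    unfolding is_walk_def
  proof (intro conjI allI impI)
    fix i assume i: "Suc i < length q"
    have "(fst ((q @ [v]) ! Suc i) - fst ((q @ [v]) ! i), snd ((q @ [v]) ! Suc i) - snd ((q @ [v]) ! i))
        \<in> {(1, 1), (1, -1)}"
      using w i unfolding is_walk_def by simp
    thus "(fst (q ! Suc i) - fst (q ! i), snd (q ! Suc i) - snd (q ! i)) \<in> {(1, 1), (1, -1)}"
      using i by (simp add: nth_append)
  next
    show "q \<noteq> []" by fact
    show "\<forall>v\<in>set q. snd v \<ge> 0" using w unfolding is_walk_def by simp
  qed
  moreover have "(fst ((q @ [v]) ! length q) - fst ((q @ [v]) ! (length q - 1)),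
      snd ((q @ [v]) ! length q) - snd ((q @ [v]) ! (length q - 1))) \<in> {(1, 1), (1, -1)}"
  proof -
    have "Suc (length q - 1) = length q" using assms by simp
    thus ?thesis using w unfolding is_walk_def by (metis length_append_singleton lessI)
  qed
  hence "(fst v - fst (last q), snd v - snd (last q)) \<in> {(1, 1), (1, -1)}"
    using assms by (simp add: nth_append last_conv_nth)
  moreover have "snd v \<ge> 0" using w unfolding is_walk_def by simp
  ultimately show "is_walk q \<and> snd v \<ge> 0 \<and>
    fst v = fst (last q) + 1 \<and> snd v - snd (last q) \<in> {1, -1}" by auto
next
  assume r: "is_walk q \<and> snd v \<ge> 0 \<and> fst v = fst (last q) + 1 \<and> snd v - snd (last q) \<in> {1, -1}"
  show "is_walk (q @ [v])"
    unfolding is_walk_def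
  proof (intro conjI allI impI)
    fix i assume i: "Suc i < length (q @ [v])"
    show "(fst ((q @ [v]) ! Suc i) - fst ((q @ [v]) ! i), snd ((q @ [v]) ! Suc i) - snd ((q @ [v]) ! i))
        \<in> {(1, 1), (1, -1)}"
    proof (cases "Suc i < length q")
      case True
      thus ?thesis using r unfolding is_walk_def by (simp add: nth_append)
    next
      case False
      hence "Suc i = length q" using i by simp
      hence *: "(q @ [v]) ! Suc i = v" "(q @ [v]) ! i = last q"
        using assms by (auto simp: nth_append last_conv_nth dest: sym)
      show ?thesis unfolding * using r by auto
    qed
  next
    show "\<forall>v\<in>set (q @ [v]). snd v \<ge> 0" using r unfolding is_walk_def by simp
  qed simp
qed

text \<open>Time can be read off a point, so a point appended at time t + 1 never meets an older
  one.\<close>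

lemma walks_nth:
  assumes "p \<in> walks (0, b) (int t, h)"
  shows "length p = Suc t" and "s \<le> t \<Longrightarrow> fst (p ! s) = int s"
proof -
  have w: "is_walk p" and ne: "p \<noteq> []" and hd: "hd p = (0, b)" and last: "last p = (int t, h)"
    using assms by (auto simp: walks_def is_walk_def)
  have pos: "fst (p ! i) = int i" if "i < length p" for i
    using that
  proof (induction i)
    case 0 thus ?case using hd ne by (simp add: hd_conv_nth)
  next
    case (Suc i)
    have "(fst (p ! Suc i) - fst (p ! i), snd (p ! Suc i) - snd (p ! i)) \<in> {(1, 1), (1, -1)}"
      using w Suc.prems unfolding is_walk_def by blast
    with Suc show ?case by auto
  qed
  have "int t = int (length p - 1)" using pos[of "length p - 1"] last ne by (simp add: last_conv_nth)
  thus l: "length p = Suc t" using ne by (cases p) auto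
  show "fst (p ! s) = int s" if "s \<le> t" using pos l that by simp
qed

lemma walks_0: "walks (0, b) (0, h) = (if h = b \<and> 0 \<le> b then {[(0, b)]} else {})"
proof -
  have "p = [(0, b)] \<and> h = b \<and> 0 \<le> b" if "p \<in> walks (0, b) (0, h)" for p
  proof -
    have "length p = 1" using walks_nth(1)[of p b 0 h] that by simp
    then obtain v where "p = [v]" by (metis One_nat_def length_0_conv length_Suc_conv)
    thus ?thesis using that by (auto simp: walks_def is_walk_def)
  qed
  moreover have "[(0, b)] \<in> walks (0, b) (0, b)" if "0 \<le> b"
    using that by (simp add: walks_def is_walk_def)
  ultimately show ?thesis by auto
qed

lemma walks_Suc:
  "p \<in> walks (0, b) (int (Suc t), h) \<longleftrightarrow>
    0 \<le> h \<and> (\<exists>q. \<exists>\<epsilon>\<in>{-1, 1}. q \<in> walks (0, b) (int t, h + \<epsilon>) \<and> p = q @ [(int (Suc t), h)])"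
proof
  assume p: "p \<in> walks (0, b) (int (Suc t), h)"
  have len: "length p = Suc (Suc t)" using walks_nth(1)[OF p] .
  define q where "q = butlast p"
  have "length q = Suc t" "p \<noteq> []" using len by (auto simp: q_def)
  moreover have "last p = (int (Suc t), h)" using p by (simp add: walks_def)
  ultimately have q: "q \<noteq> []" "p = q @ [(int (Suc t), h)]"
    unfolding q_def using append_butlast_last_id[of p] by force+
  have "hd q = (0, b)" using p q by (simp add: walks_def)
  moreover have "is_walk q" "h \<ge> 0" "int (Suc t) = fst (last q) + 1" "h - snd (last q) \<in> {1, -1}"
    using p unfolding q(2) walks_def by (simp_all add: is_walk_snoc[OF q(1)])
  moreover from this have "last q = (int t, h + (snd (last q) - h))" "snd (last q) - h \<in> {-1, 1}"
    by (auto simp: prod_eq_iff)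
  ultimately show "0 \<le> h \<and> (\<exists>q. \<exists>\<epsilon>\<in>{-1, 1}. q \<in> walks (0, b) (int t, h + \<epsilon>) \<and> p = q @ [(int (Suc t), h)])"
    using q(2) unfolding walks_def by blast
next
  assume "0 \<le> h \<and> (\<exists>q. \<exists>\<epsilon>\<in>{-1, 1}. q \<in> walks (0, b) (int t, h + \<epsilon>) \<and> p = q @ [(int (Suc t), h)])"
  then obtain q \<epsilon> where "0 \<le> h" "\<epsilon> \<in> {-1, 1}" "q \<in> walks (0, b) (int t, h + \<epsilon>)"
    and p: "p = q @ [(int (Suc t), h)]" by blast
  moreover from this have "q \<noteq> []" by (auto simp: walks_def is_walk_def)
  ultimately show "p \<in> walks (0, b) (int (Suc t), h)"
    unfolding walks_def by (auto simp: is_walk_snoc)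
qed

text \<open>Arbitrary end heights, because undoing the last step of every walk leaves the arithmetic
  progression of end points in \<open>vicious_families\<close>.\<close>

definition families :: "nat \<Rightarrow> nat \<Rightarrow> (nat \<Rightarrow> int) \<Rightarrow> (nat \<Rightarrow> (int \<times> int) list) set" where
  "families n t e = {P \<in> (\<Pi>\<^sub>E i\<in>{1..n}. walks (0, 2 * int i - 2) (int t, e i)). vicious n P}"

definition weight :: "real \<Rightarrow> nat \<Rightarrow> nat \<Rightarrow> (nat \<Rightarrow> int) \<Rightarrow> real" where
  "weight \<kappa> n t e = (\<Sum>P\<in>families n t e. \<kappa> ^ contacts n P)"

definition snoc_family :: "nat \<Rightarrow> nat \<Rightarrow> (nat \<Rightarrow> int) \<Rightarrow> (nat \<Rightarrow> (int \<times> int) list) \<Rightarrow> nat \<Rightarrow> (int \<times> int) list" where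
  "snoc_family n t e Q = (\<lambda>i\<in>{1..n}. Q i @ [(int (Suc t), e i)])"

lemma finite_families: "finite (families n t e)"
  unfolding families_def
  by (rule finite_Collect_conjI) (intro disjI1, simp only: Collect_mem_eq, intro finite_PiE finite_walks, simp)

lemma in_set_walk_iff:
  assumes "p \<in> walks (0, b) (int t, h)"
  shows "v \<in> set p \<longleftrightarrow> (\<exists>s\<le>t. v = p ! s)"
  using walks_nth(1)[OF assms] by (auto simp: in_set_conv_nth less_Suc_eq_le)

lemma walk_time_le:
  assumes "p \<in> walks (0, b) (int t, h)" "v \<in> set p"
  shows "fst v \<le> int t"
  using assms walks_nth(2)[OF assms(1)] by (auto simp: in_set_walk_iff)

text \<open>A family amounts to its last steps, read backwards as \<open>g\<close>, together with
  its truncation at time t. The appended points must be distinct and not below the axis; older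
  points are no obstacle, as their time is smaller.\<close>

lemma snoc_families:
  assumes nonneg: "\<And>i. i \<in> {1..n} \<Longrightarrow> e i \<ge> 0" and inj: "inj_on e {1..n}"
  shows "bij_betw (\<lambda>(g, Q). snoc_family n t e Q)
    (SIGMA g:(\<Pi>\<^sub>E i\<in>{1..n}. {-1, 1}). families n t (\<lambda>i. e i + g i)) (families n (Suc t) e)"
  unfolding bij_betw_def
proof
  show "inj_on (\<lambda>(g, Q). snoc_family n t e Q)
      (SIGMA g:(\<Pi>\<^sub>E i\<in>{1..n}. {-1, 1}). families n t (\<lambda>i. e i + g i))"
  proof (rule inj_onI, clarify)
    fix g Q g' Q'
    assume g: "g \<in> (\<Pi>\<^sub>E i\<in>{1..n}. {-1, 1})" and Q: "Q \<in> families n t (\<lambda>i. e i + g i)"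
      and g': "g' \<in> (\<Pi>\<^sub>E i\<in>{1..n}. {-1, 1})" and Q': "Q' \<in> families n t (\<lambda>i. e i + g' i)"
      and eq: "snoc_family n t e Q = snoc_family n t e Q'"
    have E: "Q i = Q' i" if "i \<in> {1..n}" for i
      using fun_cong[OF eq, of i] that by (simp add: snoc_family_def)
    have "Q = Q'" using Q Q' E unfolding families_def
      by (intro extensionalityI[of _ "{1..n}"]) (auto simp: PiE_def)
    moreover have "g i = g' i" if "i \<in> {1..n}" for i
    proof -
      have "last (Q i) = (int t, e i + g i)" "last (Q' i) = (int t, e i + g' i)"
        using Q Q' that by (auto simp: families_def walks_def dest!: PiE_mem)
      thus ?thesis using E[OF that] by simp
    qed
    hence "g = g'" using g g' by (intro extensionalityI[of _ "{1..n}"]) (auto simp: PiE_def)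
    ultimately show "g = g' \<and> Q = Q'" by simp
  qed
  show "(\<lambda>(g, Q). snoc_family n t e Q) `
      (SIGMA g:(\<Pi>\<^sub>E i\<in>{1..n}. {-1, 1}). families n t (\<lambda>i. e i + g i)) = families n (Suc t) e"
  proof (intro equalityI subsetI)
    fix P assume "P \<in> (\<lambda>(g, Q). snoc_family n t e Q) `
      (SIGMA g:(\<Pi>\<^sub>E i\<in>{1..n}. {-1, 1}). families n t (\<lambda>i. e i + g i))"
    then obtain g Q where g: "g \<in> (\<Pi>\<^sub>E i\<in>{1..n}. {-1, 1::int})"
      and Q: "Q \<in> families n t (\<lambda>i. e i + g i)" and P: "P = snoc_family n t e Q" by auto
    have walk: "Q i \<in> walks (0, 2 * int i - 2) (int t, e i + g i)" if "i \<in> {1..n}" for i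
      using Q that by (auto simp: families_def)
    have "P i \<in> walks (0, 2 * int i - 2) (int (Suc t), e i)" if "i \<in> {1..n}" for i
      unfolding walks_Suc using walk[OF that] nonneg[OF that] PiE_mem[OF g that] that
      by (intro conjI exI[of _ "Q i"] bexI[of _ "g i"]) (auto simp: P snoc_family_def)
    moreover have "vicious n P"
      unfolding vicious_def
    proof (intro ballI impI)
      fix i j assume ij: "i \<in> {1..n}" "j \<in> {1..n}" "i \<noteq> j"
      have "set (Q i) \<inter> set (Q j) = {}" using Q ij by (auto simp: families_def vicious_def)
      moreover have "e i \<noteq> e j" using inj ij by (auto dest: inj_onD)
      moreover have "(int (Suc t), h) \<notin> set (Q l)" if "l \<in> {1..n}" for l h
        using walk_time_le[OF walk[OF that], of "(int (Suc t), h)"] by auto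
      ultimately show "set (P i) \<inter> set (P j) = {}" using ij by (auto simp: P snoc_family_def)
    qed
    moreover have "P \<in> extensional {1..n}" by (simp add: P snoc_family_def)
    ultimately show "P \<in> families n (Suc t) e" by (auto simp: families_def PiE_def)
  next
    fix P assume P: "P \<in> families n (Suc t) e"
    have "\<forall>i\<in>{1..n}. \<exists>q \<epsilon>. \<epsilon> \<in> {-1, 1} \<and> q \<in> walks (0, 2 * int i - 2) (int t, e i + \<epsilon>) \<and>
        P i = q @ [(int (Suc t), e i)]"
    proof
      fix i assume i: "i \<in> {1..n}"
      hence "P i \<in> walks (0, 2 * int i - 2) (int (Suc t), e i)" using P by (auto simp: families_def)
      thus "\<exists>q \<epsilon>. \<epsilon> \<in> {-1, 1} \<and> q \<in> walks (0, 2 * int i - 2) (int t, e i + \<epsilon>) \<and>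
        P i = q @ [(int (Suc t), e i)]"
        unfolding walks_Suc by blast
    qed
    then obtain Q0 g0 where Qg: "\<And>i. i \<in> {1..n} \<Longrightarrow> g0 i \<in> {-1, 1} \<and>
        Q0 i \<in> walks (0, 2 * int i - 2) (int t, e i + g0 i) \<and> P i = Q0 i @ [(int (Suc t), e i)]"
      by metis
    define g where "g = restrict g0 {1..n}"
    define Q where "Q = restrict Q0 {1..n}"
    have "g \<in> (\<Pi>\<^sub>E i\<in>{1..n}. {-1, 1})" using Qg by (auto simp: g_def)
    moreover have "vicious n Q"
      unfolding vicious_def
    proof (intro ballI impI)
      fix i j assume ij: "i \<in> {1..n}" "j \<in> {1..n}" "i \<noteq> j"
      have "set (P i) \<inter> set (P j) = {}" using P ij by (auto simp: families_def vicious_def)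
      thus "set (Q i) \<inter> set (Q j) = {}" using Qg[OF ij(1)] Qg[OF ij(2)] ij by (auto simp: Q_def)
    qed
    hence "Q \<in> families n t (\<lambda>i. e i + g i)"
      using Qg by (auto simp: families_def Q_def g_def)
    moreover have "P = snoc_family n t e Q"
    proof
      fix i show "P i = snoc_family n t e Q i"
        using Qg[of i] P by (cases "i \<in> {1..n}")
          (auto simp: snoc_family_def Q_def families_def PiE_def extensional_def)
    qed
    ultimately show "P \<in> (\<lambda>(g, Q). snoc_family n t e Q) `
      (SIGMA g:(\<Pi>\<^sub>E i\<in>{1..n}. {-1, 1}). families n t (\<lambda>i. e i + g i))"
      by (intro image_eqI[of _ _ "(g, Q)"]) simp_all
  qed
qed

text \<open>Since \<open>e\<close> is injective, at most one end point lies on the axis, so the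
  product over all end points is \<kappa> or 1 and matches the at most one new contact.\<close>

lemma contacts_snoc_family:
  assumes Q: "Q \<in> families n t f" and inj: "inj_on e {1..n}"
  shows "\<kappa> ^ contacts n (snoc_family n t e Q) = (\<Prod>i=1..n. if e i = 0 then \<kappa> else 1) * (\<kappa>::real) ^ contacts n Q"
proof -
  have walk: "Q i \<in> walks (0, 2 * int i - 2) (int t, f i)" if "i \<in> {1..n}" for i
    using Q that by (auto simp: families_def)
  let ?C = "{v. (\<exists>i\<in>{1..n}. v \<in> set (Q i)) \<and> snd v = 0}"
  have fin: "finite ?C" by (rule finite_subset[of _ "\<Union>i\<in>{1..n}. set (Q i)"]) auto
  have new: "(int (Suc t), h) \<notin> ?C" for h
    using walk_time_le[OF walk, of _ "(int (Suc t), h)"] by force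
  show ?thesis
  proof (cases "\<exists>j\<in>{1..n}. e j = 0")
    case True
    then obtain j where j: "j \<in> {1..n}" "e j = 0" by blast
    have "{v. (\<exists>i\<in>{1..n}. v \<in> set (snoc_family n t e Q i)) \<and> snd v = 0} = insert (int (Suc t), 0) ?C"
      using j by (force simp: snoc_family_def)
    hence "contacts n (snoc_family n t e Q) = Suc (contacts n Q)"
      unfolding contacts_def using card_insert_disjoint[OF fin new] by simp
    moreover have "(\<Prod>i=1..n. if e i = 0 then \<kappa> else 1) = \<kappa>"
    proof -
      have "(\<Prod>i\<in>{1..n} - {j}. if e i = 0 then \<kappa> else 1) = 1"
        using inj_on_eq_iff[OF inj _ j(1)] j(2) by (intro prod.neutral) auto
      thus ?thesis using j by (subst prod.remove[of _ j]) auto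
    qed
    ultimately show ?thesis by simp
  next
    case False
    hence "{v. (\<exists>i\<in>{1..n}. v \<in> set (snoc_family n t e Q i)) \<and> snd v = 0} = ?C"
      by (force simp: snoc_family_def)
    moreover have "(\<Prod>i=1..n. if e i = 0 then \<kappa> else 1) = 1"
      using False by (intro prod.neutral) auto
    ultimately show ?thesis unfolding contacts_def by simp
  qed
qed

lemma weight_Suc:
  assumes nonneg: "\<And>i. i \<in> {1..n} \<Longrightarrow> e i \<ge> 0" and inj: "inj_on e {1..n}"
  shows "weight \<kappa> n (Suc t) e = (\<Prod>i=1..n. if e i = 0 then \<kappa> else 1) *
    (\<Sum>g\<in>(\<Pi>\<^sub>E i\<in>{1..n}. {-1, 1}). weight \<kappa> n t (\<lambda>i. e i + g i))"
proof -
  let ?S = "SIGMA g:(\<Pi>\<^sub>E i\<in>{1..n}. {-1, 1}). families n t (\<lambda>i. e i + g i)"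
  have "weight \<kappa> n (Suc t) e = (\<Sum>(g, Q)\<in>?S. \<kappa> ^ contacts n (snoc_family n t e Q))"
    unfolding weight_def
    by (subst sum.reindex_bij_betw[OF snoc_families[OF assms], symmetric]) (auto simp: case_prod_beta)
  also have "\<dots> = (\<Sum>(g, Q)\<in>?S. (\<Prod>i=1..n. if e i = 0 then \<kappa> else 1) * \<kappa> ^ contacts n Q)"
    by (rule sum.cong) (auto simp: contacts_snoc_family[OF _ inj])
  also have "\<dots> = (\<Sum>g\<in>(\<Pi>\<^sub>E i\<in>{1..n}. {-1, 1}). \<Sum>Q\<in>families n t (\<lambda>i. e i + g i).
      (\<Prod>i=1..n. if e i = 0 then \<kappa> else 1) * \<kappa> ^ contacts n Q)"
    by (subst sum.Sigma) (auto intro: finite_PiE finite_families)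
  finally show ?thesis unfolding weight_def by (simp add: sum_distrib_left)
qed

text \<open>Illegal step choices contribute nothing, so the sum in \<open>weight_Suc\<close> may run
  over all sign vectors.\<close>

lemma weight_empty:
  assumes "i \<in> {1..n}" "e i < 0 \<or> (\<exists>j\<in>{1..n}. i \<noteq> j \<and> e i = e j)"
  shows "weight \<kappa> n t e = 0"
proof -
  have "families n t e = {}"
  proof (rule equals0I)
    fix P assume P: "P \<in> families n t e"
    have last: "(int t, e j) \<in> set (P j)" "e j \<ge> 0" if "j \<in> {1..n}" for j
    proof -
      have "P j \<in> walks (0, 2 * int j - 2) (int t, e j)" using P that by (auto simp: families_def)
      thus "(int t, e j) \<in> set (P j)" "e j \<ge> 0"
        unfolding walks_def is_walk_def by (force dest: last_in_set)+
    qed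
    then obtain j where j: "j \<in> {1..n}" "i \<noteq> j" "e i = e j" using assms by force
    have "set (P i) \<inter> set (P j) = {}" using P assms(1) j by (auto simp: families_def vicious_def)
    thus False using last[OF assms(1)] last[OF j(1)] j by auto
  qed
  thus ?thesis by (simp add: weight_def)
qed

text \<open>Walks start at the origin and only points after the start are weighted; the contact of
  the lowest walk at time 0 is the separate factor \<kappa> in
  \<open>weight_eq_cdet\<close>.\<close>

primrec walk_weight :: "real \<Rightarrow> nat \<Rightarrow> int \<Rightarrow> real" where
  "walk_weight \<kappa> 0 x = (if x = 0 then 1 else 0)"
| "walk_weight \<kappa> (Suc t) x = (if x < 0 then 0 else
     (if x = 0 then \<kappa> else 1) * (walk_weight \<kappa> t (x - 1) + walk_weight \<kappa> t (x + 1)))"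

lemma walk_weight_neg: "x < 0 \<Longrightarrow> walk_weight \<kappa> t x = 0"
  by (cases t) auto

lemma walk_weight_beyond: "x > int t \<Longrightarrow> walk_weight \<kappa> t x = 0"
  by (induction t arbitrary: x) auto

lemma walk_weight_diagonal: "walk_weight \<kappa> t (int t) = 1"
  by (induction t) (auto simp: walk_weight_beyond)

text \<open>Away from the axis the recursion is linear and invariant under shifts, so only x = 0
  needs an argument. There the surplus (\<kappa> - 1) times \<open>walk_weight \<kappa> t 1\<close>
  is the part of \<open>walk_weight \<kappa> (Suc t) 2\<close> that arrives from height 1.\<close>

lemma walk_weight_split:
  "x \<ge> 0 \<Longrightarrow> walk_weight \<kappa> t x = walk_weight 1 t x + (\<kappa> - 1) * walk_weight \<kappa> t (x + 2)"
proof (induction t arbitrary: x)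
  case (Suc t)
  show ?case
  proof (cases "x = 0")
    case True
    have "walk_weight \<kappa> t 1 = walk_weight 1 t 1 + (\<kappa> - 1) * walk_weight \<kappa> t 3"
      using Suc.IH[of 1] by simp
    hence "\<kappa> * walk_weight \<kappa> t 1 = walk_weight 1 t 1 + (\<kappa> - 1) * (walk_weight \<kappa> t 1 + walk_weight \<kappa> t 3)"
      by algebra
    thus ?thesis using True by (simp add: walk_weight_neg)
  next
    case False
    have "walk_weight \<kappa> t (x - 1) = walk_weight 1 t (x - 1) + (\<kappa> - 1) * walk_weight \<kappa> t (x + 1)"
      "walk_weight \<kappa> t (x + 1) = walk_weight 1 t (x + 1) + (\<kappa> - 1) * walk_weight \<kappa> t (x + 3)"
      using Suc.IH[of "x - 1"] Suc.IH[of "x + 1"] Suc.prems False by (simp_all add: add_ac)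
    hence "walk_weight \<kappa> t (x - 1) + walk_weight \<kappa> t (x + 1) = walk_weight 1 t (x - 1)
        + walk_weight 1 t (x + 1) + (\<kappa> - 1) * (walk_weight \<kappa> t (x + 1) + walk_weight \<kappa> t (x + 3))"
      by algebra
    thus ?thesis using False Suc.prems by (simp add: add_ac)
  qed
qed simp

text \<open>K is kept free so that the remainder can later be pushed beyond the reach of the
  walk.\<close>

lemma walk_weight_expand:
  assumes "x \<ge> 0"
  shows "walk_weight \<kappa> t x = (\<Sum>k<K. (\<kappa> - 1) ^ k * walk_weight 1 t (x + 2 * int k))
    + (\<kappa> - 1) ^ K * walk_weight \<kappa> t (x + 2 * int K)"
proof (induction K)
  case (Suc K)
  have "walk_weight \<kappa> t (x + 2 * int K) = walk_weight 1 t (x + 2 * int K)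
      + (\<kappa> - 1) * walk_weight \<kappa> t (x + 2 * int (Suc K))"
    using walk_weight_split[of "x + 2 * int K" \<kappa> t] assms by (simp add: add_ac)
  thus ?case using Suc by (simp add: distrib_left mult_ac)
qed simp

text \<open>Here m counts the down steps. The factorial form, unlike a difference of binomials,
  exposes the linear factor x + 1 that later becomes 2k + a.\<close>

lemma ballot_number:
  "walk_weight 1 (2 * m + x) (int x) = real (x + 1) * fact (2 * m + x) / (fact m * fact (m + x + 1))"
proof (induction "2 * m + x" arbitrary: m x)
  case 0
  thus ?case by simp
next
  case (Suc t)
  have f: "fact (2 * m + x) = real (2 * m + x) * fact t" using Suc.hyps(2) by (metis fact_Suc of_nat_fact of_nat_mult)
  show ?case
  proof (cases x)
    case 0
    then obtain m' where m: "m = Suc m'" using Suc.hyps(2) by (cases m) auto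
    have "t = 2 * m' + 1" using Suc.hyps(2) 0 m by simp
    hence "walk_weight 1 t 1 = 2 * fact t / (fact m' * fact (m' + 2))"
      using Suc.hyps(1)[of m' 1] by simp
    moreover have "walk_weight 1 (2 * m + x) (int x) = walk_weight 1 t 1"
      unfolding Suc.hyps(2)[symmetric] using 0 by (simp add: walk_weight_neg)
    moreover have "fact m = real (m' + 1) * fact m'" "m + x + 1 = m' + 2"
      "real (x + 1) * (real (2 * m + x) * fact t) = (2 * fact t) * real (m' + 1)"
      using m 0 by auto
    moreover have "2 * fact t / (F * G) = (2 * fact t) * real (m' + 1) / (real (m' + 1) * F * G)" for F G :: real
      by simp
    ultimately show ?thesis unfolding f by (simp only:)
  next
    case (Suc x')
    have t: "t = 2 * m + x'" using Suc.hyps(2) Suc by simp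
    have A: "walk_weight 1 t (int x') = real (x' + 1) * fact t / (fact m * fact (m + x' + 1))"
      using Suc.hyps(1)[of m x'] t by simp
    have "walk_weight 1 (2 * m + x) (int x) = walk_weight 1 t (int x') + walk_weight 1 t (int x' + 2)"
      unfolding Suc.hyps(2)[symmetric] using Suc by (simp add: add.commute)
    also have "walk_weight 1 t (int x' + 2) = real m * real (x' + 3) * fact t / (fact m * fact (m + x' + 2))"
    proof (cases m)
      case 0
      thus ?thesis using t by (simp add: walk_weight_beyond)
    next
      case (Suc m')
      thus ?thesis using Suc.hyps(1)[of m' "x' + 2"] t by (simp add: add.commute)
    qed
    finally have "walk_weight 1 (2 * m + x) (int x) = real (x' + 1) * fact t / (fact m * fact (m + x' + 1))
        + real m * real (x' + 3) * fact t / (fact m * fact (m + x' + 2))" unfolding A .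
    moreover have "(fact (m + x' + 2) :: real) = real (m + x' + 2) * fact (m + x' + 1)" by simp
    moreover have "m + x + 1 = m + x' + 2" using Suc by simp
    moreover have "real (x' + 1) * T / (F * G) + real m * real (x' + 3) * T / (F * (real (m + x' + 2) * G))
        = real (x + 1) * (real (2 * m + x) * T) / (F * (real (m + x' + 2) * G))"
      if "F \<noteq> 0" "G \<noteq> 0" for F G T :: real
      using that Suc by (simp add: divide_simps) (simp add: algebra_simps)
    ultimately show ?thesis unfolding f by simp
  qed
qed

lemma fact_eq_prod_mult:
  "r \<le> q \<Longrightarrow> (fact q :: real) = fact (q - r) * (\<Prod>l<r. real q - real l)"
proof (induction r)
  case (Suc r)
  have "(fact (q - r) :: real) = real (q - r) * fact (q - Suc r)"
    using Suc.prems by (metis Suc_diff_Suc Suc_le_lessD fact_Suc of_nat_fact of_nat_mult)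
  thus ?case using Suc by (simp add: of_nat_diff)
qed simp

text \<open>Trades the denominator belonging to the length s for one that depends only on q and x,
  at the price of 2r linear factors. With r = n - i all rows i then share one denominator. For r > q
  the factor at l = q vanishes, and the height is indeed out of reach.\<close>

lemma ballot_number_prod:
  assumes "s + 2 * r = x + 2 * q"
  shows "walk_weight 1 s (int x) = real (x + 1) / (fact q * fact (q + x + 1)) *
    (fact s * (\<Prod>l<r. (real q - real l) * (real (q + x + 1) - real l)))"
proof (cases "r \<le> q")
  case True
  have s: "s = 2 * (q - r) + x" using assms True by simp
  have "(fact (q + x + 1) :: real) = fact (q - r + x + 1) * (\<Prod>l<r. real (q + x + 1) - real l)"
    using fact_eq_prod_mult[of r "q + x + 1"] True by (simp del: fact_Suc add: Suc_diff_le)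
  moreover have "(\<Prod>l<r. real q - real l) \<noteq> 0" "(\<Prod>l<r. real (q + x + 1) - real l) \<noteq> 0"
    using True by auto
  ultimately show ?thesis
    unfolding fact_eq_prod_mult[OF True] prod.distrib ballot_number[of "q - r" x, folded s]
    by (simp del: fact_Suc)
next
  case False
  hence "(\<Prod>l<r. (real q - real l) * (real (q + x + 1) - real l)) = 0"
    by (intro prod_zero) (auto intro!: bexI[of _ q])
  moreover have "int s < int x" using False assms by linarith
  ultimately show ?thesis by (simp add: walk_weight_beyond)
qed

section \<open>The weight of vicious families as a determinant\<close>

lemma families_cong:
  assumes "\<And>i. i \<in> {1..n} \<Longrightarrow> e i = f i"
  shows "families n t e = families n t f"
proof -
  have "(\<Pi>\<^sub>E i\<in>{1..n}. walks (0, 2 * int i - 2) (int t, e i))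
      = (\<Pi>\<^sub>E i\<in>{1..n}. walks (0, 2 * int i - 2) (int t, f i))"
    by (rule PiE_cong) (simp add: assms)
  thus ?thesis by (simp add: families_def)
qed

lemma weight_0: "n \<ge> 1 \<Longrightarrow> weight \<kappa> n 0 (\<lambda>i. 2 * int i - 2) = \<kappa>"
proof -
  assume n: "n \<ge> 1"
  let ?P = "\<lambda>i\<in>{1..n}. [(0::int, 2 * int i - 2)]"
  have "families n 0 (\<lambda>i. 2 * int i - 2) = {?P}"
  proof (intro equalityI subsetI)
    fix P assume "P \<in> families n 0 (\<lambda>i. 2 * int i - 2)"
    hence P: "P \<in> (\<Pi>\<^sub>E i\<in>{1..n}. walks (0, 2 * int i - 2) (0, 2 * int i - 2))"
      by (simp add: families_def)
    have "P = ?P"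
    proof
      fix i show "P i = ?P i"
        using P PiE_mem[OF P, of i] by (cases "i \<in> {1..n}") (auto simp: walks_0 split: if_splits)
    qed
    thus "P \<in> {?P}" by simp
  next
    fix P assume "P \<in> {?P}"
    thus "P \<in> families n 0 (\<lambda>i. 2 * int i - 2)"
      by (auto simp: families_def vicious_def walks_0)
  qed
  moreover have "{v. (\<exists>i\<in>{1..n}. v \<in> set (?P i)) \<and> snd v = 0} = {(0, 0)}"
    using n by force
  ultimately show ?thesis by (simp add: weight_def contacts_def)
qed

text \<open>Row i counts walks of length t + 2(i - 1) from the origin, as though the i-th walk had
  started at (-2(i - 1), 0); at time 0 and for the initial end points the matrix is then triangular
  with unit diagonal. Parity keeps neighbouring end points at distance at least 2, so one step can
  make them meet but not cross.\<close>

lemma weight_eq_cdet: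
  assumes "n \<ge> 1" "\<And>i. i \<in> {1..n} \<Longrightarrow> e i \<ge> 0"
    "\<And>i j. i \<in> {1..n} \<Longrightarrow> j \<in> {1..n} \<Longrightarrow> i < j \<Longrightarrow> e i < e j"
    "\<And>i. i \<in> {1..n} \<Longrightarrow> even (e i - int t)"
  shows "weight \<kappa> n t e = \<kappa> * cdet n (\<lambda>j i. walk_weight \<kappa> (t + 2 * (i - 1)) (e j))"
  using assms
proof (induction t arbitrary: e)
  case 0
  have ge: "e i \<ge> 2 * int i - 2" if "i \<in> {1..n}" for i
    using that
  proof (induction i)
    case (Suc i)
    show ?case
    proof (cases "i = 0")
      case False
      hence "i \<in> {1..n}" using Suc.prems by auto
      hence "e i \<ge> 2 * int i - 2" "e i < e (Suc i)" "even (e i)" "even (e (Suc i))"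
        using Suc.IH 0 Suc.prems by auto
      thus ?thesis by (auto elim!: evenE)
    qed (use 0 Suc.prems in auto)
  qed simp
  show ?case
  proof (cases "\<forall>i\<in>{1..n}. e i = 2 * int i - 2")
    case True
    have "cdet n (\<lambda>j i. walk_weight \<kappa> (0 + 2 * (i - 1)) (e j))
        = cdet n (\<lambda>j i. walk_weight \<kappa> (2 * (i - 1)) (int (2 * (j - 1))))"
      using True by (intro cdet_cong) (auto simp: of_nat_diff)
    also have "\<dots> = 1"
      by (subst cdet_triangular) (auto simp: walk_weight_beyond walk_weight_diagonal simp del: of_nat_mult)
    finally have "cdet n (\<lambda>j i. walk_weight \<kappa> (0 + 2 * (i - 1)) (e j)) = 1" .
    moreover have "families n 0 e = families n 0 (\<lambda>i. 2 * int i - 2)"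
      using True by (intro families_cong) simp
    hence "weight \<kappa> n 0 e = \<kappa>" using weight_0[OF 0(1)] by (simp add: weight_def)
    ultimately show ?thesis by simp
  next
    case False
    then obtain j where j: "j \<in> {1..n}" "e j > 2 * int j - 2" using ge by force
    \<comment> \<open>Slack at one index propagates upwards, so the top end point is out of reach in
      every row and the last column vanishes. There is no family either, since a walk of length 0
      cannot leave its start.\<close>
    have up: "e (j + d) > 2 * int (j + d) - 2" if "j + d \<le> n" for d
      using that
    proof (induction d)
      case (Suc d)
      have "e (j + d) < e (j + Suc d)" "even (e (j + d))" "even (e (j + Suc d))"
        using 0(3)[of "j + d" "j + Suc d"] 0(4)[of "j + d"] 0(4)[of "j + Suc d"] j Suc.prems by auto
      thus ?case using Suc.IH Suc.prems by (auto elim!: evenE)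
    qed (use j in simp)
    have en: "e n > 2 * int n - 2" using up[of "n - j"] j by simp
    have "cdet n (\<lambda>j i. walk_weight \<kappa> (0 + 2 * (i - 1)) (e j)) = 0"
    proof (rule cdet_zero_column)
      fix i assume "i \<in> {1..n}"
      thus "walk_weight \<kappa> (0 + 2 * (i - 1)) (e n) = 0"
        using en by (intro walk_weight_beyond) (auto simp: of_nat_diff)
    qed (use 0(1) in auto)
    moreover have "families n 0 e = {}"
    proof (rule equals0I)
      fix P assume "P \<in> families n 0 e"
      hence "P j \<in> walks (0, 2 * int j - 2) (0, e j)" using j by (auto simp: families_def)
      thus False using j by (auto simp: walks_0 split: if_splits)
    qed
    ultimately show ?thesis by (simp add: weight_def)
  qed
next
  case (Suc t)
  have inj: "inj_on e {1..n}"
    using Suc.prems(3) by (intro inj_onI) (metis less_irrefl linorder_neqE_nat)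
  let ?w = "\<Prod>i=1..n. if e i = 0 then \<kappa> else 1"
  have step: "weight \<kappa> n t (\<lambda>i. e i + g i) =
      \<kappa> * cdet n (\<lambda>j i. walk_weight \<kappa> (t + 2 * (i - 1)) (e j + g j))"
    if g: "g \<in> (\<Pi>\<^sub>E i\<in>{1..n}. {-1, 1})" for g
  proof (cases "\<exists>i\<in>{1..n}. e i + g i < 0 \<or> (\<exists>j\<in>{1..n}. i \<noteq> j \<and> e i + g i = e j + g j)")
    case True
    then obtain i where i: "i \<in> {1..n}"
      and *: "e i + g i < 0 \<or> (\<exists>j\<in>{1..n}. i \<noteq> j \<and> e i + g i = e j + g j)" by blast
    from * have "cdet n (\<lambda>j i. walk_weight \<kappa> (t + 2 * (i - 1)) (e j + g j)) = 0"
    proof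
      assume "e i + g i < 0"
      thus ?thesis using i by (intro cdet_zero_column[of i]) (auto simp: walk_weight_neg)
    next
      assume "\<exists>j\<in>{1..n}. i \<noteq> j \<and> e i + g i = e j + g j"
      then obtain j where "j \<in> {1..n}" "i \<noteq> j" "e i + g i = e j + g j" by blast
      thus ?thesis using i by (intro cdet_equal_columns[of i _ j]) auto
    qed
    thus ?thesis using weight_empty[OF i *] by simp
  next
    case False
    show ?thesis
    proof (rule Suc.IH)
      fix i assume i: "i \<in> {1..n}"
      have "g i = -1 \<or> g i = 1" using PiE_mem[OF g i] by auto
      thus "even (e i + g i - int t)" using Suc.prems(4)[OF i] by (auto simp: algebra_simps)
      show "e i + g i \<ge> 0" using False i by (meson not_le)
    next
      fix i j assume ij: "i \<in> {1..n}" "j \<in> {1..n}" "i < j"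
      have "g i = -1 \<or> g i = 1" "g j = -1 \<or> g j = 1"
        using PiE_mem[OF g ij(1)] PiE_mem[OF g ij(2)] by auto
      moreover have "e i < e j" "even (e j - e i)"
        using Suc.prems(3)[OF ij] Suc.prems(4)[OF ij(1)] Suc.prems(4)[OF ij(2)] by auto
      moreover from this have "e i + 2 \<le> e j" by presburger
      moreover have "e i + g i \<noteq> e j + g j" using False ij(1,2) less_imp_neq[OF ij(3)] by metis
      ultimately show "e i + g i < e j + g j" by auto
    qed fact
  qed
  have "cdet n (\<lambda>j i. walk_weight \<kappa> (Suc t + 2 * (i - 1)) (e j)) = cdet n (\<lambda>j i.
      (if e j = 0 then \<kappa> else 1) * (\<Sum>\<epsilon>\<in>{-1, 1}. walk_weight \<kappa> (t + 2 * (i - 1)) (e j + \<epsilon>)))"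
  proof (rule cdet_cong)
    fix i j assume "j \<in> {1..n}"
    thus "walk_weight \<kappa> (Suc t + 2 * (i - 1)) (e j) =
      (if e j = 0 then \<kappa> else 1) * (\<Sum>\<epsilon>\<in>{-1, 1}. walk_weight \<kappa> (t + 2 * (i - 1)) (e j + \<epsilon>))"
      using Suc.prems(2)[of j] by simp
  qed
  also have "\<dots> = ?w * (\<Sum>g\<in>(\<Pi>\<^sub>E i\<in>{1..n}. {-1, 1}).
      cdet n (\<lambda>j i. walk_weight \<kappa> (t + 2 * (i - 1)) (e j + g j)))"
    unfolding cdet_scale_columns by (subst cdet_sum_columns) auto
  also have "\<kappa> * \<dots> = weight \<kappa> n (Suc t) e"
    by (subst weight_Suc) (use Suc.prems(2) inj in \<open>auto simp: step sum_distrib_left mult_ac\<close>)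
  finally show ?case by simp
qed

lemma weight_nonneg: "\<kappa> \<ge> 0 \<Longrightarrow> weight \<kappa> n t e \<ge> 0"
  unfolding weight_def by (intro sum_nonneg) auto

text \<open>It suffices to peel off a last step common to all walks, which changes only y: to 1 if y
  = 0 and to y - 1 otherwise. The remaining summands are nonnegative.\<close>

lemma weight_pos:
  assumes "\<kappa> > 0" "n \<ge> 1" "y \<le> t" "even (t - y)"
  shows "weight \<kappa> n t (\<lambda>i. int y + 2 * int i - 2) > 0"
  using assms(3,4)
proof (induction t arbitrary: y)
  case 0
  thus ?case using weight_0[OF assms(2), of \<kappa>] assms(1) by simp
next
  case (Suc t)
  let ?e = "\<lambda>i. int y + 2 * int i - 2" and ?G = "\<Pi>\<^sub>E i\<in>{1..n}. {-1, 1::int}"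
  obtain \<epsilon> y' where \<epsilon>: "\<epsilon> \<in> {-1, 1}" "int y + \<epsilon> = int y'" "y' \<le> t" "even (t - y')"
  proof (cases "y = 0")
    case True
    hence "t \<ge> 1" "odd t" using Suc.prems by (auto intro: Suc_leI odd_pos)
    thus ?thesis using that[of 1 1] True by simp
  next
    case False
    moreover from this have "Suc t - y = t - (y - 1)" by simp
    ultimately show ?thesis using that[of "-1" "y - 1"] Suc.prems by auto
  qed
  define g where "g = (\<lambda>i\<in>{1..n}. \<epsilon>)"
  have g: "g \<in> ?G" using \<epsilon> by (auto simp: g_def)
  have "families n t (\<lambda>i. ?e i + g i) = families n t (\<lambda>i. int y' + 2 * int i - 2)"
    using \<epsilon>(2) by (intro families_cong) (simp add: g_def)
  hence "weight \<kappa> n t (\<lambda>i. ?e i + g i) > 0"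
    using Suc.IH[OF \<epsilon>(3,4)] by (simp add: weight_def)
  hence "(\<Sum>g\<in>?G. weight \<kappa> n t (\<lambda>i. ?e i + g i)) > 0"
    using g assms(1) by (intro sum_pos2[of _ g]) (auto intro: weight_nonneg finite_PiE)
  moreover have "(\<Prod>i=1..n. if ?e i = 0 then \<kappa> else 1) > 0" using assms(1) by (intro prod_pos) auto
  moreover have "inj_on ?e {1..n}" by (intro inj_onI) auto
  ultimately show ?case by (subst weight_Suc) auto
qed

subsection \<open>The partition function as a single sum\<close>

lemma poly_eq_smult_prod_roots:
  fixes p :: "real poly"
  assumes "finite A" "degree p \<le> card A" "\<And>x. x \<in> A \<Longrightarrow> poly p x = 0"
  shows "\<exists>c. p = smult c (\<Prod>x\<in>A. [:- x, 1:])"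
  using assms
proof (induction A arbitrary: p rule: finite_induct)
  case empty
  thus ?case by (auto elim!: degree_eq_zeroE)
next
  case (insert x A)
  have "poly p x = 0" using insert.prems by simp
  then obtain q where p: "p = [:- x, 1:] * q" by (auto simp: poly_eq_0_iff_dvd elim: dvdE)
  have "degree q \<le> card A"
  proof (cases "q = 0")
    case False
    hence "degree p = Suc (degree q)" unfolding p by (subst degree_mult_eq) auto
    thus ?thesis using insert by simp
  qed simp
  moreover have "poly q z = 0" if "z \<in> A" for z
    using insert.prems(2)[of z] insert.hyps that by (auto simp: p)
  ultimately obtain c where "q = smult c (\<Prod>x\<in>A. [:- x, 1:])" using insert.IH by blast
  thus ?case using insert.hyps by (intro exI[of _ c]) (simp add: p mult.commute)
qed

text \<open>With \<open>a = y + 2n - 1\<close>, the factors \<open>(k + r) (k + a - r) = k (k + a) + r (a - r)\<close> come from the roots at which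
  the shifted last column is proportional to one of the other columns (\<open>k = - r\<close>).\<close>

definition height_poly :: "nat \<Rightarrow> nat \<Rightarrow> real \<Rightarrow> real" where
  "height_poly n y k = (\<Prod>r\<in>{1..<n}. (k + real r) * (k + real (y + 2 * n - 1) - real r))"

text \<open>The outer factors are what remains of the ballot numbers in the shifted last column; the
  height polynomial is the contribution of the determinant.\<close>

definition mode_weight :: "nat \<Rightarrow> nat \<Rightarrow> nat \<Rightarrow> nat \<Rightarrow> real" where
  "mode_weight n y M k = real (2 * k + (y + 2 * n - 1)) * height_poly n y (real k)
     * real ((2 * M + (y + 2 * n - 1)) choose (M - k))"

definition mode_sum :: "nat \<Rightarrow> nat \<Rightarrow> nat \<Rightarrow> real \<Rightarrow> real" where
  "mode_sum n y M x = (\<Sum>k\<le>M. x ^ k * mode_weight n y M k)"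

text \<open>Columns are cleared from left to right: what has to be removed from column r + 1 is a
  multiple of column r + 2, which at that moment still carries \<kappa>. The last column has no
  right neighbour, hence r < n.\<close>

lemma cdet_remove_weights:
  fixes e :: "nat \<Rightarrow> int" and s :: "nat \<Rightarrow> nat"
  assumes e: "\<And>j. j \<in> {1..n} \<Longrightarrow> e j \<ge> 0" "\<And>j. e (Suc j) = e j + 2" and "r < n"
  shows "cdet n (\<lambda>j i. walk_weight (if j \<le> r then 1 else \<kappa>) (s i) (e j)) =
    cdet n (\<lambda>j i. walk_weight \<kappa> (s i) (e j))"
  using \<open>r < n\<close>
proof (induction r)
  case 0
  show ?case by (rule cdet_cong) simp
next
  case (Suc r)
  define c where "c = (\<lambda>j i. walk_weight (if j \<le> r then 1 else \<kappa>) (s i) (e j))"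
  have r: "Suc r \<in> {1..n}" "Suc (Suc r) \<in> {1..n}" using Suc.prems by auto
  have "cdet n c = cdet n (c(Suc r := (\<lambda>i. walk_weight 1 (s i) (e (Suc r))
      + (\<kappa> - 1) * walk_weight \<kappa> (s i) (e (Suc (Suc r))))))"
  proof (rule cdet_cong)
    fix i j
    have "walk_weight \<kappa> (s i) (e (Suc r)) = walk_weight 1 (s i) (e (Suc r))
        + (\<kappa> - 1) * walk_weight \<kappa> (s i) (e (Suc (Suc r)))"
      using walk_weight_split[of "e (Suc r)" \<kappa> "s i"] e(1)[OF r(1)] by (simp add: e(2)[of "Suc r"])
    thus "c j i = (c(Suc r := (\<lambda>i. walk_weight 1 (s i) (e (Suc r))
        + (\<kappa> - 1) * walk_weight \<kappa> (s i) (e (Suc (Suc r)))))) j i"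
      by (auto simp: c_def)
  qed
  also have "\<dots> = cdet n (c(Suc r := (\<lambda>i. walk_weight 1 (s i) (e (Suc r))))) + (\<kappa> - 1) *
      cdet n (c(Suc r := (\<lambda>i. walk_weight \<kappa> (s i) (e (Suc (Suc r))))))"
    by (rule cdet_column_add[OF r(1)])
  also have "cdet n (c(Suc r := (\<lambda>i. walk_weight \<kappa> (s i) (e (Suc (Suc r)))))) = 0"
    by (rule cdet_equal_columns[OF r]) (auto simp: c_def)
  also have "cdet n (c(Suc r := (\<lambda>i. walk_weight 1 (s i) (e (Suc r))))) =
      cdet n (\<lambda>j i. walk_weight (if j \<le> Suc r then 1 else \<kappa>) (s i) (e j))"
    by (rule cdet_cong) (auto simp: c_def)
  finally show ?case using Suc by (simp add: c_def)
qed

text \<open>The column that cannot be cleared is expanded completely instead. After M + 1 shifts by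
  2 its height exceeds the length of the longest walks, those of row n, so the remainder is
  zero.\<close>

lemma cdet_last_column_expand:
  fixes n y M :: nat and \<kappa> :: real
  assumes "n \<ge> 1"
  defines "s \<equiv> \<lambda>i. 2 * M + y + 2 * (i - 1)" and "e \<equiv> \<lambda>j. int y + 2 * int j - 2"
  shows "cdet n (\<lambda>j i. walk_weight \<kappa> (s i) (e j)) = (\<Sum>k\<le>M. (\<kappa> - 1) ^ k *
    cdet n ((\<lambda>j i. walk_weight 1 (s i) (e j))(n := (\<lambda>i. walk_weight 1 (s i) (e n + 2 * int k)))))"
proof -
  let ?c = "\<lambda>j i. walk_weight 1 (s i) (e j)"
  have n: "n \<in> {1..n}" using assms by simp
  have "cdet n (\<lambda>j i. walk_weight \<kappa> (s i) (e j)) =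
      cdet n (\<lambda>j i. walk_weight (if j \<le> n - 1 then 1 else \<kappa>) (s i) (e j))"
    by (rule cdet_remove_weights[symmetric]) (use assms(1) in \<open>auto simp: e_def\<close>)
  also have "\<dots> = cdet n (?c(n := (\<lambda>i. \<Sum>k\<le>M. (\<kappa> - 1) ^ k * walk_weight 1 (s i) (e n + 2 * int k))))"
  proof (rule cdet_cong)
    fix i j assume ij: "i \<in> {1..n}" "j \<in> {1..n}"
    have "walk_weight \<kappa> (s i) (e n + 2 * int (Suc M)) = 0"
      using ij by (intro walk_weight_beyond) (auto simp: s_def e_def of_nat_diff)
    moreover have "e n \<ge> 0" using assms(1) by (simp add: e_def)
    ultimately have "walk_weight \<kappa> (s i) (e n) = (\<Sum>k\<le>M. (\<kappa> - 1) ^ k * walk_weight 1 (s i) (e n + 2 * int k))"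
      using walk_weight_expand[of "e n" \<kappa> "s i" "Suc M"] by (simp add: lessThan_Suc_atMost)
    thus "walk_weight (if j \<le> n - 1 then 1 else \<kappa>) (s i) (e j) =
        (?c(n := (\<lambda>i. \<Sum>k\<le>M. (\<kappa> - 1) ^ k * walk_weight 1 (s i) (e n + 2 * int k)))) j i"
      using ij by auto
  qed
  finally show ?thesis unfolding cdet_column_sum[OF n] .
qed

text \<open>The prefactor depends on the column only, and the rest is \<open>fact s\<close> times a
  polynomial of degree n - i in k(k + a). As k is real, negative shifts k = -r are included; they
  describe the other columns of the matrix.\<close>

lemma walk_weight_column:
  fixes n y M i q x :: nat
  defines "a \<equiv> y + 2 * n - 1" and "s \<equiv> 2 * M + y + 2 * (i - 1)"
  assumes i: "i \<in> {1..n}" and x: "x + 2 * q = 2 * M + y + 2 * n - 2" and k: "k = real M - real q"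
  shows "walk_weight 1 s (int x) = (2 * k + real a) / (fact q * fact (q + x + 1)) *
    (fact s * (\<Prod>l<n - i. (real M - real l) * (real M + real a - real l) - k * (k + real a)))"
proof -
  have n: "n \<ge> 1" using i by simp
  have "s + 2 * (n - i) = x + 2 * q" using i x by (auto simp: s_def)
  moreover have xr: "real x + 1 = 2 * k + real a"
  proof -
    have "real x + 2 * real q = 2 * real M + real a - 1"
      using x n unfolding a_def by linarith
    thus ?thesis by (simp add: k)
  qed
  moreover have "(real q - real l) * (real (q + x + 1) - real l) =
      (real M - real l) * (real M + real a - real l) - k * (k + real a)" for l
  proof -
    have A: "real (q + x + 1) = real M + real a + k" using xr by (simp add: k)
    have B: "real q = real M - k" by (simp add: k)
    show ?thesis unfolding A B by (simp add: algebra_simps)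
  qed
  ultimately show ?thesis using ballot_number_prod[of s "n - i" x q] by (simp add: add.commute)
qed

lemma vicious_families_eq: "vicious_families n t y = families n t (\<lambda>i. int y + 2 * int i - 2)"
  by (simp add: vicious_families_def families_def)

text \<open>Stripped of its prefactor, the determinant is a polynomial \<open>\<Phi>\<close> in Y =
  k(k + a) of degree at most n - 1, by expansion along the last column. The n - 1 distinct roots fix
  it up to a constant, which may depend on M but not on k.\<close>

lemma last_column_factor:
  fixes n y M :: nat
  assumes n: "n \<ge> 1"
  defines "s \<equiv> \<lambda>i. 2 * M + y + 2 * (i - 1)" and "e \<equiv> \<lambda>j. int y + 2 * int j - 2"
  shows "\<exists>C. \<forall>k\<le>M. cdet n ((\<lambda>j i. walk_weight 1 (s i) (e j))(n := (\<lambda>i. walk_weight 1 (s i) (e n + 2 * int k))))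
    = C * mode_weight n y M k"
proof -
  let ?c = "\<lambda>j i. walk_weight 1 (s i) (e j)"
  define a where "a = y + 2 * n - 1"
  have nn: "n \<in> {1..n}" using n by simp
  define b where "b = (\<lambda>Y i. fact (s i) * (\<Prod>l<n - i. (real M - real l) * (real M + real a - real l) - Y))"
  \<comment> \<open>Cofactors of the last column, obtained by placing unit vectors there.\<close>
  define m where "m = (\<lambda>i'. cdet n (?c(n := (\<lambda>i. if i = i' then 1 else 0))))"
  define \<Phi> where "\<Phi> = (\<Sum>i=1..n. smult (m i * fact (s i))
    (\<Prod>l<n - i. [:(real M - real l) * (real M + real a - real l), -1:]))"
  have \<Phi>: "poly \<Phi> Y = cdet n (?c(n := b Y))" for Y
  proof -
    have "cdet n (?c(n := b Y)) = cdet n (?c(n := (\<lambda>i. \<Sum>i'=1..n. b Y i' * (if i = i' then 1 else 0))))"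
      by (rule cdet_cong) (auto simp: if_distrib[of "(*) _"] cong: if_cong)
    also have "\<dots> = (\<Sum>i=1..n. b Y i * m i)"
      unfolding m_def by (rule cdet_column_sum[OF nn])
    also have "\<dots> = poly \<Phi> Y"
      by (simp add: \<Phi>_def b_def poly_sum poly_prod mult_ac)
    finally show ?thesis ..
  qed
  have "degree \<Phi> \<le> n - 1"
    unfolding \<Phi>_def
  proof (rule degree_sum_le)
    fix i assume i: "i \<in> {1..n}"
    have "degree (\<Prod>l<n - i. [:(real M - real l) * (real M + real a - real l), -1:])
        \<le> (\<Sum>l<n - i. degree [:(real M - real l) * (real M + real a - real l), -1:])"
      by (rule degree_prod_sum_le[unfolded comp_def]) simp
    also have "\<dots> \<le> n - 1" using i by (simp add: diff_le_mono2)
    finally show "degree (smult (m i * fact (s i)) (\<Prod>l<n - i. [:(real M - real l) * (real M + real a - real l), -1:])) \<le> n - 1"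
      by (rule order_trans[OF degree_smult_le])
  qed simp
  define root where "root = (\<lambda>r. - (real r * (real a - real r)))"
  \<comment> \<open>Two roots coincide only if r = r' or r + r' = a, and the latter is excluded
    because r and r' are below n.\<close>
  have inj: "inj_on root {1..<n}"
  proof (rule inj_onI)
    fix r r' assume r: "r \<in> {1..<n}" "r' \<in> {1..<n}" "root r = root r'"
    hence "(real r - real r') * (real a - real r - real r') = 0"
      by (simp add: root_def algebra_simps)
    moreover have "r + r' < a" using r by (auto simp: a_def)
    hence "real r + real r' < real a" by linarith
    ultimately show "r = r'" by auto
  qed
  have roots: "poly \<Phi> (root r) = 0" if r: "r \<in> {1..<n}" for r
  proof -
    \<comment> \<open>The shift k = -r: x is the end height of column n - r.\<close>
    define x q where "x = y + 2 * (n - r) - 2" and "q = M + r"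
    have xq: "x + 2 * q = 2 * M + y + 2 * n - 2" using r by (auto simp: x_def q_def)
    have ex: "int x = e (n - r)" using r by (auto simp: x_def e_def of_nat_diff)
    have kq: "- real r = real M - real q" by (simp add: q_def)
    have rt: "- real r * (- real r + real a) = root r" by (simp add: root_def algebra_simps)
    have col: "walk_weight 1 (s i) (e (n - r)) =
        (2 * - real r + real a) / (fact q * fact (q + x + 1)) * b (root r) i" if "i \<in> {1..n}" for i
      using walk_weight_column[OF that xq kq, folded a_def] by (simp only: b_def s_def ex rt)
    have "r + r < a" using r by (auto simp: a_def)
    hence "real r + real r < real a" by linarith
    hence ne: "(2 * - real r + real a) / (fact q * fact (q + x + 1)) \<noteq> (0 :: real)" by simp
    have "(2 * - real r + real a) / (fact q * fact (q + x + 1)) * cdet n (?c(n := b (root r))) =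
        cdet n (?c(n := (\<lambda>i. (2 * - real r + real a) / (fact q * fact (q + x + 1)) * b (root r) i)))"
      by (rule cdet_column_scale[OF nn, symmetric])
    also have "\<dots> = 0"
    proof (rule cdet_equal_columns[of "n - r" n n])
      fix i assume "i \<in> {1..n}"
      thus "(?c(n := (\<lambda>i. (2 * - real r + real a) / (fact q * fact (q + x + 1)) * b (root r) i))) (n - r) i =
        (?c(n := (\<lambda>i. (2 * - real r + real a) / (fact q * fact (q + x + 1)) * b (root r) i))) n i"
        using col r by simp
    qed (use r in auto)
    finally show ?thesis using ne unfolding \<Phi> by simp
  qed
  have "\<exists>C. \<Phi> = smult C (\<Prod>z\<in>root ` {1..<n}. [:- z, 1:])"
  proof (rule poly_eq_smult_prod_roots)
    show "degree \<Phi> \<le> card (root ` {1..<n})"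
      using \<open>degree \<Phi> \<le> n - 1\<close> unfolding card_image[OF inj] by simp
  qed (use roots in auto)
  then obtain C where C: "\<Phi> = smult C (\<Prod>r\<in>{1..<n}. [:- root r, 1:])"
    unfolding prod.reindex[OF inj] comp_def by blast
  have "cdet n (?c(n := (\<lambda>i. walk_weight 1 (s i) (e n + 2 * int k)))) = (C / fact (2 * M + a)) * mode_weight n y M k"
    if k: "k \<le> M" for k
  proof -
    define x q where "x = y + 2 * n - 2 + 2 * k" and "q = M - k"
    let ?K = "(2 * real k + real a) / (fact q * fact (q + x + 1))"
    have xq: "x + 2 * q = 2 * M + y + 2 * n - 2" using n k by (auto simp: x_def q_def)
    have kq: "real k = real M - real q" using k by (simp add: q_def)
    have ex: "int x = e n + 2 * int k" using n by (auto simp: x_def e_def of_nat_diff)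
    have "cdet n (?c(n := (\<lambda>i. walk_weight 1 (s i) (e n + 2 * int k)))) =
        cdet n (?c(n := (\<lambda>i. ?K * b (real k * (real k + real a)) i)))"
    proof (rule cdet_cong)
      fix i j assume "i \<in> {1..n}"
      hence "walk_weight 1 (s i) (e n + 2 * int k) = ?K * b (real k * (real k + real a)) i"
        using walk_weight_column[OF _ xq kq] unfolding ex s_def b_def a_def by simp
      thus "(?c(n := (\<lambda>i. walk_weight 1 (s i) (e n + 2 * int k)))) j i =
        (?c(n := (\<lambda>i. ?K * b (real k * (real k + real a)) i))) j i" by simp
    qed
    also have "\<dots> = ?K * poly \<Phi> (real k * (real k + real a))"
      unfolding \<Phi> by (rule cdet_column_scale[OF nn])
    also have "poly \<Phi> (real k * (real k + real a)) = C * height_poly n y (real k)"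
      unfolding C height_poly_def a_def[symmetric] poly_smult poly_prod
      by (intro arg_cong[of _ _ "(*) C"] prod.cong refl) (simp add: root_def algebra_simps)
    also have "q + x + 1 = M + a + k" using n k by (auto simp: x_def q_def a_def)
    also have "(2 * real k + real a) / (fact q * fact (M + a + k)) = real (2 * k + a) *
        real ((2 * M + a) choose (M - k)) / fact (2 * M + a)"
      using k by (subst binomial_fact) (auto simp: q_def field_simps)
    finally show ?thesis unfolding mode_weight_def a_def[symmetric]
      by (simp only: times_divide_eq_left times_divide_eq_right mult_ac)
  qed
  thus ?thesis by blast
qed

lemma Z_eq_mode_sum:
  assumes n: "n \<ge> 1"
  shows "\<exists>C. \<forall>\<kappa>. Z n (2 * M + y) y \<kappa> = \<kappa> * C * mode_sum n y M (\<kappa> - 1)"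
proof -
  let ?s = "\<lambda>i. 2 * M + y + 2 * (i - 1)" and ?e = "\<lambda>j. int y + 2 * int j - 2"
  obtain C where C: "\<And>k. k \<le> M \<Longrightarrow> cdet n ((\<lambda>j i. walk_weight 1 (?s i) (?e j))(n := (\<lambda>i. walk_weight 1 (?s i) (?e n + 2 * int k))))
    = C * mode_weight n y M k"
    using last_column_factor[OF n, of M y] by blast
  have "Z n (2 * M + y) y \<kappa> = \<kappa> * C * mode_sum n y M (\<kappa> - 1)" for \<kappa>
  proof -
    have "Z n (2 * M + y) y \<kappa> = weight \<kappa> n (2 * M + y) ?e"
      by (simp add: Z_def weight_def vicious_families_eq)
    also have "\<dots> = \<kappa> * cdet n (\<lambda>j i. walk_weight \<kappa> (?s i) (?e j))"
      by (rule weight_eq_cdet) (use n in auto)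
    also have "\<dots> = \<kappa> * (\<Sum>k\<le>M. (\<kappa> - 1) ^ k * (C * mode_weight n y M k))"
      unfolding cdet_last_column_expand[OF n] using C by simp
    finally show ?thesis by (simp add: mode_sum_def sum_distrib_left mult_ac)
  qed
  thus ?thesis by blast
qed

text \<open>The constant cancels in the logarithmic derivative, and the explicit factor \<kappa> of
  Z yields the summand 1. For \<kappa> < 1 the terms of \<open>mode_sum\<close> alternate in sign,
  so its nonvanishing is inherited from Z > 0.\<close>

lemma mean_contacts_eq:
  assumes n: "n \<ge> 1" and "\<kappa> > 0"
  shows "mode_sum n y M (\<kappa> - 1) \<noteq> 0"
    and "mean_contacts n (2 * M + y) y \<kappa> = 1 + \<kappa> *
      (\<Sum>k\<le>M. real k * (\<kappa> - 1) ^ (k - 1) * mode_weight n y M k) / mode_sum n y M (\<kappa> - 1)"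
proof -
  let ?S' = "\<Sum>k\<le>M. real k * (\<kappa> - 1) ^ (k - 1) * mode_weight n y M k"
  obtain C where C: "Z n (2 * M + y) y = (\<lambda>\<kappa>. \<kappa> * C * mode_sum n y M (\<kappa> - 1))"
    using Z_eq_mode_sum[OF n, of M y] by auto
  have "Z n (2 * M + y) y \<kappa> > 0"
    using weight_pos[OF \<open>\<kappa> > 0\<close> n, of y "2 * M + y"] by (simp add: Z_def weight_def vicious_families_eq)
  hence ne: "C \<noteq> 0" "mode_sum n y M (\<kappa> - 1) \<noteq> 0" unfolding C by auto
  thus "mode_sum n y M (\<kappa> - 1) \<noteq> 0" by simp
  have "((\<lambda>x. mode_sum n y M (x - 1)) has_real_derivative ?S') (at \<kappa>)"
    unfolding mode_sum_def by (auto intro!: derivative_eq_intros sum.cong)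
  hence "(Z n (2 * M + y) y has_real_derivative (C * mode_sum n y M (\<kappa> - 1) + \<kappa> * C * ?S')) (at \<kappa>)"
    unfolding C by (auto intro!: derivative_eq_intros)
  hence "deriv (Z n (2 * M + y) y) \<kappa> = C * mode_sum n y M (\<kappa> - 1) + \<kappa> * C * ?S'"
    by (rule DERIV_imp_deriv)
  thus "mean_contacts n (2 * M + y) y \<kappa> = 1 + \<kappa> * ?S' / mode_sum n y M (\<kappa> - 1)"
    unfolding mean_contacts_def C using ne \<open>\<kappa> > 0\<close> by (simp add: field_simps)
qed

subsection \<open>The subcritical regime\<close>

text \<open>Upper negation turns both factors into binomials with upper entries -a and -b, to which
  Vandermonde applies; the signs combine to (-1)^n.\<close>

lemma negative_binomial_convolution:
  fixes a b :: real
  shows "(\<Sum>h=0..n. ((a + real h - 1) gchoose h) * ((b + real (n - h) - 1) gchoose (n - h)))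
    = (a + b + real n - 1) gchoose n"
proof -
  have "(\<Sum>h=0..n. ((a + real h - 1) gchoose h) * ((b + real (n - h) - 1) gchoose (n - h)))
      = (\<Sum>h=0..n. (-1) ^ n * ((- a gchoose h) * (- b gchoose (n - h))))"
  proof (rule sum.cong[OF refl])
    fix h assume "h \<in> {0..n}"
    hence "(-1 :: real) ^ n = (-1) ^ h * (-1) ^ (n - h)" by (simp flip: power_add)
    moreover have "(-1 :: real) ^ h * (-1) ^ h = 1" "(-1 :: real) ^ (n - h) * (-1) ^ (n - h) = 1"
      by (simp_all add: minus_one_power_iff)
    moreover have "A * B = s * (p * A * (q * B))" if "s = p * q" "p * p = 1" "q * q = 1" for A B s p q :: real
    proof -
      have "s * (p * A * (q * B)) = (p * p) * (q * q) * (A * B)" unfolding that(1) by (simp only: mult_ac)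
      thus ?thesis using that by simp
    qed
    ultimately show "((a + real h - 1) gchoose h) * ((b + real (n - h) - 1) gchoose (n - h))
        = (-1) ^ n * ((- a gchoose h) * (- b gchoose (n - h)))"
      unfolding gbinomial_minus[of a] gbinomial_minus[of b] by blast
  qed
  also have "\<dots> = (-1) ^ n * ((- a + - b) gchoose n)"
    unfolding sum_distrib_left[symmetric] gbinomial_Vandermonde ..
  also have "\<dots> = (a + b + real n - 1) gchoose n"
    using gbinomial_minus[of "a + b" n] by (simp add: algebra_simps)
  finally show ?thesis .
qed

text \<open>Write 2n - h = n + (n - h). The first part is the plain convolution with b = k + n; in
  the second, absorption removes the factor n - h and leaves a convolution of order n - 1. Both give
  the same binomial, with factors k + a + n and k + n.\<close>

lemma weighted_negative_binomial_convolution: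
  fixes a k :: real
  assumes "n \<ge> 1"
  shows "(\<Sum>h=0..n. real (2 * n - h) * ((k + real (2 * n - h) - 1) gchoose (n - h)) * ((a + real h - 1) gchoose h))
    = (2 * k + a + 2 * real n) * ((k + a + 2 * real n - 1) gchoose (n - 1))"
proof -
  define g where "g = (\<lambda>h. (a + real h - 1) gchoose h)"
  obtain m where m: "n = Suc m" using assms by (cases n) auto
  let ?b = "k + real n"
  have "(\<Sum>h=0..n. real (2 * n - h) * ((k + real (2 * n - h) - 1) gchoose (n - h)) * g h)
      = (\<Sum>h=0..n. real n * (g h * ((?b + real (n - h) - 1) gchoose (n - h)))
          + g h * (real (n - h) * ((?b + real (n - h) - 1) gchoose (n - h))))"
  proof (rule sum.cong[OF refl])
    fix h assume "h \<in> {0..n}"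
    hence "real (2 * n - h) = real n + real (n - h)" by (simp add: of_nat_diff)
    thus "real (2 * n - h) * ((k + real (2 * n - h) - 1) gchoose (n - h)) * g h
      = real n * (g h * ((?b + real (n - h) - 1) gchoose (n - h)))
          + g h * (real (n - h) * ((?b + real (n - h) - 1) gchoose (n - h)))"
      by (simp add: algebra_simps)
  qed
  also have "\<dots> = real n * ((a + ?b + real n - 1) gchoose n)
      + (\<Sum>h=0..n. g h * (real (n - h) * ((?b + real (n - h) - 1) gchoose (n - h))))"
    unfolding sum.distrib sum_distrib_left[symmetric] g_def negative_binomial_convolution ..
  also have "(\<Sum>h=0..n. g h * (real (n - h) * ((?b + real (n - h) - 1) gchoose (n - h))))
      = (\<Sum>h=0..m. ?b * (g h * (((?b + 1) + real (m - h) - 1) gchoose (m - h))))"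
  proof -
    have "g h * (real (n - h) * ((?b + real (n - h) - 1) gchoose (n - h)))
        = ?b * (g h * (((?b + 1) + real (m - h) - 1) gchoose (m - h)))" if "h \<le> m" for h
    proof -
      have d: "n - h = Suc (m - h)" using that m by simp
      have "real (n - h) * ((?b + real (n - h) - 1) gchoose (n - h))
          = (?b + real (m - h)) * ((?b + real (m - h) - 1) gchoose (m - h))"
      proof -
        have "?b + real (n - h) - 1 = ?b + real (m - h)" using d by simp
        thus ?thesis unfolding d using gbinomial_absorption[of "m - h" "?b + real (m - h)"] by metis
      qed
      also have "\<dots> = ?b * ((?b + real (m - h)) gchoose (m - h))"
        using gbinomial_absorb_comp[of "?b + real (m - h)" "m - h"] by simp
      finally show ?thesis by (simp add: algebra_simps)
    qed
    hence "(\<Sum>h=0..m. g h * (real (n - h) * ((?b + real (n - h) - 1) gchoose (n - h))))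
      = (\<Sum>h=0..m. ?b * (g h * (((?b + 1) + real (m - h) - 1) gchoose (m - h))))"
      by (intro sum.cong) auto
    moreover have "(\<Sum>h=0..n. g h * (real (n - h) * ((?b + real (n - h) - 1) gchoose (n - h))))
      = (\<Sum>h=0..m. g h * (real (n - h) * ((?b + real (n - h) - 1) gchoose (n - h))))"
      unfolding m by simp
    ultimately show ?thesis by simp
  qed
  also have "\<dots> = ?b * ((a + (?b + 1) + real m - 1) gchoose m)"
    unfolding sum_distrib_left[symmetric] g_def negative_binomial_convolution ..
  also have "real n * ((a + ?b + real n - 1) gchoose n)
      = (k + a + real n) * ((k + a + 2 * real n - 1) gchoose m)"
  proof -
    have "real n * ((a + ?b + real n - 1) gchoose n)
        = (a + ?b + real n - 1) * ((a + ?b + real n - 1 - 1) gchoose m)"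
      using gbinomial_absorption[of m "a + ?b + real n - 1"] by (simp add: m)
    also have "\<dots> = (a + ?b + real n - 1 - real m) * ((a + ?b + real n - 1) gchoose m)"
      by (rule gbinomial_absorb_comp[symmetric])
    finally show ?thesis by (simp add: m algebra_simps)
  qed
  finally show ?thesis by (simp add: g_def m algebra_simps)
qed

lemma height_poly_binomial:
  assumes "n \<ge> 1"
  shows "height_poly n y (real k) = (fact (n - 1))\<^sup>2 * real ((k + n - 1) choose (n - 1))
    * real ((k + y + 2 * n - 2) choose (n - 1))"
proof -
  obtain m where m: "n = Suc m" using assms by (cases n) auto
  have g: "real (q choose m) * fact m = (\<Prod>i<m. real q - real i)" for q
    by (simp add: binomial_gbinomial gbinomial_prod_rev lessThan_atLeast0)
  have "(\<Prod>r\<in>{1..<n}. real k + real r) = (\<Prod>i<m. real (k + m) - real i)"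
    by (rule prod.reindex_bij_witness[of _ "\<lambda>i. m - i" "\<lambda>r. m - r"]) (auto simp: m of_nat_diff)
  moreover have "(\<Prod>r\<in>{1..<n}. real k + real (y + 2 * n - 1) - real r) = (\<Prod>i<m. real (k + y + 2 * m) - real i)"
    by (rule prod.reindex_bij_witness[of _ "\<lambda>i. Suc i" "\<lambda>r. r - 1"]) (auto simp: m of_nat_diff)
  ultimately show ?thesis
    unfolding height_poly_def prod.distrib g[symmetric] by (simp add: m power2_eq_square)
qed

text \<open>The part common to the summands of both sums in C. The upper entry y + h - 2 is negative
  for small y and h, so the binomial has to be the generalized one.\<close>

definition asymp_coeff :: "nat \<Rightarrow> nat \<Rightarrow> nat \<Rightarrow> real" where
  "asymp_coeff n y h = real (n choose h) * (real_of_int (int y + int h - 2) gchoose h) / real ((2 * n) choose h)"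

text \<open>The binomials on the right, as functions of k, have the generating functions 1/(1 -
  x)^(2n - h), which at x = \<kappa> - 1 are the powers of 2 - \<kappa> in the claim. Once the
  common factor (k + n - 1 choose n - 1) is extracted, the sum is the weighted convolution with a =
  y - 1.\<close>

lemma mode_coeff_expand:
  assumes n: "n \<ge> 1"
  shows "real (2 * k + (y + 2 * n - 1)) * height_poly n y (real k) =
    2 * fact (2 * n - 1) * (\<Sum>h=0..n. asymp_coeff n y h * real ((k + (2 * n - 1 - h)) choose k))"
proof -
  obtain m where m: "n = Suc m" using n by (cases n) auto
  have term_eq: "2 * fact (2 * n - 1) * (asymp_coeff n y h * real ((k + (2 * n - 1 - h)) choose k)) =
      (fact (n - 1))\<^sup>2 * real ((k + n - 1) choose (n - 1)) * (real (2 * n - h) *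
        ((real k + real (2 * n - h) - 1) gchoose (n - h)) * ((real y - 1 + real h - 1) gchoose h))"
    if h: "h \<le> n" for h
  proof -
    have i1: "real_of_int (int y + int h - 2) = real y - 1 + real h - 1" by simp
    have i2: "real k + real (2 * n - h) - 1 = real (k + (2 * n - 1 - h))" using h n by (simp add: of_nat_diff)
    have c1: "real (n choose h) = fact n / (fact h * fact (n - h))"
      using h by (simp add: binomial_fact)
    have c2: "real ((2 * n) choose h) = fact (2 * n) / (fact h * fact (2 * n - h))"
      using h by (simp add: binomial_fact)
    have c3: "real ((k + (2 * n - 1 - h)) choose k) = fact (k + (2 * n - 1 - h)) / (fact k * fact (2 * n - 1 - h))"
      by (simp add: binomial_fact)
    have c4: "real ((k + (2 * n - 1 - h)) choose (n - h)) = fact (k + (2 * n - 1 - h)) / (fact (n - h) * fact (k + n - 1))"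
      using h n by (simp add: binomial_fact add.commute)
    have c5: "real ((k + n - 1) choose (n - 1)) = fact (k + n - 1) / (fact (n - 1) * fact k)"
      using n by (simp add: binomial_fact add.commute)
    have f1: "(fact n :: real) = real n * fact (n - 1)" using n by (simp add: fact_reduce)
    have f2: "(fact (2 * n) :: real) = 2 * real n * fact (2 * n - 1)" using n by (simp add: fact_reduce)
    have f3: "(fact (2 * n - h) :: real) = real (2 * n - h) * fact (2 * n - 1 - h)"
      using n h by (subst fact_reduce) auto
    have F: "2 * A * (real n * B / (H * D) * G / (2 * real n * A / (H * (E * L))) * (K / (J * L)))
        = B\<^sup>2 * (I / (B * J)) * (E * (K / (D * I)) * G)"
      if "A \<noteq> 0" "B \<noteq> 0" "H \<noteq> 0" "D \<noteq> 0" "L \<noteq> 0" "J \<noteq> 0" "I \<noteq> 0" for A B H D E L K J I G :: real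
      using that n by (simp add: field_simps power2_eq_square)
    show ?thesis
      unfolding asymp_coeff_def i1 i2 binomial_gbinomial[symmetric] c1 c2 c3 c4 c5 unfolding f1 f2 f3
      by (rule F) auto
  qed
  have "2 * fact (2 * n - 1) * (\<Sum>h=0..n. asymp_coeff n y h * real ((k + (2 * n - 1 - h)) choose k)) =
      (fact (n - 1))\<^sup>2 * real ((k + n - 1) choose (n - 1)) * (\<Sum>h=0..n. real (2 * n - h) *
        ((real k + real (2 * n - h) - 1) gchoose (n - h)) * ((real y - 1 + real h - 1) gchoose h))"
    unfolding sum_distrib_left using term_eq by (intro sum.cong) auto
  also have "\<dots> = (fact (n - 1))\<^sup>2 * real ((k + n - 1) choose (n - 1)) *
      ((2 * real k + (real y - 1) + 2 * real n) * ((real k + (real y - 1) + 2 * real n - 1) gchoose (n - 1)))"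
    unfolding weighted_negative_binomial_convolution[OF n] ..
  also have "real k + (real y - 1) + 2 * real n - 1 = real (k + y + 2 * n - 2)" using n by (simp add: of_nat_diff)
  also have "2 * real k + (real y - 1) + 2 * real n = real (2 * k + (y + 2 * n - 1))" using n by (simp add: of_nat_diff)
  finally show ?thesis unfolding height_poly_binomial[OF n] binomial_gbinomial[symmetric] by (simp add: mult_ac)
qed

section \<open>Generating functions and summability of the limiting series\<close>

lemma negative_binomial_sums:
  fixes x :: real
  assumes "\<bar>x\<bar> < 1"
  shows "(\<lambda>k. real ((k + m) choose k) * x ^ k) sums (1 / (1 - x) ^ Suc m)"
proof -
  have "(\<lambda>k. (- real (Suc m) gchoose k) * (- x) ^ k) sums (1 + - x) powr (- real (Suc m))"
    using assms by (intro gen_binomial_real) simp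
  moreover have "(- real (Suc m) gchoose k) * (- x) ^ k = real ((k + m) choose k) * x ^ k" for k
  proof -
    have "(- real (Suc m) gchoose k) = (-1) ^ k * real ((k + m) choose k)"
      unfolding gbinomial_minus by (simp add: binomial_gbinomial add.commute)
    moreover have "(- x) ^ k = (-1) ^ k * x ^ k" by (rule power_minus)
    moreover have "(-1 :: real) ^ k * (-1) ^ k = 1" by (simp add: minus_one_power_iff)
    ultimately show ?thesis by simp
  qed
  moreover have "(1 + - x) powr (- real (Suc m)) = 1 / (1 - x) ^ Suc m"
    using assms by (simp only: powr_minus_divide) (subst powr_realpow, auto)
  ultimately show ?thesis by simp
qed

text \<open>The termwise derivative of the previous series, found by absorption instead of
  differentiation: up to the factor m + 1 it is the series for m + 1, moved by one index.\<close>

lemma negative_binomial_deriv_sums: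
  fixes x :: real
  assumes "\<bar>x\<bar> < 1"
  shows "(\<lambda>k. real ((k + m) choose k) * (real k * x ^ (k - 1))) sums (real (Suc m) / (1 - x) ^ Suc (Suc m))"
proof -
  have E: "real ((Suc k + m) choose Suc k) * (real (Suc k) * x ^ k)
      = real (Suc m) * (real ((k + Suc m) choose k) * x ^ k)" for k
  proof -
    have "Suc k * ((Suc k + m) choose Suc k) = (k + Suc m - k) * ((k + Suc m) choose k)"
      using binomial_absorption[of k "Suc k + m"] binomial_absorb_comp[of "k + Suc m" k] by simp
    hence "real (Suc k) * real ((Suc k + m) choose Suc k) = real (Suc m) * real ((k + Suc m) choose k)"
      by (metis add_diff_cancel_left' of_nat_mult)
    thus ?thesis by (metis (no_types, opaque_lifting) mult.assoc mult.commute)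
  qed
  have "(\<lambda>k. real ((Suc k + m) choose Suc k) * (real (Suc k) * x ^ (Suc k - 1)))
      sums (real (Suc m) * (1 / (1 - x) ^ Suc (Suc m)))"
    unfolding diff_Suc_1 E by (rule sums_mult[OF negative_binomial_sums[OF assms]])
  from sums_Suc[OF this] show ?thesis by simp
qed

text \<open>The right side is (k + 1)(k + 2)...(k + D). Thus the negative binomial series can serve
  as a majorant for polynomial times geometric terms.\<close>

lemma power_le_fact_binomial: "real (k + 1) ^ D \<le> fact D * real ((k + D) choose k)"
proof (induction D)
  case (Suc D)
  have "Suc D * ((k + Suc D) choose k) = (k + Suc D) * ((k + D) choose k)"
    using binomial_absorb_comp[of "k + Suc D" k] by simp
  hence E: "real (Suc D) * real ((k + Suc D) choose k) = real (k + Suc D) * real ((k + D) choose k)"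
    by (metis of_nat_mult)
  have "real (k + 1) ^ Suc D \<le> real (k + Suc D) * (fact D * real ((k + D) choose k))"
    unfolding power_Suc using Suc by (intro mult_mono) auto
  also have "\<dots> = fact D * (real (Suc D) * real ((k + Suc D) choose k))" unfolding E by simp
  finally show ?case by (simp add: mult_ac)
qed simp

lemma summable_polynomial_geometric:
  fixes x :: real
  assumes "\<bar>x\<bar> < 1"
  shows "summable (\<lambda>k. real (k + 1) ^ D * \<bar>x\<bar> ^ k)"
proof (rule summable_comparison_test')
  show "summable (\<lambda>k. fact D * (real ((k + D) choose k) * \<bar>x\<bar> ^ k))"
    using negative_binomial_sums[of "\<bar>x\<bar>" D] assms by (intro summable_mult) (auto simp: sums_iff)
  fix k :: nat
  show "norm (real (k + 1) ^ D * \<bar>x\<bar> ^ k) \<le> fact D * (real ((k + D) choose k) * \<bar>x\<bar> ^ k)"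
    using mult_right_mono[OF power_le_fact_binomial[of k D], of "\<bar>x\<bar> ^ k"]
    by (simp add: abs_mult mult_ac)
qed

text \<open>Going from k to k + 1 multiplies the ratio by (M - k)/(M + a + k + 1), so it drops by at
  most (a + 2k + 1)/M; these drops add up to k(k + a)/M.\<close>

lemma binomial_ratio_bounds:
  fixes k M a :: nat
  assumes "k \<le> M"
  defines "r \<equiv> \<lambda>k. real ((2 * M + a) choose (M - k)) / real ((2 * M + a) choose M)"
  shows "0 \<le> r k" "r k \<le> 1" "real M * (1 - r k) \<le> real k * (real k + real a)"
proof -
  have *: "0 \<le> r k \<and> r k \<le> 1 \<and> real M * (1 - r k) \<le> real k * (real k + real a)"
    using \<open>k \<le> M\<close>
  proof (induction k)
    case (Suc k)
    define D where "D = real M + real a + real k + 1"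
    have D: "D > 0" by (simp add: D_def)
    have "Suc (M - Suc k) = M - k" using Suc.prems by simp
    moreover have "2 * M + a - (M - Suc k) = M + a + k + 1" using Suc.prems by simp
    ultimately have "(M - k) * ((2 * M + a) choose (M - k)) = (M + a + k + 1) * ((2 * M + a) choose (M - Suc k))"
      using binomial_absorption[of "M - Suc k" "2 * M + a"] binomial_absorb_comp[of "2 * M + a" "M - Suc k"] by simp
    hence "real (M - k) * real ((2 * M + a) choose (M - k)) = real (M + a + k + 1) * real ((2 * M + a) choose (M - Suc k))"
      by (metis of_nat_mult)
    hence "D * real ((2 * M + a) choose (M - Suc k)) = (real M - real k) * real ((2 * M + a) choose (M - k))"
      using Suc.prems by (simp add: D_def of_nat_diff algebra_simps)
    hence rec: "D * r (Suc k) = (real M - real k) * r k" by (simp add: r_def)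
    have IH: "0 \<le> r k" "r k \<le> 1" "real M * (1 - r k) \<le> real k * (real k + real a)"
      using Suc by auto
    have "0 \<le> D * r (Suc k)" unfolding rec using IH Suc.prems by simp
    hence pos: "0 \<le> r (Suc k)" using D by (simp add: zero_le_mult_iff)
    have "D * r (Suc k) \<le> D * 1"
      unfolding rec using IH Suc.prems by (intro mult_mono) (auto simp: D_def)
    hence le: "r (Suc k) \<le> 1" using D by simp
    have "D * (r k - r (Suc k)) = (real a + 2 * real k + 1) * r k"
      using rec by (simp add: D_def algebra_simps)
    hence "D * (r k - r (Suc k)) \<le> real a + 2 * real k + 1"
      using IH mult_left_mono[of "r k" 1 "real a + 2 * real k + 1"] by simp
    moreover have "r k - r (Suc k) \<ge> 0"
      using \<open>D * (r k - r (Suc k)) = (real a + 2 * real k + 1) * r k\<close> IH(1) D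
      by (smt (verit) mult_nonneg_nonneg of_nat_0_le_iff zero_le_mult_iff)
    hence "real M * (r k - r (Suc k)) \<le> D * (r k - r (Suc k))"
      by (intro mult_right_mono) (auto simp: D_def)
    ultimately have "real M * (1 - r (Suc k)) \<le> real k * (real k + real a) + (real a + 2 * real k + 1)"
      using IH(3) by (simp add: algebra_simps)
    also have "\<dots> = real (Suc k) * (real (Suc k) + real a)" by (simp add: algebra_simps)
    finally show ?case using pos le by simp
  qed (simp add: r_def)
  thus "0 \<le> r k" "r k \<le> 1" "real M * (1 - r k) \<le> real k * (real k + real a)" by auto
qed

text \<open>The ratio, set to 0 beyond M, differs from 1 by at most (a + 1)(k + 1)^2 / M for every
  k; for k > M simply because k + 1 > M. Hence the weight (k + 1)^2 in the hypothesis.\<close>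

lemma truncated_series_bigo:
  fixes d :: "nat \<Rightarrow> real"
  assumes sm: "summable (\<lambda>k. \<bar>d k\<bar> * real (k + 1) ^ 2)"
  shows "(\<lambda>M. (\<Sum>k\<le>M. d k * (real ((2 * M + a) choose (M - k)) / real ((2 * M + a) choose M))) - suminf d)
    \<in> O(\<lambda>M. 1 / real M)"
proof (rule bigoI[of _ "real (a + 1) * (\<Sum>k. \<bar>d k\<bar> * real (k + 1) ^ 2)"])
  have sd: "summable (\<lambda>k. \<bar>d k\<bar>)"
  proof (rule summable_comparison_test'[OF sm])
    fix k :: nat
    have "1 \<le> real (k + 1) ^ 2" by (rule one_le_power) simp
    thus "norm \<bar>d k\<bar> \<le> \<bar>d k\<bar> * real (k + 1) ^ 2"
      using mult_left_mono[of 1 "real (k + 1) ^ 2" "\<bar>d k\<bar>"] by simp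
  qed
  show "\<forall>\<^sub>F M in at_top. norm ((\<Sum>k\<le>M. d k * (real ((2 * M + a) choose (M - k)) / real ((2 * M + a) choose M))) - suminf d)
      \<le> real (a + 1) * (\<Sum>k. \<bar>d k\<bar> * real (k + 1) ^ 2) * norm (1 / real M)"
    using eventually_gt_at_top[of 0]
  proof eventually_elim
    fix M :: nat assume M: "M > 0"
    define r where "r = (\<lambda>k. if k \<le> M then real ((2 * M + a) choose (M - k)) / real ((2 * M + a) choose M) else 0)"
    have bound: "\<bar>r k - 1\<bar> \<le> real (a + 1) * real (k + 1) ^ 2 / real M" for k
    proof -
      have "real M * \<bar>r k - 1\<bar> \<le> real (a + 1) * real (k + 1) ^ 2"
      proof (cases "k \<le> M")
        case True
        hence "real M * \<bar>r k - 1\<bar> \<le> real k * (real k + real a)"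
          using binomial_ratio_bounds[OF True, of a] by (simp add: r_def)
        also have "\<dots> \<le> real (k + 1) * (real (k + 1) * real (a + 1))"
          by (intro mult_mono) (auto simp: algebra_simps)
        finally show ?thesis by (simp add: power2_eq_square mult_ac)
      next
        case False
        have "real M \<le> 1 * (real (k + 1) * 1)" using False by simp
        also have "\<dots> \<le> real (a + 1) * (real (k + 1) * real (k + 1))"
          by (intro mult_mono) auto
        finally show ?thesis using False by (simp add: r_def power2_eq_square)
      qed
      thus ?thesis using M by (simp add: field_simps)
    qed
    have term_bound: "\<bar>d k * r k - d k\<bar> \<le> real (a + 1) / real M * (\<bar>d k\<bar> * real (k + 1) ^ 2)" for k
    proof -
      have "\<bar>d k * r k - d k\<bar> = \<bar>d k\<bar> * \<bar>r k - 1\<bar>" by (simp add: abs_mult[symmetric] algebra_simps)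
      also have "\<dots> \<le> \<bar>d k\<bar> * (real (a + 1) * real (k + 1) ^ 2 / real M)"
        by (rule mult_left_mono[OF bound]) simp
      finally show ?thesis by (simp add: mult_ac)
    qed
    have "(\<lambda>k. d k * r k) sums (\<Sum>k\<le>M. d k * r k)"
      by (rule sums_finite) (auto simp: r_def)
    hence "(\<lambda>k. d k * r k - d k) sums ((\<Sum>k\<le>M. d k * r k) - suminf d)"
      by (rule sums_diff) (use sd in \<open>auto intro: summable_sums summable_rabs_cancel\<close>)
    moreover have "summable (\<lambda>k. real (a + 1) / real M * (\<bar>d k\<bar> * real (k + 1) ^ 2))"
      by (rule summable_mult[OF sm])
    ultimately have "\<bar>(\<Sum>k\<le>M. d k * r k) - suminf d\<bar> \<le> (\<Sum>k. real (a + 1) / real M * (\<bar>d k\<bar> * real (k + 1) ^ 2))"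
      using norm_suminf_le[of "\<lambda>k. d k * r k - d k"] term_bound by (simp add: sums_iff)
    also have "\<dots> = real (a + 1) / real M * (\<Sum>k. \<bar>d k\<bar> * real (k + 1) ^ 2)"
      by (rule suminf_mult[OF sm])
    also have "(\<Sum>k\<le>M. d k * r k) = (\<Sum>k\<le>M. d k * (real ((2 * M + a) choose (M - k)) / real ((2 * M + a) choose M)))"
      by (rule sum.cong) (auto simp: r_def)
    finally show "norm ((\<Sum>k\<le>M. d k * (real ((2 * M + a) choose (M - k)) / real ((2 * M + a) choose M))) - suminf d)
      \<le> real (a + 1) * (\<Sum>k. \<bar>d k\<bar> * real (k + 1) ^ 2) * norm (1 / real M)"
      by simp
  qed
qed

lemma bigo_cmult:
  fixes f g :: "'a \<Rightarrow> real"
  shows "f \<in> O[F](g) \<Longrightarrow> (\<lambda>x. c * f x) \<in> O[F](g)"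
  by (cases "c = 0") auto

text \<open>By f/g - a/b = ((f - a) - (a/b)(g - b))/g, where 1/g stays bounded because g tends to b
  \<noteq> 0.\<close>

lemma quotient_bigo:
  fixes f g h :: "'a \<Rightarrow> real"
  assumes f: "(\<lambda>x. f x - a) \<in> O[F](h)" and g: "(\<lambda>x. g x - b) \<in> O[F](h)"
    and b: "b \<noteq> 0" and h: "(h \<longlongrightarrow> 0) F"
  shows "(\<lambda>x. f x / g x - a / b) \<in> O[F](h)"
proof -
  obtain c where "\<forall>\<^sub>F x in F. norm (g x - b) \<le> c * norm (h x)"
    using g by (elim landau_o.bigE)
  hence "((\<lambda>x. g x - b) \<longlongrightarrow> 0) F"
    by (rule Lim_null_comparison) (use h in \<open>intro tendsto_mult_right_zero tendsto_norm_zero\<close>)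
  hence gb: "(g \<longlongrightarrow> b) F" by (simp add: LIM_zero_iff)
  hence "((\<lambda>x. inverse (g x)) \<longlongrightarrow> inverse b) F" using b by (rule tendsto_inverse)
  hence inv: "(\<lambda>x. inverse (g x)) \<in> O[F](\<lambda>_. 1)" by (intro bigoI_tendsto[of _ _ "inverse b"]) auto
  have "(\<lambda>x. (f x - a) - a / b * (g x - b)) \<in> O[F](h)"
    by (rule sum_in_bigo(2)[OF f bigo_cmult[OF g]])
  hence "(\<lambda>x. inverse (g x) * ((f x - a) - a / b * (g x - b))) \<in> O[F](\<lambda>x. 1 * h x)"
    by (rule landau_o.big.mult[OF inv])
  moreover have "\<forall>\<^sub>F x in F. inverse (g x) * ((f x - a) - a / b * (g x - b)) = f x / g x - a / b"
    using tendsto_imp_eventually_ne[OF gb b]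
    by eventually_elim (use b in \<open>simp add: field_simps\<close>)
  ultimately show ?thesis by (simp add: landau_o.big.in_cong)
qed

text \<open>For y \<ge> 1 all coefficients are nonnegative. For y = 0 the one at h = 1 is -1/2, but
  those with h \<ge> 2 vanish and the two remaining terms combine to a positive multiple of
  \<kappa>.\<close>

lemma asymp_denominator_pos:
  fixes \<kappa> :: real
  assumes n: "n \<ge> 1" and k: "0 < \<kappa>" "\<kappa> < 2"
  shows "(\<Sum>h=0..n. asymp_coeff n y h * (1 / (2 - \<kappa>) ^ (2 * n - h))) > 0"
proof (cases "y = 0")
  case False
  have nn: "asymp_coeff n y h \<ge> 0" for h
  proof (cases "h = 0")
    case False
    have "real_of_int (int y + int h - 2) = real (y + h - 2)" using \<open>y \<noteq> 0\<close> False by simp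
    thus ?thesis by (simp only: asymp_coeff_def binomial_gbinomial[symmetric]) simp
  qed (simp add: asymp_coeff_def)
  have "asymp_coeff n y 0 * (1 / (2 - \<kappa>) ^ (2 * n - 0)) > 0"
    using k by (simp add: asymp_coeff_def)
  thus ?thesis using nn k by (intro sum_pos2[of _ 0]) auto
next
  case True
  have z: "asymp_coeff n 0 h = 0" if "h \<ge> 2" for h
  proof -
    have "real_of_int (int 0 + int h - 2) = real (h - 2)" using that by simp
    moreover have "(h - 2) choose h = 0" using that by (simp add: binomial_eq_0)
    ultimately show ?thesis by (simp only: asymp_coeff_def binomial_gbinomial[symmetric])
  qed
  have "(\<Sum>h=0..n. asymp_coeff n y h * (1 / (2 - \<kappa>) ^ (2 * n - h)))
      = (\<Sum>h\<in>{0, 1}. asymp_coeff n y h * (1 / (2 - \<kappa>) ^ (2 * n - h)))"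
    using n z True by (intro sum.mono_neutral_right) auto
  also have "\<dots> = 1 / (2 - \<kappa>) ^ (2 * n) - (1 / 2) * (1 / (2 - \<kappa>) ^ (2 * n - 1))"
    using n True by (simp add: asymp_coeff_def field_simps)
  also have "(2 - \<kappa>) ^ (2 * n) = (2 - \<kappa>) * (2 - \<kappa>) ^ (2 * n - 1)"
    using n by (simp flip: power_Suc)
  also have "1 / ((2 - \<kappa>) * (2 - \<kappa>) ^ (2 * n - 1)) - (1 / 2) * (1 / (2 - \<kappa>) ^ (2 * n - 1))
      = (1 / (2 - \<kappa>) ^ (2 * n - 1)) * (\<kappa> / (2 * (2 - \<kappa>)))"
    using k by (simp add: field_simps)
  also have "\<dots> > 0" using k by simp
  finally show ?thesis .
qed

text \<open>\<open>mode_weight\<close> without its binomial, hence free of M; this is what survives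
  in the limit.\<close>

definition mode_coeff :: "nat \<Rightarrow> nat \<Rightarrow> nat \<Rightarrow> real" where
  "mode_coeff n y k = real (2 * k + (y + 2 * n - 1)) * height_poly n y (real k)"

text \<open>Crude: each linear factor is at most (y + 2n + 2)(k + 1), and their number is at most 2n
  + 1.\<close>

lemma mode_coeff_bound:
  "\<bar>mode_coeff n y k\<bar> \<le> real (y + 2 * n + 2) ^ (2 * n + 1) * real (k + 1) ^ (2 * n + 1)"
proof -
  define b where "b = real (y + 2 * n + 2) * real (k + 1)"
  have b1: "b \<ge> 1" unfolding b_def using mult_mono[of 1 "real (y + 2 * n + 2)" 1 "real (k + 1)"] by simp
  have b: "\<bar>u\<bar> \<le> b" if "\<bar>u\<bar> \<le> 2 * real k + real (y + 2 * n)" for u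
  proof -
    have "b = real (y + 2 * n + 2) + real (k * y) + real (2 * k * n) + 2 * real k"
      by (simp add: b_def algebra_simps)
    thus ?thesis using that of_nat_0_le_iff[of "k * y"] of_nat_0_le_iff[of "2 * k * n"] by linarith
  qed
  have "\<bar>height_poly n y (real k)\<bar> \<le> (\<Prod>r\<in>{1..<n}. b * b)"
    unfolding height_poly_def abs_prod
  proof (intro prod_mono conjI abs_ge_zero)
    fix r assume "r \<in> {1..<n}"
    thus "\<bar>(real k + real r) * (real k + real (y + 2 * n - 1) - real r)\<bar> \<le> b * b"
      unfolding abs_mult using b1 by (intro mult_mono b) (auto simp: of_nat_diff)
  qed
  also have "\<dots> = b ^ (2 * (n - 1))" by (simp add: power_mult power2_eq_square)
  finally have "\<bar>mode_coeff n y k\<bar> \<le> b * b ^ (2 * (n - 1))"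
    unfolding mode_coeff_def abs_mult using b1 by (intro mult_mono b) auto
  also have "\<dots> = b ^ Suc (2 * (n - 1))" by simp
  also have "\<dots> \<le> b ^ (2 * n + 1)" using b1 by (intro power_increasing) auto
  finally show ?thesis unfolding b_def power_mult_distrib .
qed

text \<open>The extra (k + 1)^2 is the one demanded by \<open>truncated_series_bigo\<close>. The
  derivative series is moved by one index to remove the exponent k - 1, at the cost of k + 2 \<le>
  2(k + 1).\<close>

lemma mode_series_summable:
  fixes x :: real
  assumes x: "\<bar>x\<bar> < 1"
  shows "summable (\<lambda>k. \<bar>x ^ k * mode_coeff n y k\<bar> * real (k + 1) ^ 2)"
    and "summable (\<lambda>k. \<bar>real k * x ^ (k - 1) * mode_coeff n y k\<bar> * real (k + 1) ^ 2)"
proof -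
  define K where "K = real (y + 2 * n + 2) ^ (2 * n + 1)"
  have K: "K \<ge> 0" by (simp add: K_def)
  have bound: "\<bar>mode_coeff n y k\<bar> * real (k + 1) ^ 2 \<le> K * real (k + 1) ^ (2 * n + 3)" for k
    using mult_right_mono[OF mode_coeff_bound[of n y k], of "real (k + 1) ^ 2"]
    by (simp add: K_def power_add numeral_eq_Suc mult_ac)
  show "summable (\<lambda>k. \<bar>x ^ k * mode_coeff n y k\<bar> * real (k + 1) ^ 2)"
  proof (rule summable_comparison_test')
    show "summable (\<lambda>k. K * (real (k + 1) ^ (2 * n + 3) * \<bar>x\<bar> ^ k))"
      by (intro summable_mult summable_polynomial_geometric x)
    fix k :: nat
    show "norm (\<bar>x ^ k * mode_coeff n y k\<bar> * real (k + 1) ^ 2) \<le> K * (real (k + 1) ^ (2 * n + 3) * \<bar>x\<bar> ^ k)"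
      using mult_left_mono[OF bound[of k], of "\<bar>x\<bar> ^ k"] by (simp add: abs_mult power_abs mult_ac)
  qed
  have "summable (\<lambda>k. \<bar>real (Suc k) * x ^ (Suc k - 1) * mode_coeff n y (Suc k)\<bar> * real (Suc k + 1) ^ 2)"
  proof (rule summable_comparison_test')
    show "summable (\<lambda>k. K * 2 ^ (2 * n + 3) * (real (k + 1) ^ (2 * n + 4) * \<bar>x\<bar> ^ k))"
      by (intro summable_mult summable_polynomial_geometric x)
    fix k :: nat
    have "\<bar>mode_coeff n y (Suc k)\<bar> * real (Suc k + 1) ^ 2 \<le> K * real (Suc k + 1) ^ (2 * n + 3)"
      by (rule bound)
    also have "\<dots> \<le> K * (2 * real (k + 1)) ^ (2 * n + 3)"
      using K by (intro mult_left_mono power_mono) auto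
    finally have "real (k + 1) * (\<bar>mode_coeff n y (Suc k)\<bar> * real (Suc k + 1) ^ 2)
        \<le> real (k + 1) * (K * (2 * real (k + 1)) ^ (2 * n + 3))" by (rule mult_left_mono) simp
    also have "\<dots> = K * 2 ^ (2 * n + 3) * real (k + 1) ^ (2 * n + 4)"
    proof -
      have "real (k + 1) ^ (2 * n + 4) = real (k + 1) * real (k + 1) ^ (2 * n + 3)"
        by (simp flip: power_Suc add: numeral_eq_Suc)
      thus ?thesis unfolding power_mult_distrib by simp
    qed
    finally have "\<bar>x\<bar> ^ k * (real (k + 1) * (\<bar>mode_coeff n y (Suc k)\<bar> * real (Suc k + 1) ^ 2))
        \<le> \<bar>x\<bar> ^ k * (K * 2 ^ (2 * n + 3) * real (k + 1) ^ (2 * n + 4))" by (rule mult_left_mono) simp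
    thus "norm (\<bar>real (Suc k) * x ^ (Suc k - 1) * mode_coeff n y (Suc k)\<bar> * real (Suc k + 1) ^ 2)
      \<le> K * 2 ^ (2 * n + 3) * (real (k + 1) ^ (2 * n + 4) * \<bar>x\<bar> ^ k)"
      by (simp add: abs_mult power_abs mult_ac)
  qed
  thus "summable (\<lambda>k. \<bar>real k * x ^ (k - 1) * mode_coeff n y k\<bar> * real (k + 1) ^ 2)"
    by (subst (asm) summable_Suc_iff)
qed

text \<open>Division of numerator and denominator by (2M + a choose M) turns both into truncated
  series in x = \<kappa> - 1 with |x| < 1; the limits are \<open>F * Q'\<close> and
  \<open>F * Q\<close>, and F cancels.\<close>

lemma mean_contacts_weak:
  fixes \<kappa> :: real
  assumes n: "n \<ge> 1" and \<kappa>: "0 < \<kappa>" "\<kappa> < 2"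
  shows "(\<lambda>M. mean_contacts n (2 * M + y) y \<kappa> - (1 + \<kappa> *
      (\<Sum>h=0..n. real (2 * n - h) * asymp_coeff n y h * (1 / (2 - \<kappa>) ^ (2 * n - h + 1))) /
      (\<Sum>h=0..n. asymp_coeff n y h * (1 / (2 - \<kappa>) ^ (2 * n - h))))) \<in> O(\<lambda>M. 1 / real M)"
proof -
  define x where "x = \<kappa> - 1"
  define a where "a = y + 2 * n - 1"
  have x: "\<bar>x\<bar> < 1" using \<kappa> by (auto simp: x_def)
  have x2: "1 - x = 2 - \<kappa>" by (simp add: x_def)
  define Q where "Q = (\<Sum>h=0..n. asymp_coeff n y h * (1 / (2 - \<kappa>) ^ (2 * n - h)))"
  define Q' where "Q' = (\<Sum>h=0..n. real (2 * n - h) * asymp_coeff n y h * (1 / (2 - \<kappa>) ^ (2 * n - h + 1)))"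
  define F where "F = (2 * fact (2 * n - 1) :: real)"
  have coeff: "mode_coeff n y k = F * (\<Sum>h=0..n. asymp_coeff n y h * real ((k + (2 * n - 1 - h)) choose k))" for k
    unfolding mode_coeff_def F_def by (rule mode_coeff_expand[OF n])
  have "(\<lambda>k. F * (\<Sum>h=0..n. asymp_coeff n y h * (real ((k + (2 * n - 1 - h)) choose k) * x ^ k))) sums
      (F * (\<Sum>h=0..n. asymp_coeff n y h * (1 / (1 - x) ^ Suc (2 * n - 1 - h))))"
    by (intro sums_mult sums_sum negative_binomial_sums x)
  also have "(\<Sum>h=0..n. asymp_coeff n y h * (1 / (1 - x) ^ Suc (2 * n - 1 - h))) = Q"
    unfolding Q_def x2 using n by (intro sum.cong) (auto simp: Suc_diff_le simp del: power_Suc intro!: arg_cong[of _ _ "(^) (2 - \<kappa>)"])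
  finally have Q: "(\<Sum>k. x ^ k * mode_coeff n y k) = F * Q"
    unfolding coeff by (simp add: sums_iff sum_distrib_left mult_ac)
  have "(\<lambda>k. F * (\<Sum>h=0..n. asymp_coeff n y h * (real ((k + (2 * n - 1 - h)) choose k) * (real k * x ^ (k - 1))))) sums
      (F * (\<Sum>h=0..n. asymp_coeff n y h * (real (Suc (2 * n - 1 - h)) / (1 - x) ^ Suc (Suc (2 * n - 1 - h)))))"
    by (intro sums_mult sums_sum negative_binomial_deriv_sums x)
  also have "(\<Sum>h=0..n. asymp_coeff n y h * (real (Suc (2 * n - 1 - h)) / (1 - x) ^ Suc (Suc (2 * n - 1 - h)))) = Q'"
    unfolding Q'_def x2
  proof (rule sum.cong[OF refl])
    fix h assume "h \<in> {0..n}"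
    hence "Suc (2 * n - 1 - h) = 2 * n - h" using n by auto
    thus "asymp_coeff n y h * (real (Suc (2 * n - 1 - h)) / (2 - \<kappa>) ^ Suc (Suc (2 * n - 1 - h))) =
        real (2 * n - h) * asymp_coeff n y h * (1 / (2 - \<kappa>) ^ (2 * n - h + 1))" by simp
  qed
  finally have Q': "(\<Sum>k. real k * x ^ (k - 1) * mode_coeff n y k) = F * Q'"
    unfolding coeff by (simp add: sums_iff sum_distrib_left mult_ac)
  let ?B = "\<lambda>M k. real ((2 * M + a) choose (M - k)) / real ((2 * M + a) choose M)"
  have "(\<lambda>M. (\<Sum>k\<le>M. real k * x ^ (k - 1) * mode_coeff n y k * ?B M k) /
      (\<Sum>k\<le>M. x ^ k * mode_coeff n y k * ?B M k) - (F * Q') / (F * Q)) \<in> O(\<lambda>M. 1 / real M)"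
  proof (rule quotient_bigo)
    show "F * Q \<noteq> 0" using asymp_denominator_pos[OF n \<kappa>, of y] by (simp add: F_def Q_def)
    show "(\<lambda>M. 1 / real M) \<longlonglongrightarrow> 0" by (rule lim_1_over_n)
    show "(\<lambda>M. (\<Sum>k\<le>M. real k * x ^ (k - 1) * mode_coeff n y k * ?B M k) - F * Q') \<in> O(\<lambda>M. 1 / real M)"
      unfolding Q'[symmetric] by (rule truncated_series_bigo[OF mode_series_summable(2)[OF x]])
    show "(\<lambda>M. (\<Sum>k\<le>M. x ^ k * mode_coeff n y k * ?B M k) - F * Q) \<in> O(\<lambda>M. 1 / real M)"
      unfolding Q[symmetric] by (rule truncated_series_bigo[OF mode_series_summable(1)[OF x]])
  qed
  hence "(\<lambda>M. \<kappa> * ((\<Sum>k\<le>M. real k * x ^ (k - 1) * mode_coeff n y k * ?B M k) /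
      (\<Sum>k\<le>M. x ^ k * mode_coeff n y k * ?B M k) - (F * Q') / (F * Q))) \<in> O(\<lambda>M. 1 / real M)"
    by (rule bigo_cmult)
  also have "(\<lambda>M. \<kappa> * ((\<Sum>k\<le>M. real k * x ^ (k - 1) * mode_coeff n y k * ?B M k) /
      (\<Sum>k\<le>M. x ^ k * mode_coeff n y k * ?B M k) - (F * Q') / (F * Q))) =
      (\<lambda>M. mean_contacts n (2 * M + y) y \<kappa> - (1 + \<kappa> * Q' / Q))"
  proof
    fix M
    define c where "c = real ((2 * M + a) choose M)"
    have c: "c \<noteq> 0" by (simp add: c_def)
    have w: "mode_weight n y M k = mode_coeff n y k * ?B M k * c" for k
      using c by (simp add: mode_weight_def mode_coeff_def a_def c_def)
    have "(\<Sum>k\<le>M. real k * (\<kappa> - 1) ^ (k - 1) * mode_weight n y M k)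
        = c * (\<Sum>k\<le>M. real k * x ^ (k - 1) * mode_coeff n y k * ?B M k)"
      unfolding w sum_distrib_left x_def by (intro sum.cong) (simp_all only: mult_ac)
    moreover have "mode_sum n y M (\<kappa> - 1) = c * (\<Sum>k\<le>M. x ^ k * mode_coeff n y k * ?B M k)"
      unfolding w sum_distrib_left x_def mode_sum_def by (intro sum.cong) (simp_all only: mult_ac)
    ultimately have "mean_contacts n (2 * M + y) y \<kappa> = 1 + \<kappa> * (c * (\<Sum>k\<le>M. real k * x ^ (k - 1) * mode_coeff n y k * ?B M k))
        / (c * (\<Sum>k\<le>M. x ^ k * mode_coeff n y k * ?B M k))"
      using mean_contacts_eq(2)[OF n \<kappa>(1), of M y] by simp
    thus "\<kappa> * ((\<Sum>k\<le>M. real k * x ^ (k - 1) * mode_coeff n y k * ?B M k) /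
      (\<Sum>k\<le>M. x ^ k * mode_coeff n y k * ?B M k) - (F * Q') / (F * Q)) =
      mean_contacts n (2 * M + y) y \<kappa> - (1 + \<kappa> * Q' / Q)"
      using c by (simp add: F_def right_diff_distrib)
  qed
  finally show ?thesis unfolding Q_def Q'_def .
qed

subsection \<open>Binomial moments\<close>

definition fall :: "nat \<Rightarrow> nat \<Rightarrow> real" where
  "fall N i = (\<Prod>l<i. real N - real l)"

text \<open>Up to the normalization \<open>(1 + w)\<^sup>N\<close>, moments about \<open>N/2\<close> of a binomial variable with success probability
  \<open>w / (1 + w)\<close>. In the basis of falling factorials of \<open>N\<close> their recursion has no shift in \<open>N\<close>.\<close>

definition moment :: "real \<Rightarrow> nat \<Rightarrow> nat \<Rightarrow> real" where
  "moment w m N = (\<Sum>j\<le>N. real (N choose j) * w ^ j * (real N / 2 - real j) ^ m) / (1 + w) ^ N"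

lemma fall_Suc: "fall N (Suc i) = fall N i * (real N - real i)"
  by (simp add: fall_def)

lemma fall_0 [simp]: "fall N 0 = 1"
  by (simp add: fall_def)

lemma fall_Suc_Suc: "fall (Suc N) (Suc i) = real (Suc N) * fall N i"
  by (induction i) (simp_all add: fall_Suc)

lemma times_fall: "real N * fall N i = fall N (Suc i) + real i * fall N i"
  by (simp add: fall_Suc algebra_simps)

text \<open>A linear factor that is antisymmetric about the centre of the row turns a binomial into
  a difference of neighbours one row up. This drives both the moment recursion and the summation by
  parts at \<kappa> = 2.\<close>

lemma binomial_Suc_difference:
  "real (Suc N choose j) * (real (Suc N) - 2 * real j) =
    real (Suc N) * (real (N choose j) - (if j = 0 then 0 else real (N choose (j - 1))))"
proof (cases j)
  case (Suc i)
  have "Suc i * (Suc N choose Suc i) = Suc N * (N choose i)"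
    using binomial_absorption[of i "Suc N"] by simp
  hence 1: "real (Suc i) * real (Suc N choose Suc i) = real (Suc N) * real (N choose i)"
    by (metis of_nat_mult)
  have 2: "real (Suc N choose Suc i) = real (N choose i) + real (N choose Suc i)" by simp
  have "real (Suc N choose Suc i) * (real (Suc N) - 2 * real (Suc i)) =
      real (Suc N) * real (Suc N choose Suc i) - 2 * (real (Suc i) * real (Suc N choose Suc i))"
    by (simp only: algebra_simps)
  also have "\<dots> = real (Suc N) * (real (N choose Suc i) - real (N choose i))"
    unfolding 1 unfolding 2 by (simp only: algebra_simps)
  finally show ?thesis using Suc by simp
qed simp

lemma moment_0: "w > 0 \<Longrightarrow> moment w 0 N = 1"
  using binomial_ring[of w 1 N, symmetric] by (simp add: moment_def add.commute)

lemma moment_Suc_0: "moment w (Suc m) 0 = 0"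
  by (simp add: moment_def)

text \<open>One factor (N + 1)/2 - j is spent on turning the binomial into a difference of entries
  of row N. After recentring at N/2 this leaves (u + 1/2)^m - w (u - 1/2)^m, whose expansion in u
  gives lower moments for N.\<close>

lemma moment_Suc_Suc:
  assumes w: "w > 0"
  shows "moment w (Suc m) (Suc N) = real (Suc N) * (\<Sum>l\<le>m. real (m choose l) / 2 ^ Suc l *
    ((1 - (-1) ^ l * w) / (1 + w)) * moment w (m - l) N)"
proof -
  define u where "u = (\<lambda>j. real N / 2 - real j)"
  have z: "real (Suc N) / 2 - real j = u j + 1 / 2" for j
    by (simp add: u_def field_simps)
  have "(\<Sum>j\<le>Suc N. real (Suc N choose j) * w ^ j * (real (Suc N) / 2 - real j) ^ Suc m)
      = (\<Sum>j\<le>Suc N. (real (Suc N) / 2) * ((real (N choose j) - (if j = 0 then 0 else real (N choose (j - 1)))) * w ^ j * (u j + 1 / 2) ^ m))"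
  proof (rule sum.cong[OF refl])
    fix j
    have "real (Suc N choose j) * w ^ j * (real (Suc N) / 2 - real j) ^ Suc m =
        (real (Suc N choose j) * (real (Suc N) - 2 * real j)) / 2 * w ^ j * (real (Suc N) / 2 - real j) ^ m"
      by (simp add: field_simps)
    thus "real (Suc N choose j) * w ^ j * (real (Suc N) / 2 - real j) ^ Suc m =
        (real (Suc N) / 2) * ((real (N choose j) - (if j = 0 then 0 else real (N choose (j - 1)))) * w ^ j * (u j + 1 / 2) ^ m)"
      unfolding binomial_Suc_difference z by (simp only: mult_ac times_divide_eq_left times_divide_eq_right)
  qed
  also have "\<dots> = (real (Suc N) / 2) * ((\<Sum>j\<le>Suc N. real (N choose j) * w ^ j * (u j + 1 / 2) ^ m)
      - (\<Sum>j\<le>Suc N. (if j = 0 then 0 else real (N choose (j - 1))) * w ^ j * (u j + 1 / 2) ^ m))"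
    by (simp only: sum_distrib_left[symmetric] left_diff_distrib sum_subtractf)
  also have "(\<Sum>j\<le>Suc N. real (N choose j) * w ^ j * (u j + 1 / 2) ^ m)
      = (\<Sum>j\<le>N. real (N choose j) * w ^ j * (u j + 1 / 2) ^ m)"
    by (simp add: binomial_eq_0)
  also have "(\<Sum>j\<le>Suc N. (if j = 0 then 0 else real (N choose (j - 1))) * w ^ j * (u j + 1 / 2) ^ m)
      = (\<Sum>j\<le>N. real (N choose j) * w ^ Suc j * (u j - 1 / 2) ^ m)"
  proof -
    have E: "u (Suc j) + 1 / 2 = u j - 1 / 2" for j by (simp add: u_def field_simps)
    show ?thesis by (subst sum.atMost_Suc_shift) (simp only: E, simp)
  qed
  also have "(\<Sum>j\<le>N. real (N choose j) * w ^ j * (u j + 1 / 2) ^ m)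
      - (\<Sum>j\<le>N. real (N choose j) * w ^ Suc j * (u j - 1 / 2) ^ m)
      = (\<Sum>j\<le>N. \<Sum>l\<le>m. (real (m choose l) / 2 ^ l * (1 - (-1) ^ l * w)) * (real (N choose j) * w ^ j * u j ^ (m - l)))"
  proof -
    have b: "(v + u) ^ m = (\<Sum>l\<le>m. real (m choose l) * v ^ l * u ^ (m - l))" for v u :: real
      by (rule binomial_ring)
    have "(u j + 1 / 2) ^ m - w * (u j - 1 / 2) ^ m
        = (\<Sum>l\<le>m. real (m choose l) / 2 ^ l * (1 - (-1) ^ l * w) * u j ^ (m - l))" for j
    proof -
      have "(u j + 1 / 2) ^ m - w * (u j - 1 / 2) ^ m
          = (\<Sum>l\<le>m. real (m choose l) * (1 / 2) ^ l * u j ^ (m - l)) - w * (\<Sum>l\<le>m. real (m choose l) * (- 1 / 2) ^ l * u j ^ (m - l))"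
        using b[of "1 / 2" "u j"] b[of "- 1 / 2" "u j"] by (simp add: add.commute)
      also have "\<dots> = (\<Sum>l\<le>m. real (m choose l) / 2 ^ l * (1 - (-1) ^ l * w) * u j ^ (m - l))"
        unfolding sum_distrib_left sum_subtractf[symmetric] power_divide
        by (intro sum.cong) (simp_all add: field_simps)
      finally show ?thesis .
    qed
    hence "real (N choose j) * w ^ j * ((u j + 1 / 2) ^ m - w * (u j - 1 / 2) ^ m)
        = (\<Sum>l\<le>m. (real (m choose l) / 2 ^ l * (1 - (-1) ^ l * w)) * (real (N choose j) * w ^ j * u j ^ (m - l)))" for j
      by (simp add: sum_distrib_left mult_ac)
    thus ?thesis unfolding sum_subtractf[symmetric]
      by (intro sum.cong) (simp_all add: right_diff_distrib mult_ac)
  qed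
  also have "\<dots> = (\<Sum>l\<le>m. (real (m choose l) / 2 ^ l * (1 - (-1) ^ l * w)) * ((1 + w) ^ N * moment w (m - l) N))"
  proof -
    have "(1 + w) ^ N * moment w k N = (\<Sum>j\<le>N. real (N choose j) * w ^ j * u j ^ k)" for k
      using w by (simp add: moment_def u_def)
    thus ?thesis by (subst sum.swap) (simp add: sum_distrib_left)
  qed
  finally have "moment w (Suc m) (Suc N) = real (Suc N) / 2 * (\<Sum>l\<le>m. (real (m choose l) / 2 ^ l * (1 - (-1) ^ l * w)) *
      ((1 + w) ^ N * moment w (m - l) N)) / (1 + w) ^ Suc N"
    by (simp only: moment_def)
  also have "\<dots> = real (Suc N) * (\<Sum>l\<le>m. real (m choose l) / 2 ^ Suc l *
    ((1 - (-1) ^ l * w) / (1 + w)) * moment w (m - l) N)"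
  proof -
    have "A / 2 * (B / C * D * (E * G)) / (H * E) = A * (B / (2 * C) * (D / H) * G)"
      if "E \<noteq> 0" for A B C D E G H :: real using that by simp
    thus ?thesis using w unfolding sum_distrib_left sum_divide_distrib power_Suc by (intro sum.cong refl) simp
  qed
  finally show ?thesis .
qed

text \<open>The moment is that of a sum of N independent variables with values 1/2 and -1/2 and mean
  \<beta>. Expanding the m-th power, \<open>c i\<close> is the sum over partitions of the m factors
  into i blocks of the product of block moments: singletons give \<beta>^m, and for i = m - 1 one
  pair has second moment 1/4. At w = 1 odd blocks contribute 0, so i is at most m/2, and the perfect
  matchings give (2k)!/(2^k k!) times 1/4^k.\<close>

definition moment_coeffs :: "real \<Rightarrow> nat \<Rightarrow> (nat \<Rightarrow> real) \<Rightarrow> bool" where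
  "moment_coeffs w m c \<longleftrightarrow> (let \<beta> = (1 - w) / (2 * (1 + w)) in
     (\<forall>N. moment w m N = (\<Sum>i\<le>m. c i * fall N i)) \<and> (\<forall>i>m. c i = 0) \<and>
     c m = \<beta> ^ m \<and> (0 < m \<longrightarrow> c (m - 1) = real (m choose 2) * \<beta> ^ (m - 2) / 4) \<and>
     (w = 1 \<longrightarrow> (\<forall>i. m < 2 * i \<longrightarrow> c i = 0) \<and> (\<forall>k. m = 2 * k \<longrightarrow> c k = fact (2 * k) / (8 ^ k * fact k))))"

text \<open>Strong induction by \<open>moment_Suc_Suc\<close>: the factor N + 1 turns
  \<open>fall N i\<close> into \<open>fall (Suc N) (Suc i)\<close>, so while the order of the moment
  rises by l + 1, the index i rises by exactly one.\<close>

lemma moment_coeffs_exist: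
  assumes w: "w > 0"
  shows "\<exists>c. moment_coeffs w m c"
proof (induction m rule: less_induct)
  case (less m)
  define \<beta> where "\<beta> = (1 - w) / (2 * (1 + w))"
  show ?case
  proof (cases m)
    case 0
    have "moment_coeffs w 0 (\<lambda>i. if i = 0 then 1 else 0)"
      by (simp add: moment_coeffs_def Let_def moment_0[OF w])
    thus ?thesis using 0 by blast
  next
    case (Suc m')
    from less Suc have "\<forall>k. \<exists>c. k \<le> m' \<longrightarrow> moment_coeffs w k c" by (metis less_Suc_eq_le)
    then obtain C where C: "\<And>k. k \<le> m' \<Longrightarrow> moment_coeffs w k (C k)" by metis
    have C1: "moment w k N = (\<Sum>i\<le>k. C k i * fall N i)" if "k \<le> m'" for k N
      using C[OF that] by (simp add: moment_coeffs_def Let_def)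
    have C2: "C k i = 0" if "k \<le> m'" "i > k" for k i
      using C[OF that(1)] that(2) by (simp add: moment_coeffs_def Let_def)
    have C3: "C k k = \<beta> ^ k" if "k \<le> m'" for k
      using C[OF that] by (simp add: moment_coeffs_def Let_def \<beta>_def)
    have C4: "C k (k - 1) = real (k choose 2) * \<beta> ^ (k - 2) / 4" if "k \<le> m'" "0 < k" for k
      using C[OF that(1)] that(2) by (simp add: moment_coeffs_def Let_def \<beta>_def)
    have C5: "C k i = 0" if "k \<le> m'" "w = 1" "k < 2 * i" for k i
      using C[OF that(1)] that(2,3) by (simp add: moment_coeffs_def Let_def)
    have C6: "C (2 * k) k = fact (2 * k) / (8 ^ k * fact k)" if "2 * k \<le> m'" "w = 1" for k
      using C[OF that(1)] that(2) by (simp add: moment_coeffs_def Let_def)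
    define g where "g = (\<lambda>l. real (m' choose l) / 2 ^ Suc l * ((1 - (-1) ^ l * w) / (1 + w)))"
    define c where "c = (\<lambda>i. if i = 0 then 0 else \<Sum>l\<le>m'. g l * C (m' - l) (i - 1))"
    have g0: "g 0 = \<beta>" by (simp add: g_def \<beta>_def)
    have g1: "g 1 = real m' / 4"
    proof -
      have "(1 - (-1) ^ 1 * w) / (1 + w) = 1" using w by simp
      thus ?thesis unfolding g_def by simp
    qed
    \<comment> \<open>At w = 1 only odd l survive, so the order rises by at least 2 whenever i rises
      by 1; this caps the degree at m/2.\<close>
    have geven: "g l = 0" if "w = 1" "even l" for l using that by (simp add: g_def)
    have A: "moment w m N = (\<Sum>i\<le>m. c i * fall N i)" for N
    proof (cases N)
      case 0
      have "fall 0 (Suc i) = 0" for i by (induction i) (simp_all add: fall_Suc)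
      thus ?thesis using 0 Suc by (simp add: moment_Suc_0 sum.atMost_Suc_shift c_def del: sum.atMost_Suc)
    next
      case (Suc N')
      have "moment w m N = real (Suc N') * (\<Sum>l\<le>m'. g l * moment w (m' - l) N')"
        using moment_Suc_Suc[OF w, of m' N'] Suc \<open>m = Suc m'\<close> by (simp add: g_def)
      also have "(\<Sum>l\<le>m'. g l * moment w (m' - l) N') = (\<Sum>l\<le>m'. \<Sum>i\<le>m'. g l * C (m' - l) i * fall N' i)"
      proof (rule sum.cong[OF refl])
        fix l
        have "moment w (m' - l) N' = (\<Sum>i\<le>m' - l. C (m' - l) i * fall N' i)" by (rule C1) simp
        also have "\<dots> = (\<Sum>i\<le>m'. C (m' - l) i * fall N' i)"
          by (rule sum.mono_neutral_left) (auto simp: C2)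
        finally show "g l * moment w (m' - l) N' = (\<Sum>i\<le>m'. g l * C (m' - l) i * fall N' i)"
          by (simp add: sum_distrib_left mult_ac)
      qed
      also have "real (Suc N') * \<dots> = (\<Sum>i\<le>m'. c (Suc i) * fall N (Suc i))"
        unfolding Suc fall_Suc_Suc
        by (subst sum.swap) (simp add: c_def sum_distrib_left sum_distrib_right mult_ac)
      also have "\<dots> = (\<Sum>i\<le>m. c i * fall N i)"
        unfolding \<open>m = Suc m'\<close> sum.atMost_Suc_shift by (simp add: c_def)
      finally show ?thesis .
    qed
    have B: "c i = 0" if "i > m" for i
      using that Suc unfolding c_def by (auto intro!: sum.neutral C2)
    \<comment> \<open>Only l = 0 reaches the top coefficient, and only l = 0 and l = 1 reach the one
      below it.\<close>
    have D: "c m = \<beta> ^ m"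
    proof -
      have "c m = (\<Sum>l\<le>m'. g l * C (m' - l) m')" by (simp add: c_def Suc)
      also have "\<dots> = (\<Sum>l\<in>{0}. g l * C (m' - l) m')"
        by (rule sum.mono_neutral_right) (auto intro!: C2)
      finally show ?thesis using C3[of m'] by (simp add: g0 Suc)
    qed
    have E: "c (m - 1) = real (m choose 2) * \<beta> ^ (m - 2) / 4"
    proof (cases m')
      case 0
      thus ?thesis by (simp add: Suc c_def)
    next
      case (Suc k)
      have "c (m - 1) = (\<Sum>l\<le>m'. g l * C (m' - l) k)" by (simp add: c_def Suc \<open>m = Suc m'\<close>)
      also have "\<dots> = (\<Sum>l\<in>{0, 1}. g l * C (m' - l) k)"
        by (rule sum.mono_neutral_right) (auto intro!: C2 simp: Suc)
      also have "\<dots> = \<beta> * (real (m' choose 2) * \<beta> ^ (m' - 2) / 4) + real m' / 4 * \<beta> ^ k"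
        using C4[of m'] C3[of k] by (simp add: g0 g1 Suc del: One_nat_def)
      also have "\<beta> * (real (m' choose 2) * \<beta> ^ (m' - 2) / 4) = real (m' choose 2) * \<beta> ^ k / 4"
        by (cases k) (simp_all add: Suc)
      also have "real (m choose 2) = real (m' choose 2) + real m'"
        by (simp add: \<open>m = Suc m'\<close> numeral_2_eq_2)
      hence "real (m' choose 2) * \<beta> ^ k / 4 + real m' / 4 * \<beta> ^ k = real (m choose 2) * \<beta> ^ (m - 2) / 4"
        by (simp add: \<open>m = Suc m'\<close> Suc field_simps)
      finally show ?thesis .
    qed
    have F: "c i = 0" if "w = 1" "m < 2 * i" for i
    proof (cases i)
      case (Suc i')
      have "g l * C (m' - l) i' = 0" if "l \<le> m'" for l
      proof (cases "even l")
        case False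
        hence "l \<ge> 1" by (auto simp: odd_pos Suc_leI)
        hence "m' - l < 2 * i'" using that \<open>m < 2 * i\<close> Suc \<open>m = Suc m'\<close> by linarith
        thus ?thesis using C5[of "m' - l" i'] \<open>w = 1\<close> by simp
      qed (use geven \<open>w = 1\<close> in simp)
      thus ?thesis using Suc by (auto simp: c_def intro!: sum.neutral)
    qed (simp add: c_def)
    have G: "c k = fact (2 * k) / (8 ^ k * fact k)" if "w = 1" and mk: "m = 2 * k" for k
    proof -
      obtain k' where k: "k = Suc k'" "m' = 2 * k' + 1" using mk Suc by (cases k) auto
      have "c k = (\<Sum>l\<le>m'. g l * C (m' - l) k')" by (simp add: c_def k)
      also have "\<dots> = (\<Sum>l\<in>{1}. g l * C (m' - l) k')"
      proof (rule sum.mono_neutral_right)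
        show "\<forall>l\<in>{..m'} - {1}. g l * C (m' - l) k' = 0"
        proof
          fix l assume l: "l \<in> {..m'} - {1}"
          show "g l * C (m' - l) k' = 0"
          proof (cases "even l")
            case False
            hence "l \<ge> 2" using l by (cases l) (auto simp: Suc_leI odd_pos)
            hence "m' - l < 2 * k'" using l k by auto
            thus ?thesis using C5[of "m' - l" k'] \<open>w = 1\<close> by simp
          qed (use geven \<open>w = 1\<close> in simp)
        qed
      qed (auto simp: k)
      also have "\<dots> = real (2 * k' + 1) / 4 * (fact (2 * k') / (8 ^ k' * fact k'))"
        using C6[of k'] \<open>w = 1\<close> by (simp only: sum.insert sum.empty finite.emptyI finite.insertI empty_iff if_False
            not_False_eq_True g1) (simp add: k)
      also have "\<dots> = fact (2 * k) / (8 ^ k * fact k)"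
        by (simp add: k divide_simps)
      finally show ?thesis .
    qed
    have "moment_coeffs w m c"
      unfolding moment_coeffs_def Let_def using A B D E F G by (auto simp: \<beta>_def)
    thus ?thesis by blast
  qed
qed

section \<open>Orders of growth of falling factorials and moments\<close>

lemma diff_const_bigtheta: "(\<lambda>N. real N - c) \<in> \<Theta>(\<lambda>N. real N)"
proof (rule bigthetaI_tendsto[of 1])
  have "(\<lambda>N. 1 - c * (1 / real N)) \<longlonglongrightarrow> 1 - c * 0"
    by (intro tendsto_intros lim_1_over_n)
  moreover have "\<forall>\<^sub>F N in sequentially. 1 - c * (1 / real N) = (real N - c) / real N"
    using eventually_gt_at_top[of 0] by eventually_elim (simp add: field_simps)
  ultimately show "(\<lambda>N. (real N - c) / real N) \<longlonglongrightarrow> 1"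
    by (simp add: tendsto_cong)
qed simp

lemma fall_bigtheta: "(\<lambda>N. fall N i) \<in> \<Theta>(\<lambda>N. real N ^ i)"
proof (induction i)
  case (Suc i)
  have "(\<lambda>N. fall N i * (real N - real i)) \<in> \<Theta>(\<lambda>N. real N ^ i * real N)"
    by (rule landau_theta.mult[OF Suc diff_const_bigtheta])
  thus ?case by (simp add: fall_Suc mult_ac)
qed simp

lemma power_bigo_mono: "i \<le> d \<Longrightarrow> (\<lambda>N. real N ^ i) \<in> O(\<lambda>N. real N ^ d)"
proof (rule bigoI[of _ 1])
  assume "i \<le> d"
  show "\<forall>\<^sub>F N in sequentially. norm (real N ^ i) \<le> 1 * norm (real N ^ d)"
    using eventually_ge_at_top[of 1]
    by eventually_elim (use \<open>i \<le> d\<close> in \<open>auto intro!: power_increasing\<close>)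
qed

lemma fall_bigo: "i \<le> d \<Longrightarrow> (\<lambda>N. fall N i) \<in> O(\<lambda>N. real N ^ d)"
  using fall_bigtheta power_bigo_mono by (blast intro: landau_o.big.trans)

lemma sum_fall_bigo:
  assumes "\<And>i. i \<in> I \<Longrightarrow> i \<le> d"
  shows "(\<lambda>N. \<Sum>i\<in>I. c i * fall N i) \<in> O(\<lambda>N. real N ^ d)"
  by (intro big_sum_in_bigo bigo_cmult fall_bigo assms)

lemma moment_bigo:
  assumes "w > 0" "m \<le> d"
  shows "(\<lambda>N. moment w m N) \<in> O(\<lambda>N. real N ^ d)"
proof -
  obtain c where "moment_coeffs w m c" using moment_coeffs_exist[OF assms(1)] by blast
  hence "(\<lambda>N. moment w m N) = (\<lambda>N. \<Sum>i\<le>m. c i * fall N i)" by (simp add: moment_coeffs_def Let_def)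
  thus ?thesis using assms(2) by (simp only:) (intro sum_fall_bigo, simp)
qed

lemma moment_symmetric_asymp: "(\<lambda>N. moment 1 (2 * n) N - fact (2 * n) / (8 ^ n * fact n) * fall N n) \<in> O(\<lambda>N. real N ^ (n - 1))"
  and moment_symmetric_bigo: "n \<le> d \<Longrightarrow> (\<lambda>N. moment 1 (2 * n) N) \<in> O(\<lambda>N. real N ^ d)"
proof -
  obtain c where c: "moment_coeffs 1 (2 * n) c" using moment_coeffs_exist[of 1] by auto
  have E: "moment 1 (2 * n) N = (\<Sum>i\<le>n. c i * fall N i)" for N
  proof -
    have "moment 1 (2 * n) N = (\<Sum>i\<le>2 * n. c i * fall N i)" using c by (simp add: moment_coeffs_def Let_def)
    also have "\<dots> = (\<Sum>i\<le>n. c i * fall N i)"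
      by (rule sum.mono_neutral_right) (use c in \<open>auto simp: moment_coeffs_def Let_def\<close>)
    finally show ?thesis .
  qed
  have cn: "c n = fact (2 * n) / (8 ^ n * fact n)" using c by (simp add: moment_coeffs_def Let_def)
  have "moment 1 (2 * n) N - fact (2 * n) / (8 ^ n * fact n) * fall N n = (\<Sum>i<n. c i * fall N i)" for N
    unfolding E cn[symmetric] by (simp flip: lessThan_Suc_atMost)
  moreover have "(\<lambda>N. \<Sum>i<n. c i * fall N i) \<in> O(\<lambda>N. real N ^ (n - 1))"
    by (rule sum_fall_bigo) auto
  ultimately show "(\<lambda>N. moment 1 (2 * n) N - fact (2 * n) / (8 ^ n * fact n) * fall N n) \<in> O(\<lambda>N. real N ^ (n - 1))"
    by simp
  show "(\<lambda>N. moment 1 (2 * n) N) \<in> O(\<lambda>N. real N ^ d)" if "n \<le> d"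
    using sum_fall_bigo[of "{..n}" d c] that by (simp add: E)
qed

text \<open>\<beta> N + \<delta> is the quotient of consecutive moments to second order. The
  coefficients of \<open>fall N (Suc m)\<close> agree at once. At \<open>fall N m\<close>, as (m + 1
  choose 2) - (m choose 2) = m, the condition is m \<beta>^(m - 1)/4 = m \<beta>^(m + 1) + \<delta>
  \<beta>^m, which determines \<delta>.\<close>

lemma moment_ratio_asymp:
  assumes w: "0 < w" "w < 1" and m: "m \<ge> 1"
  defines "\<beta> \<equiv> (1 - w) / (2 * (1 + w))"
  defines "\<delta> \<equiv> real m * (1 / 4 - \<beta>\<^sup>2) / \<beta>"
  shows "(\<lambda>N. moment w (Suc m) N - (\<beta> * real N + \<delta>) * moment w m N) \<in> O(\<lambda>N. real N ^ (m - 1))"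
proof -
  have \<beta>: "\<beta> > 0" using w by (simp add: \<beta>_def)
  obtain k where k: "m = Suc k" using m by (cases m) auto
  obtain c d where "moment_coeffs w (Suc m) c" "moment_coeffs w m d"
    using moment_coeffs_exist[OF w(1)] by metis
  hence c: "moment w (Suc m) N = (\<Sum>i\<le>Suc m. c i * fall N i)" "c (Suc m) = \<beta> ^ Suc m"
      "c m = real (Suc m choose 2) * \<beta> ^ (m - 1) / 4"
    and d: "moment w m N = (\<Sum>i\<le>m. d i * fall N i)" "d m = \<beta> ^ m" "d k = real (m choose 2) * \<beta> ^ (m - 2) / 4" for N
    using k by (simp_all add: moment_coeffs_def Let_def \<beta>_def)
  have "(\<beta> * real N + \<delta>) * moment w m N = \<beta> * \<beta> ^ m * fall N (Suc m)
      + (\<beta> * \<beta> ^ m * real m + \<beta> * d k + \<delta> * \<beta> ^ m) * fall N m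
      + ((\<beta> * d k * real k + \<delta> * d k) * fall N k + (\<Sum>i<k. \<beta> * d i * (fall N (Suc i) + real i * fall N i))
      + (\<Sum>i<k. \<delta> * d i * fall N i))" for N
  proof -
    have M: "moment w m N = (\<Sum>i<k. d i * fall N i) + d k * fall N k + \<beta> ^ m * fall N m"
      unfolding d(1) d(2)[symmetric] by (simp add: k flip: lessThan_Suc_atMost)
    have h1: "real N * (\<Sum>i<k. d i * fall N i) = (\<Sum>i<k. d i * (fall N (Suc i) + real i * fall N i))"
      unfolding sum_distrib_left times_fall[symmetric] by (simp add: mult_ac)
    have h2: "real N * fall N k = fall N m + real k * fall N k" and h3: "real N * fall N m = fall N (Suc m) + real m * fall N m"
      unfolding times_fall k by simp_all
    have alg: "(\<beta> * n + \<delta>) * (S + D * f + B * g) = \<beta> * B * g' + (\<beta> * B * real m + \<beta> * D + \<delta> * B) * g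
        + ((\<beta> * D * real k + \<delta> * D) * f + \<beta> * S' + \<delta> * S)"
      if "n * S = S'" "n * f = g + real k * f" "n * g = g' + real m * g" for n S D f B g S' g' :: real
    proof -
      have "(\<beta> * n + \<delta>) * (S + D * f + B * g) = \<beta> * (n * S) + \<beta> * D * (n * f) + \<beta> * B * (n * g)
          + \<delta> * S + \<delta> * D * f + \<delta> * B * g" by (simp add: algebra_simps)
      thus ?thesis unfolding that by (simp add: algebra_simps)
    qed
    have sd: "(\<Sum>i<k. \<beta> * d i * (fall N (Suc i) + real i * fall N i)) = \<beta> * (\<Sum>i<k. d i * (fall N (Suc i) + real i * fall N i))"
      "(\<Sum>i<k. \<delta> * d i * fall N i) = \<delta> * (\<Sum>i<k. d i * fall N i)"
      by (simp_all only: sum_distrib_left mult.assoc)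
    show ?thesis unfolding M sd by (rule alg[OF h1 h2 h3])
  qed
  moreover have "moment w (Suc m) N = \<beta> * \<beta> ^ m * fall N (Suc m) + c m * fall N m + (\<Sum>i\<le>k. c i * fall N i)" for N
    unfolding c(1) using c(2) by (simp add: k)
  moreover have "\<beta> * \<beta> ^ m * real m + \<beta> * d k + \<delta> * \<beta> ^ m = c m"
  proof -
    have 1: "\<beta> * d k = real (m choose 2) * \<beta> ^ k / 4"
      using d(3) k by (cases k) (simp_all add: numeral_2_eq_2)
    have 2: "\<delta> * \<beta> ^ m = real m * (1 / 4 - \<beta>\<^sup>2) * \<beta> ^ k" using \<beta> by (simp add: \<delta>_def k)
    have 3: "real (Suc m choose 2) = real (m choose 2) + real m" by (simp add: numeral_2_eq_2)
    show ?thesis unfolding 1 2 c(3) 3 by (simp add: k field_simps power2_eq_square)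
  qed
  ultimately have "moment w (Suc m) N - (\<beta> * real N + \<delta>) * moment w m N =
      (\<Sum>i\<le>k. c i * fall N i) - ((\<beta> * d k * real k + \<delta> * d k) * fall N k + (\<Sum>i<k. \<beta> * d i * (fall N (Suc i) + real i * fall N i))
      + (\<Sum>i<k. \<delta> * d i * fall N i))" for N by simp
  moreover have "(\<lambda>N. (\<Sum>i\<le>k. c i * fall N i) - ((\<beta> * d k * real k + \<delta> * d k) * fall N k
      + (\<Sum>i<k. \<beta> * d i * (fall N (Suc i) + real i * fall N i)) + (\<Sum>i<k. \<delta> * d i * fall N i))) \<in> O(\<lambda>N. real N ^ k)"
    by (intro sum_in_bigo sum_fall_bigo big_sum_in_bigo bigo_cmult fall_bigo) auto
  ultimately show ?thesis by (simp add: k)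
qed

lemma moment_leading:
  assumes w: "0 < w"
  shows "(\<lambda>N. moment w m N - ((1 - w) / (2 * (1 + w))) ^ m * fall N m) \<in> O(\<lambda>N. real N ^ (m - 1))"
proof -
  obtain c where "moment_coeffs w m c" using moment_coeffs_exist[OF w] by blast
  hence "moment w m N - ((1 - w) / (2 * (1 + w))) ^ m * fall N m = (\<Sum>i<m. c i * fall N i)" for N
    by (simp add: moment_coeffs_def Let_def flip: lessThan_Suc_atMost)
  moreover have "(\<lambda>N. \<Sum>i<m. c i * fall N i) \<in> O(\<lambda>N. real N ^ (m - 1))"
    by (rule sum_fall_bigo) auto
  ultimately show ?thesis by simp
qed

text \<open>The height polynomial is even in the centred variable \<open>z = k + a/2\<close>; this polynomial expresses it in \<open>z\<^sup>2\<close>.\<close>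

definition even_height_poly :: "nat \<Rightarrow> nat \<Rightarrow> real poly" where
  "even_height_poly n y = (\<Prod>r\<in>{1..<n}. [:- (real (y + 2 * n - 1) / 2 - real r)\<^sup>2, 1:])"

lemma poly_even_height_poly:
  "poly (even_height_poly n y) ((k + real (y + 2 * n - 1) / 2)\<^sup>2) = height_poly n y k"
  unfolding even_height_poly_def height_poly_def poly_prod
  by (intro prod.cong refl) (simp add: power2_eq_square algebra_simps)

lemma degree_even_height_poly: "degree (even_height_poly n y) = n - 1"
  and coeff_even_height_poly: "coeff (even_height_poly n y) (n - 1) = 1"
proof -
  show d: "degree (even_height_poly n y) = n - 1"
    unfolding even_height_poly_def by (subst degree_prod_eq_sum_degree) auto
  have "lead_coeff (even_height_poly n y) = 1"
    unfolding even_height_poly_def by (simp add: lead_coeff_prod)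
  thus "coeff (even_height_poly n y) (n - 1) = 1" by (simp add: d)
qed

text \<open>The average of z p(z^2), and in \<open>even_mean\<close> of z^2 p(z^2), over a whole
  weighted binomial row, with z = N/2 - j and p the even height polynomial. They model
  \<open>mode_sum\<close> and its first moment in z after completion of the row.\<close>

definition odd_mean :: "real \<Rightarrow> nat \<Rightarrow> nat \<Rightarrow> nat \<Rightarrow> real" where
  "odd_mean w n y N = (\<Sum>i\<le>n - 1. coeff (even_height_poly n y) i * moment w (2 * i + 1) N)"

definition even_mean :: "real \<Rightarrow> nat \<Rightarrow> nat \<Rightarrow> nat \<Rightarrow> real" where
  "even_mean w n y N = (\<Sum>i\<le>n - 1. coeff (even_height_poly n y) i * moment w (2 * i + 2) N)"

lemma sum_poly_moment:
  "(\<Sum>j\<le>N. real (N choose j) * w ^ j * ((real N / 2 - real j) ^ e * poly (even_height_poly n y) ((real N / 2 - real j)\<^sup>2))) / (1 + w) ^ N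
    = (\<Sum>i\<le>n - 1. coeff (even_height_poly n y) i * moment w (2 * i + e) N)"
proof -
  have "real (N choose j) * w ^ j * ((real N / 2 - real j) ^ e * poly (even_height_poly n y) ((real N / 2 - real j)\<^sup>2))
      = (\<Sum>i\<le>n - 1. coeff (even_height_poly n y) i * (real (N choose j) * w ^ j * (real N / 2 - real j) ^ (2 * i + e)))" for j
    unfolding poly_altdef degree_even_height_poly sum_distrib_left
    by (intro sum.cong refl) (simp add: power_add power_mult)
  thus ?thesis
    unfolding moment_def by (simp add: sum_divide_distrib sum_distrib_left) (rule sum.swap)
qed

lemma odd_mean_eq:
  "(\<Sum>j\<le>N. real (N choose j) * w ^ j * ((real N / 2 - real j) * poly (even_height_poly n y) ((real N / 2 - real j)\<^sup>2)))
    = (1 + w) ^ N * odd_mean w n y N" if "w > 0"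
  using sum_poly_moment[of N w 1 n y] that by (simp add: odd_mean_def field_simps)

lemma even_mean_eq:
  "(\<Sum>j\<le>N. real (N choose j) * w ^ j * ((real N / 2 - real j)\<^sup>2 * poly (even_height_poly n y) ((real N / 2 - real j)\<^sup>2)))
    = (1 + w) ^ N * even_mean w n y N" if "w > 0"
  using sum_poly_moment[of N w 2 n y] that by (simp add: even_mean_def field_simps)

text \<open>Only the top power i = n - 1 needs the precise ratio, hence \<delta> is the one for m =
  2n - 1. For smaller i each moment is of order at most N^(2n - 2) by itself, even after
  multiplication by N.\<close>

lemma even_odd_mean_asymp:
  assumes w: "0 < w" "w < 1" and n: "n \<ge> 1"
  defines "\<beta> \<equiv> (1 - w) / (2 * (1 + w))"
  defines "\<delta> \<equiv> real (2 * n - 1) * (1 / 4 - \<beta>\<^sup>2) / \<beta>"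
  shows "(\<lambda>N. even_mean w n y N - (\<beta> * real N + \<delta>) * odd_mean w n y N) \<in> O(\<lambda>N. real N ^ (2 * n - 2))"
proof -
  let ?c = "coeff (even_height_poly n y)"
  have "even_mean w n y N - (\<beta> * real N + \<delta>) * odd_mean w n y N =
      (\<Sum>i\<le>n - 1. ?c i * (moment w (Suc (2 * i + 1)) N - (\<beta> * real N + \<delta>) * moment w (2 * i + 1) N))" for N
    unfolding even_mean_def odd_mean_def sum_distrib_left sum_subtractf[symmetric]
    by (intro sum.cong refl) (simp add: algebra_simps)
  moreover have "(\<lambda>N. moment w (Suc (2 * i + 1)) N - (\<beta> * real N + \<delta>) * moment w (2 * i + 1) N) \<in> O(\<lambda>N. real N ^ (2 * n - 2))"
    if i: "i \<le> n - 1" for i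
  proof (cases "i = n - 1")
    case True
    hence "2 * i + 1 = 2 * n - 1" "2 * n - 1 - 1 = 2 * n - 2" using n by auto
    thus ?thesis using moment_ratio_asymp[OF w, of "2 * n - 1"] n by (simp add: \<beta>_def \<delta>_def)
  next
    case False
    hence i2: "2 * i + 2 \<le> 2 * n - 2" using i n by auto
    have "(\<lambda>N. real N * moment w (2 * i + 1) N) \<in> O(\<lambda>N. real N * real N ^ (2 * i + 1))"
      by (intro landau_o.big.mult_left moment_bigo w) simp
    also have "(\<lambda>N. real N * real N ^ (2 * i + 1)) = (\<lambda>N. real N ^ (2 * i + 2))" by simp
    also have "(\<lambda>N. real N ^ (2 * i + 2)) \<in> O(\<lambda>N. real N ^ (2 * n - 2))" by (rule power_bigo_mono[OF i2])
    finally have 1: "(\<lambda>N. \<beta> * (real N * moment w (2 * i + 1) N)) \<in> O(\<lambda>N. real N ^ (2 * n - 2))" by (rule bigo_cmult)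
    have "(\<lambda>N. moment w (Suc (2 * i + 1)) N - (\<beta> * (real N * moment w (2 * i + 1) N) + \<delta> * moment w (2 * i + 1) N))
        \<in> O(\<lambda>N. real N ^ (2 * n - 2))"
      by (intro sum_in_bigo 1 bigo_cmult moment_bigo w) (use i2 in auto)
    thus ?thesis by (simp add: algebra_simps)
  qed
  ultimately show ?thesis by (simp only:) (intro big_sum_in_bigo bigo_cmult, simp)
qed

lemma odd_mean_leading:
  assumes w: "0 < w" and n: "n \<ge> 1"
  shows "(\<lambda>N. odd_mean w n y N - ((1 - w) / (2 * (1 + w))) ^ (2 * n - 1) * fall N (2 * n - 1)) \<in> O(\<lambda>N. real N ^ (2 * n - 2))"
proof -
  let ?c = "coeff (even_height_poly n y)"
  obtain m where m: "n = Suc m" using n by (cases n) auto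
  have e: "2 * n - 1 - 1 = 2 * n - 2" by simp
  have "odd_mean w n y N - ((1 - w) / (2 * (1 + w))) ^ (2 * n - 1) * fall N (2 * n - 1) =
      (\<Sum>i<m. ?c i * moment w (2 * i + 1) N) + (moment w (2 * n - 1) N - ((1 - w) / (2 * (1 + w))) ^ (2 * n - 1) * fall N (2 * n - 1))" for N
    using coeff_even_height_poly[of n y] by (simp add: odd_mean_def m flip: lessThan_Suc_atMost)
  moreover have "(\<lambda>N. \<Sum>i<m. ?c i * moment w (2 * i + 1) N) \<in> O(\<lambda>N. real N ^ (2 * n - 2))"
    by (intro big_sum_in_bigo bigo_cmult moment_bigo w) (auto simp: m)
  note sum_in_bigo(1)[OF this moment_leading[OF w, of "2 * n - 1", unfolded e]]
  ultimately show ?thesis by (simp only:)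
qed

text \<open>At w = 1 the moment of order 2i + 2 has degree i + 1 only, so just i = n - 1 contributes
  to \<open>fall N n\<close>.\<close>

lemma even_mean_symmetric:
  assumes n: "n \<ge> 1"
  shows "(\<lambda>N. even_mean 1 n y N - fact (2 * n) / (8 ^ n * fact n) * fall N n) \<in> O(\<lambda>N. real N ^ (n - 1))"
proof -
  let ?c = "coeff (even_height_poly n y)"
  obtain m where m: "n = Suc m" using n by (cases n) auto
  have "even_mean 1 n y N - fact (2 * n) / (8 ^ n * fact n) * fall N n =
      (\<Sum>i<m. ?c i * moment 1 (2 * (i + 1)) N) + (moment 1 (2 * n) N - fact (2 * n) / (8 ^ n * fact n) * fall N n)" for N
    using coeff_even_height_poly[of n y] by (simp add: even_mean_def m del: fact_Suc flip: lessThan_Suc_atMost)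
  moreover have "(\<lambda>N. \<Sum>i<m. ?c i * moment 1 (2 * (i + 1)) N) \<in> O(\<lambda>N. real N ^ (n - 1))"
    by (intro big_sum_in_bigo bigo_cmult moment_symmetric_bigo) (auto simp: m)
  note sum_in_bigo(1)[OF this moment_symmetric_asymp]
  ultimately show ?thesis by (simp only:)
qed

text \<open>Under k = M - j the centred variable k + a/2 becomes N/2 - j, and 2k + a becomes 2z; so
  the sum over k is one over the lower part of a binomial row.\<close>

lemma mode_weight_height:
  fixes n y M j :: nat
  assumes "j \<le> M"
  defines "N \<equiv> 2 * M + (y + 2 * n - 1)"
  defines "z \<equiv> real N / 2 - real j"
  shows "mode_weight n y M (M - j) = 2 * (real (N choose j) * (z * poly (even_height_poly n y) (z\<^sup>2)))"
    and "real (M - j) = z - real (y + 2 * n - 1) / 2"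
proof -
  show k: "real (M - j) = z - real (y + 2 * n - 1) / 2"
    using assms(1) unfolding z_def N_def by (simp only: of_nat_add of_nat_mult of_nat_numeral of_nat_diff) (simp add: field_simps)
  hence "poly (even_height_poly n y) (z\<^sup>2) = height_poly n y (real (M - j))"
    using poly_even_height_poly[of n y "real (M - j)"] by simp
  moreover have "real (2 * (M - j) + (y + 2 * n - 1)) = 2 * z" using k by simp
  moreover have "M - (M - j) = j" using assms(1) by simp
  ultimately show "mode_weight n y M (M - j) = 2 * (real (N choose j) * (z * poly (even_height_poly n y) (z\<^sup>2)))"
    unfolding mode_weight_def N_def by simp
qed

subsection \<open>The supercritical regime\<close>

lemma poly_abs_bound:
  fixes p :: "real poly"
  obtains K where "K \<ge> 0" "\<And>z. \<bar>poly p z\<bar> \<le> K * (1 + \<bar>z\<bar>) ^ degree p"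
proof
  show "(\<Sum>i\<le>degree p. \<bar>coeff p i\<bar>) \<ge> 0" by (intro sum_nonneg) auto
  fix z :: real
  have "\<bar>poly p z\<bar> \<le> (\<Sum>i\<le>degree p. \<bar>coeff p i * z ^ i\<bar>)"
    unfolding poly_altdef by (rule sum_abs)
  also have "\<dots> \<le> (\<Sum>i\<le>degree p. \<bar>coeff p i\<bar> * (1 + \<bar>z\<bar>) ^ degree p)"
  proof (rule sum_mono)
    fix i assume "i \<in> {..degree p}"
    have "\<bar>z\<bar> ^ i \<le> (1 + \<bar>z\<bar>) ^ i" by (intro power_mono) auto
    also have "\<dots> \<le> (1 + \<bar>z\<bar>) ^ degree p" using \<open>i \<in> {..degree p}\<close> by (intro power_increasing) auto
    finally show "\<bar>coeff p i * z ^ i\<bar> \<le> \<bar>coeff p i\<bar> * (1 + \<bar>z\<bar>) ^ degree p"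
      by (simp add: abs_mult power_abs mult_left_mono)
  qed
  finally show "\<bar>poly p z\<bar> \<le> (\<Sum>i\<le>degree p. \<bar>coeff p i\<bar>) * (1 + \<bar>z\<bar>) ^ degree p"
    by (simp add: sum_distrib_right)
qed

text \<open>For j > M one has w^j \<le> w^M, and the binomials sum to at most 2^N. Relative to (1 +
  w)^N the tail is thus at most a power of M times \<rho>^M, where \<rho> = 4w/(1 + w)^2 < 1 as w <
  1. The factor N is included because the tail will be multiplied by \<beta> N + \<delta>.\<close>

lemma binomial_tail_bigo:
  fixes p :: "real poly" and a :: nat
  assumes w: "0 < w" "w < 1"
  defines "\<tau> \<equiv> \<lambda>M. (\<Sum>j\<in>{M<..2 * M + a}. real ((2 * M + a) choose j) * w ^ j * poly p (real (2 * M + a) / 2 - real j))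
    / (1 + w) ^ (2 * M + a)"
  shows "(\<lambda>M. real (2 * M + a) * \<tau> M) \<in> O(\<lambda>_. 1)"
proof -
  obtain K where K: "K \<ge> 0" "\<And>z. \<bar>poly p z\<bar> \<le> K * (1 + \<bar>z\<bar>) ^ degree p" using poly_abs_bound[of p] by blast
  define d where "d = degree p"
  define \<rho> where "\<rho> = 4 * w / (1 + w)\<^sup>2"
  have "0 < (1 - w)\<^sup>2" using w by simp
  hence "4 * w < (1 + w)\<^sup>2" by (simp add: power2_eq_square algebra_simps)
  hence \<rho>: "0 \<le> \<rho>" "\<rho> < 1" using w by (auto simp: \<rho>_def)
  define L where "L = K * (2 / (1 + w)) ^ a * real (a + 2) ^ Suc d"
  have bound: "\<bar>real (2 * M + a) * \<tau> M\<bar> \<le> L * (real (M + 1) ^ Suc d * \<bar>\<rho>\<bar> ^ M)" for M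
  proof -
    define N where "N = 2 * M + a"
    have "\<bar>\<Sum>j\<in>{M<..N}. real (N choose j) * w ^ j * poly p (real N / 2 - real j)\<bar>
        \<le> (\<Sum>j\<in>{M<..N}. real (N choose j) * (w ^ M * (K * (1 + real N) ^ d)))"
    proof (rule order_trans[OF sum_abs sum_mono])
      fix j assume j: "j \<in> {M<..N}"
      have "\<bar>poly p (real N / 2 - real j)\<bar> \<le> K * (1 + \<bar>real N / 2 - real j\<bar>) ^ d"
        using K(2) by (simp add: d_def)
      also have "\<dots> \<le> K * (1 + real N) ^ d"
        using j K(1) by (intro mult_left_mono power_mono) auto
      finally have 1: "\<bar>poly p (real N / 2 - real j)\<bar> \<le> K * (1 + real N) ^ d" .
      have "w ^ j \<le> w ^ M" using w j by (intro power_decreasing) auto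
      hence "w ^ j * \<bar>poly p (real N / 2 - real j)\<bar> \<le> w ^ M * (K * (1 + real N) ^ d)"
        using w 1 by (intro mult_mono) auto
      hence "real (N choose j) * (w ^ j * \<bar>poly p (real N / 2 - real j)\<bar>) \<le> real (N choose j) * (w ^ M * (K * (1 + real N) ^ d))"
        by (rule mult_left_mono) simp
      thus "\<bar>real (N choose j) * w ^ j * poly p (real N / 2 - real j)\<bar> \<le> real (N choose j) * (w ^ M * (K * (1 + real N) ^ d))"
        using w by (simp add: abs_mult mult.assoc)
    qed
    also have "\<dots> \<le> (\<Sum>j\<le>N. real (N choose j) * (w ^ M * (K * (1 + real N) ^ d)))"
      using w K(1) by (intro sum_mono2) auto
    also have "\<dots> = 2 ^ N * (w ^ M * (K * (1 + real N) ^ d))"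
    proof -
      have "(\<Sum>j\<le>N. real (N choose j)) = 2 ^ N" using choose_row_sum[of N] by (metis of_nat_numeral of_nat_power of_nat_sum)
      thus ?thesis by (simp add: sum_distrib_right[symmetric])
    qed
    finally have "\<bar>\<tau> M\<bar> \<le> 2 ^ N * (w ^ M * (K * (1 + real N) ^ d)) / (1 + w) ^ N"
      using w by (simp add: \<tau>_def N_def divide_right_mono)
    hence "\<bar>real N * \<tau> M\<bar> \<le> (1 + real N) * (2 ^ N * (w ^ M * (K * (1 + real N) ^ d)) / (1 + w) ^ N)"
      unfolding abs_mult by (intro mult_mono) auto
    also have "\<dots> = K * (2 / (1 + w)) ^ N * w ^ M * (1 + real N) ^ Suc d"
      by (simp add: power_divide)
    also have "\<dots> \<le> K * (2 / (1 + w)) ^ N * w ^ M * (real (a + 2) * real (M + 1)) ^ Suc d"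
    proof -
      have "1 + real N \<le> real (a + 2) * real (M + 1)" using of_nat_0_le_iff[of "a * M"] by (simp add: N_def algebra_simps)
      thus ?thesis using w K(1) by (intro mult_left_mono power_mono) auto
    qed
    also have "(2 / (1 + w)) ^ N * w ^ M = (2 / (1 + w)) ^ a * \<rho> ^ M"
    proof -
      have "(2 / (1 + w)) ^ N = ((2 / (1 + w))\<^sup>2) ^ M * (2 / (1 + w)) ^ a"
        by (simp add: N_def power_add power_mult)
      moreover have "(2 / (1 + w))\<^sup>2 * w = \<rho>" by (simp add: \<rho>_def power_divide)
      hence "((2 / (1 + w))\<^sup>2) ^ M * w ^ M = \<rho> ^ M" by (simp flip: power_mult_distrib)
      ultimately show ?thesis by (simp add: mult_ac)
    qed
    hence "K * (2 / (1 + w)) ^ N * w ^ M * (real (a + 2) * real (M + 1)) ^ Suc d = L * (real (M + 1) ^ Suc d * \<bar>\<rho>\<bar> ^ M)"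
      using \<rho>(1) unfolding L_def power_mult_distrib by (simp only: abs_of_nonneg mult_ac)
    finally show ?thesis by (simp only: N_def)
  qed
  have "(\<lambda>M. real (M + 1) ^ Suc d * \<bar>\<rho>\<bar> ^ M) \<longlonglongrightarrow> 0"
    by (intro summable_LIMSEQ_zero summable_polynomial_geometric) (use \<rho> in auto)
  hence "(\<lambda>M. real (M + 1) ^ Suc d * \<bar>\<rho>\<bar> ^ M) \<in> O(\<lambda>_. 1)"
    by (intro bigoI_tendsto[of _ _ 0]) auto
  hence "(\<lambda>M. L * (real (M + 1) ^ Suc d * \<bar>\<rho>\<bar> ^ M)) \<in> O(\<lambda>_. 1)" by (rule bigo_cmult)
  moreover have "(\<lambda>M. real (2 * M + a) * \<tau> M) \<in> O(\<lambda>M. L * (real (M + 1) ^ Suc d * \<bar>\<rho>\<bar> ^ M))"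
    using order_trans[OF bound abs_ge_self] by (intro bigoI[of _ 1] always_eventually allI) simp
  ultimately show ?thesis by (rule landau_o.big_trans[rotated])
qed

lemma sum_atMost_rev:
  fixes f :: "nat \<Rightarrow> real"
  shows "(\<Sum>k\<le>M. f k) = (\<Sum>j\<le>M. f (M - j))"
  by (rule sum.reindex_bij_witness[of _ "\<lambda>j. M - j" "\<lambda>k. M - k"]) auto

lemma bigo_compose_linear:
  fixes f g :: "nat \<Rightarrow> real"
  assumes "f \<in> O(g)"
  shows "(\<lambda>M. f (2 * M + a)) \<in> O(\<lambda>M. g (2 * M + a))"
proof -
  have "filterlim (\<lambda>M::nat. 2 * M + a) at_top at_top"
    by (rule filterlim_at_top_mono[OF filterlim_ident]) auto
  thus ?thesis using landau_o.big.compose[OF assms] by blast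
qed

text \<open>With j = M - k and w = 1/x the weight x^k is x^M w^j, and the binomial weights
  concentrate near j = N w/(1 + w), well below M. The mean is 1 + (\<kappa>/x)(A/B - a/2), where A/B
  = \<beta> N + \<delta> + O(1/N) with N = 2M + a.\<close>

lemma mean_contacts_strong:
  fixes \<kappa> :: real
  assumes n: "n \<ge> 1" and \<kappa>: "\<kappa> > 2"
  shows "(\<lambda>M. mean_contacts n (2 * M + y) y \<kappa> -
    ((\<kappa> - 2) / (\<kappa> - 1) * (real (2 * M + y) / 2)
      + \<kappa> * ((2 - \<kappa>) * real y + 4 * real n - 2) / (2 * (\<kappa> - 1) * (\<kappa> - 2)) + 1)) \<in> O(\<lambda>M. 1 / real (2 * M + (y + 2 * n - 1)))"
proof -
  define x where "x = \<kappa> - 1"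
  define w where "w = 1 / x"
  define a where "a = y + 2 * n - 1"
  define \<beta> where "\<beta> = (1 - w) / (2 * (1 + w))"
  define \<delta> where "\<delta> = real (2 * n - 1) * (1 / 4 - \<beta>\<^sup>2) / \<beta>"
  have x: "x > 1" using \<kappa> by (simp add: x_def)
  hence w: "0 < w" "w < 1" by (auto simp: w_def)
  have \<beta>k: "\<beta> = (\<kappa> - 2) / (2 * \<kappa>)"
    using \<kappa> by (simp add: \<beta>_def w_def x_def field_simps)
  hence \<beta>: "\<beta> > 0" using \<kappa> by simp
  \<comment> \<open>Substituting z^2 gives a polynomial in z itself, as the tail estimate
    requires.\<close>
  define q where "q = pcompose (even_height_poly n y) [:0, 0, 1:]"
  have q: "poly q z = poly (even_height_poly n y) (z\<^sup>2)" for z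
    by (simp add: q_def poly_pcompose power2_eq_square)
  define tail where "tail = (\<lambda>p M. (\<Sum>j\<in>{M<..2 * M + a}. real ((2 * M + a) choose j) * w ^ j * poly p (real (2 * M + a) / 2 - real j))
    / (1 + w) ^ (2 * M + a))"
  define tB where "tB = tail ([:0, 1:] * q)"
  define tA where "tA = tail ([:0, 0, 1:] * q)"
  define B where "B = (\<lambda>M. odd_mean w n y (2 * M + a) - tB M)"
  define A where "A = (\<lambda>M. even_mean w n y (2 * M + a) - tA M)"
  have sumB: "(\<Sum>j\<le>M. real ((2 * M + a) choose j) * w ^ j * (z j * poly (even_height_poly n y) ((z j)\<^sup>2)))
      = (1 + w) ^ (2 * M + a) * B M" (is ?SB)
    and sumA: "(\<Sum>j\<le>M. real ((2 * M + a) choose j) * w ^ j * ((z j)\<^sup>2 * poly (even_height_poly n y) ((z j)\<^sup>2)))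
      = (1 + w) ^ (2 * M + a) * A M" (is ?SA)
    if z: "z = (\<lambda>j. real (2 * M + a) / 2 - real j)" for M z
  proof -
    have split: "(\<Sum>j\<le>M. f j) = (\<Sum>j\<le>2 * M + a. f j) - (\<Sum>j\<in>{M<..2 * M + a}. f j)" for f :: "nat \<Rightarrow> real"
    proof -
      have "{..2 * M + a} = {..M} \<union> {M<..2 * M + a}" by auto
      hence "(\<Sum>j\<le>2 * M + a. f j) = (\<Sum>j\<le>M. f j) + (\<Sum>j\<in>{M<..2 * M + a}. f j)"
        by (simp only:) (rule sum.union_disjoint, auto)
      thus ?thesis by simp
    qed
    have "(1 + w) ^ (2 * M + a) \<noteq> 0" using w by simp
    thus ?SB ?SA
      unfolding split B_def A_def tB_def tA_def tail_def z odd_mean_eq[OF w(1)] even_mean_eq[OF w(1)] poly_mult q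
      by (simp_all add: right_diff_distrib power2_eq_square)
  qed
  have mean: "mean_contacts n (2 * M + y) y \<kappa> = 1 + \<kappa> / x * (A M / B M - real a / 2)" and B0: "B M \<noteq> 0" for M
  proof -
    define z where "z = (\<lambda>j. real (2 * M + a) / 2 - real j)"
    have xw: "x ^ (M - j) = x ^ M * w ^ j" if "j \<le> M" for j
      using that x by (simp add: w_def power_diff power_divide)
    have mw: "mode_weight n y M (M - j) = 2 * (real ((2 * M + a) choose j) * (z j * poly (even_height_poly n y) ((z j)\<^sup>2)))"
      "real (M - j) = z j - real a / 2" if "j \<le> M" for j
      using mode_weight_height(1)[OF that, where n = n and y = y] mode_weight_height(2)[OF that, where n = n and y = y]
      by (simp_all only: a_def z_def)
    have S: "mode_sum n y M x = 2 * x ^ M * (1 + w) ^ (2 * M + a) * B M"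
    proof -
      have "mode_sum n y M x = (\<Sum>j\<le>M. x ^ (M - j) * mode_weight n y M (M - j))"
        unfolding mode_sum_def by (rule sum_atMost_rev)
      also have "\<dots> = (\<Sum>j\<le>M. 2 * x ^ M * (real ((2 * M + a) choose j) * w ^ j * (z j * poly (even_height_poly n y) ((z j)\<^sup>2))))"
        by (intro sum.cong refl) (simp add: xw mw(1))
      finally show ?thesis unfolding sum_distrib_left[symmetric] sumB[OF z_def] by simp
    qed
    have "x * (\<Sum>k\<le>M. real k * x ^ (k - 1) * mode_weight n y M k) = (\<Sum>k\<le>M. real k * x ^ k * mode_weight n y M k)"
      unfolding sum_distrib_left
    proof (rule sum.cong[OF refl])
      fix k show "x * (real k * x ^ (k - 1) * mode_weight n y M k) = real k * x ^ k * mode_weight n y M k"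
        by (cases k) simp_all
    qed
    also have "\<dots> = (\<Sum>j\<le>M. real (M - j) * x ^ (M - j) * mode_weight n y M (M - j))"
      by (rule sum_atMost_rev)
    also have "\<dots> = (\<Sum>j\<le>M. 2 * x ^ M * (real ((2 * M + a) choose j) * w ^ j * ((z j)\<^sup>2 * poly (even_height_poly n y) ((z j)\<^sup>2)))
        - real a / 2 * (2 * x ^ M * (real ((2 * M + a) choose j) * w ^ j * (z j * poly (even_height_poly n y) ((z j)\<^sup>2)))))"
    proof (rule sum.cong[OF refl])
      fix j assume "j \<in> {..M}"
      hence j: "j \<le> M" by simp
      show "real (M - j) * x ^ (M - j) * mode_weight n y M (M - j) =
        2 * x ^ M * (real ((2 * M + a) choose j) * w ^ j * ((z j)\<^sup>2 * poly (even_height_poly n y) ((z j)\<^sup>2)))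
        - real a / 2 * (2 * x ^ M * (real ((2 * M + a) choose j) * w ^ j * (z j * poly (even_height_poly n y) ((z j)\<^sup>2))))"
        unfolding mw[OF j] xw[OF j]
        by (simp only: left_diff_distrib right_diff_distrib power2_eq_square mult_ac)
    qed
    also have "\<dots> = 2 * x ^ M * (1 + w) ^ (2 * M + a) * (A M - real a / 2 * B M)"
      unfolding sum_subtractf sum_distrib_left[symmetric] sumA[OF z_def] sumB[OF z_def]
      by (simp only: right_diff_distrib mult_ac)
    finally have S': "x * (\<Sum>k\<le>M. real k * x ^ (k - 1) * mode_weight n y M k)
        = 2 * x ^ M * (1 + w) ^ (2 * M + a) * (A M - real a / 2 * B M)" .
    have "mode_sum n y M x \<noteq> 0" using mean_contacts_eq(1)[OF n, of \<kappa> y M] \<kappa> by (simp add: x_def)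
    thus B0: "B M \<noteq> 0" unfolding S by simp
    have "2 * x ^ M * (1 + w) ^ (2 * M + a) \<noteq> 0" using x w by simp
    hence "(x * (\<Sum>k\<le>M. real k * x ^ (k - 1) * mode_weight n y M k)) / mode_sum n y M x = (A M - real a / 2 * B M) / B M"
      unfolding S' S by (rule mult_divide_mult_cancel_left)
    also have "\<dots> = A M / B M - real a / 2" using B0 by (simp add: diff_divide_distrib)
    finally have E: "(\<Sum>k\<le>M. real k * x ^ (k - 1) * mode_weight n y M k) / mode_sum n y M x = (A M / B M - real a / 2) / x"
      using x by (simp add: field_simps)
    have "mean_contacts n (2 * M + y) y \<kappa> = 1 + \<kappa> *
        ((\<Sum>k\<le>M. real k * x ^ (k - 1) * mode_weight n y M k) / mode_sum n y M x)"
      using mean_contacts_eq(2)[OF n, of \<kappa> M y] \<kappa> by (simp add: x_def[symmetric])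
    thus "mean_contacts n (2 * M + y) y \<kappa> = 1 + \<kappa> / x * (A M / B M - real a / 2)"
      unfolding E by simp
  qed
  have one: "(\<lambda>_. 1) \<in> O(\<lambda>M. real (2 * M + a) ^ d)" for d
    using bigo_compose_linear[OF power_bigo_mono[of 0 d], of a] by simp
  have tail_bigo: "(\<lambda>M. real (2 * M + a) * tail p M) \<in> O(\<lambda>M. real (2 * M + a) ^ d)" for p d
    using binomial_tail_bigo[OF w, of a p] one[of d] unfolding tail_def by (rule landau_o.big_trans)
  have tail_bigo': "tail p \<in> O(\<lambda>M. real (2 * M + a) ^ d)" for p d
  proof (rule landau_o.big_trans[OF _ tail_bigo])
    show "tail p \<in> O(\<lambda>M. real (2 * M + a) * tail p M)"
    proof (rule bigoI[of _ 1])
      show "\<forall>\<^sub>F M in sequentially. norm (tail p M) \<le> 1 * norm (real (2 * M + a) * tail p M)"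
        using eventually_ge_at_top[of 1]
      proof eventually_elim
        case (elim M)
        hence "1 * \<bar>tail p M\<bar> \<le> real (2 * M + a) * \<bar>tail p M\<bar>" by (intro mult_right_mono) auto
        thus ?case by (simp add: abs_mult)
      qed
    qed
  qed
  have num: "(\<lambda>M. A M - (\<beta> * real (2 * M + a) + \<delta>) * B M) \<in> O(\<lambda>M. real (2 * M + a) ^ (2 * n - 2))"
  proof -
    have "(\<lambda>M. (even_mean w n y (2 * M + a) - (\<beta> * real (2 * M + a) + \<delta>) * odd_mean w n y (2 * M + a))
        - tA M + (\<beta> * (real (2 * M + a) * tB M) + \<delta> * tB M)) \<in> O(\<lambda>M. real (2 * M + a) ^ (2 * n - 2))"
      using bigo_compose_linear[OF even_odd_mean_asymp[OF w n, of y], of a]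
      by (intro sum_in_bigo(1) sum_in_bigo(2)[OF _ tail_bigo'[of "[:0, 0, 1:] * q", folded tA_def]] bigo_cmult)
        (simp_all only: \<beta>_def \<delta>_def tB_def tail_bigo tail_bigo')
    thus ?thesis by (simp add: A_def B_def algebra_simps)
  qed
  \<comment> \<open>A lower bound for the denominator: since \<beta> > 0, the leading term dominates
    both the lower moments and the tail.\<close>
  have den: "(\<lambda>M. real (2 * M + a) ^ (2 * n - 1)) \<in> O(B)"
  proof -
    let ?f = "\<lambda>M. \<beta> ^ (2 * n - 1) * fall (2 * M + a) (2 * n - 1)"
    have f: "(\<lambda>M. real (2 * M + a) ^ (2 * n - 1)) \<in> O(?f)"
    proof -
      have "(\<lambda>N. real N ^ (2 * n - 1)) \<in> O(\<lambda>N. fall N (2 * n - 1))"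
        using fall_bigtheta by (meson bigthetaD2 bigomega_iff_bigo)
      from bigo_compose_linear[OF this] show ?thesis using \<beta> by simp
    qed
    have "(\<lambda>M. (odd_mean w n y (2 * M + a) - ?f M) - tB M) \<in> O(\<lambda>M. real (2 * M + a) ^ (2 * n - 2))"
      using bigo_compose_linear[OF odd_mean_leading[OF w(1) n, of y], of a]
      unfolding \<beta>_def tB_def by (rule sum_in_bigo(2)[OF _ tail_bigo'])
    also have "(\<lambda>M. (odd_mean w n y (2 * M + a) - ?f M) - tB M) = (\<lambda>M. B M - ?f M)"
      by (simp add: B_def algebra_simps)
    also have "(\<lambda>M. real (2 * M + a) ^ (2 * n - 2)) \<in> o(\<lambda>M. real (2 * M + a) ^ (2 * n - 1))"
    proof (rule landau_o.small_power_increasing)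
      have "filterlim (\<lambda>M. real (2 * M + a)) at_top sequentially"
        by (rule filterlim_at_top_mono[OF filterlim_real_sequentially]) auto
      hence "filterlim (\<lambda>M. real (2 * M + a)) at_infinity sequentially"
        by (rule filterlim_at_top_imp_at_infinity)
      thus "(\<lambda>_. 1) \<in> o(\<lambda>M. real (2 * M + a))"
        by (simp only: smallomega_1_conv_filterlim[symmetric] smallomega_iff_smallo)
    qed (use n in auto)
    finally have "(\<lambda>M. B M - ?f M) \<in> o(\<lambda>M. real (2 * M + a) ^ (2 * n - 1))" .
    hence "(\<lambda>M. B M - ?f M) \<in> o(?f)" using f by (rule landau_o.small_big_trans)
    hence "O(\<lambda>M. B M - ?f M + ?f M) = O(?f)" by (rule landau_o.big.plus_absorb1)
    thus ?thesis using f by simp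
  qed
  have "(\<lambda>M. (A M - (\<beta> * real (2 * M + a) + \<delta>) * B M) / B M) \<in> O(\<lambda>M. 1 / real (2 * M + a))"
  proof -
    have "(\<lambda>M. inverse (B M)) \<in> O(\<lambda>M. inverse (real (2 * M + a) ^ (2 * n - 1)))"
      by (rule landau_o.big.inverse[OF _ _ den]) (use B0 n in \<open>auto intro!: always_eventually eventually_mono[OF eventually_gt_at_top[of 0]]\<close>)
    from landau_o.big.mult[OF num this]
    have "(\<lambda>M. (A M - (\<beta> * real (2 * M + a) + \<delta>) * B M) * inverse (B M)) \<in>
        O(\<lambda>M. real (2 * M + a) ^ (2 * n - 2) * inverse (real (2 * M + a) ^ (2 * n - 1)))" .
    moreover have e: "2 * n - 1 = Suc (2 * n - 2)" using n by simp
    have "\<forall>\<^sub>F M in sequentially. real (2 * M + a) ^ (2 * n - 2) * inverse (real (2 * M + a) ^ (2 * n - 1)) = 1 / real (2 * M + a)"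
      using eventually_gt_at_top[of 0]
    proof eventually_elim
      case (elim M)
      hence "real (2 * M + a) \<noteq> 0" by simp
      thus ?case unfolding e power_Suc
        by (simp only: inverse_mult_distrib) (simp add: divide_inverse)
    qed
    ultimately show ?thesis by (simp add: divide_inverse landau_o.big.cong)
  qed
  hence "(\<lambda>M. \<kappa> / x * ((A M - (\<beta> * real (2 * M + a) + \<delta>) * B M) / B M)) \<in> O(\<lambda>M. 1 / real (2 * M + a))"
    by (rule bigo_cmult)
  moreover have "\<kappa> / x * ((A M - (\<beta> * real (2 * M + a) + \<delta>) * B M) / B M) = mean_contacts n (2 * M + y) y \<kappa> -
    ((\<kappa> - 2) / (\<kappa> - 1) * (real (2 * M + y) / 2)
      + \<kappa> * ((2 - \<kappa>) * real y + 4 * real n - 2) / (2 * (\<kappa> - 1) * (\<kappa> - 2)) + 1)" for M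
  proof -
    have \<delta>k: "\<delta> = (2 * real n - 1) * (2 * (\<kappa> - 1) / (\<kappa> * (\<kappa> - 2)))"
    proof -
      have "1 / 4 - \<beta>\<^sup>2 = (\<kappa> - 1) / \<kappa>\<^sup>2"
        unfolding \<beta>k using \<kappa> by (simp add: field_simps power2_eq_square)
      moreover have "real (2 * n - 1) = 2 * real n - 1" using n by (simp add: of_nat_diff)
      ultimately show ?thesis unfolding \<delta>_def \<beta>k using \<kappa> by (simp add: field_simps power2_eq_square)
    qed
    have ar: "real a = real y + 2 * real n - 1" using n by (simp add: a_def of_nat_diff)
    have "\<kappa> / x * (\<beta> * real (2 * M + a) + \<delta> - real a / 2) =
      (\<kappa> - 2) / (\<kappa> - 1) * (real (2 * M + y) / 2)
      + \<kappa> * ((2 - \<kappa>) * real y + 4 * real n - 2) / (2 * (\<kappa> - 1) * (\<kappa> - 2))"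
    proof -
      have "real (2 * M + a) = real (2 * M + y) + (2 * real n - 1)" using ar by simp
      moreover have "\<kappa> \<noteq> 0" "\<kappa> - 1 \<noteq> 0" "\<kappa> - 2 \<noteq> 0" using \<kappa> by auto
      ultimately show ?thesis unfolding \<delta>k \<beta>k ar x_def
        by (simp add: divide_simps) (simp add: algebra_simps)
    qed
    moreover have "(A M - (\<beta> * real (2 * M + a) + \<delta>) * B M) / B M = A M / B M - (\<beta> * real (2 * M + a) + \<delta>)"
      using B0[of M] by (simp add: diff_divide_distrib)
    ultimately show ?thesis unfolding mean by (simp add: right_diff_distrib)
  qed
  ultimately show ?thesis by (simp add: a_def)
qed

subsection \<open>The critical regime\<close>

text \<open>By f g - a b = (f - a) g + a (g - b), with g bounded since h tends to 0.\<close>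

lemma bigo_product_one:
  fixes f g h :: "'a \<Rightarrow> real"
  assumes f: "(\<lambda>x. f x - a) \<in> O[F](h)" and g: "(\<lambda>x. g x - b) \<in> O[F](h)" and h: "(h \<longlongrightarrow> 0) F"
  shows "(\<lambda>x. f x * g x - a * b) \<in> O[F](h)"
proof -
  have "h \<in> O[F](\<lambda>_. 1)" by (rule bigoI_tendsto[of _ _ 0]) (use h in auto)
  hence "(\<lambda>x. g x - b) \<in> O[F](\<lambda>_. 1)" by (rule landau_o.big_trans[OF g])
  hence "g \<in> O[F](\<lambda>_. 1)"
    using sum_in_bigo(1)[of "\<lambda>x. g x - b" F "\<lambda>_. 1" "\<lambda>_. b"] by simp
  hence "(\<lambda>x. (f x - a) * g x) \<in> O[F](\<lambda>x. h x * 1)" by (rule landau_o.big.mult[OF f])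
  hence "(\<lambda>x. (f x - a) * g x + a * (g x - b)) \<in> O[F](h)"
    by (intro sum_in_bigo(1) bigo_cmult g) simp
  thus ?thesis by (simp add: algebra_simps)
qed

section \<open>Wallis' product and central binomials\<close>

lemma central_binomial_wallis:
  "(\<Prod>k=1..n. (4 * real k ^ 2) / (4 * real k ^ 2 - 1)) = (4 ^ n / real ((2 * n) choose n))\<^sup>2 / real (2 * n + 1)"
proof (induction n)
  case (Suc n)
  have "Suc n * (Suc n * ((2 * Suc n) choose Suc n)) = (2 * n + 2) * ((2 * n + 1) * ((2 * n) choose n))"
  proof -
    have "Suc n * ((2 * Suc n) choose Suc n) = (2 * n + 2) * ((2 * n + 1) choose n)"
      using binomial_absorption[of n "2 * n + 2"] by simp
    moreover have "Suc n * ((2 * n + 1) choose n) = (2 * n + 1) * ((2 * n) choose n)"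
      using binomial_absorb_comp[of "2 * n + 1" n] by simp
    ultimately show ?thesis by (metis mult.left_commute)
  qed
  hence "real (Suc n) * (real (Suc n) * real ((2 * Suc n) choose Suc n)) = real (2 * n + 2) * (real (2 * n + 1) * real ((2 * n) choose n))"
    by (metis of_nat_mult)
  moreover have "X = 2 * B / S * C" if "S * (S * X) = (2 * S) * (B * C)" "S \<noteq> 0" for X B C S :: real
    using that by (simp add: field_simps)
  moreover have "real (2 * n + 2) = 2 * real (Suc n)" by simp
  ultimately have rec: "real ((2 * Suc n) choose Suc n) = 2 * real (2 * n + 1) / real (Suc n) * real ((2 * n) choose n)"
    by (metis of_nat_Suc of_nat_neq_0)
  define c where "c = real ((2 * n) choose n)"
  have c: "c \<noteq> 0" by (simp add: c_def)
  have p: "4 * real (Suc n) ^ 2 - 1 = real (2 * n + 1) * real (2 * n + 3)"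
    by (simp add: power2_eq_square algebra_simps)
  have "(\<Prod>k=1..Suc n. (4 * real k ^ 2) / (4 * real k ^ 2 - 1)) =
      (4 ^ n / c)\<^sup>2 / real (2 * n + 1) * ((4 * real (Suc n) ^ 2) / (real (2 * n + 1) * real (2 * n + 3)))"
    unfolding c_def by (subst prod.nat_ivl_Suc') (simp_all only: Suc p, simp_all add: mult_ac)
  also have "\<dots> = (4 ^ Suc n / (2 * real (2 * n + 1) / real (Suc n) * c))\<^sup>2 / real (2 * Suc n + 1)"
    using c by (simp add: power2_eq_square divide_simps) (simp add: algebra_simps)
  finally show ?case unfolding rec c_def .
qed simp

text \<open>The Wallis products p(n) increase to pi/2, which bounds r^2 = (2n + 1) p(n) from above.
  Multiplied by (2n + 1)/(2n) they decrease to the same limit, which bounds it from below.\<close>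

lemma central_binomial_bounds:
  assumes "n \<ge> 1"
  defines "r \<equiv> 4 ^ n / real ((2 * n) choose n)"
  shows "pi * real n \<le> r\<^sup>2" "r\<^sup>2 \<le> pi * (real n + 1 / 2)"
proof -
  let ?p = "\<lambda>n. \<Prod>k=1..n. (4 * real k ^ 2) / (4 * real k ^ 2 - 1)"
  have pos: "4 * real (Suc n) ^ 2 - 1 > 0" for n
    by (simp add: power2_eq_square algebra_simps add_pos_nonneg)
  have ppos: "?p n > 0" for n
  proof (rule prod_pos)
    fix k assume "k \<in> {1..n}"
    then obtain k' where "k = Suc k'" by (cases k) auto
    thus "(4 * real k ^ 2) / (4 * real k ^ 2 - 1) > 0" using pos[of k'] by simp
  qed
  have pS: "?p (Suc n) = ?p n * ((4 * real (Suc n) ^ 2) / (4 * real (Suc n) ^ 2 - 1))" for n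
    by (subst prod.nat_ivl_Suc', simp) (rule mult.commute)
  have "incseq ?p"
  proof (rule incseq_SucI)
    fix n
    have "1 \<le> (4 * real (Suc n) ^ 2) / (4 * real (Suc n) ^ 2 - 1)" using pos[of n] by (simp add: field_simps)
    hence "?p n * 1 \<le> ?p n * ((4 * real (Suc n) ^ 2) / (4 * real (Suc n) ^ 2 - 1))"
      by (intro mult_left_mono less_imp_le[OF ppos])
    thus "?p n \<le> ?p (Suc n)" unfolding pS by simp
  qed
  hence "?p n \<le> pi / 2" by (rule incseq_le[OF _ wallis])
  thus "r\<^sup>2 \<le> pi * (real n + 1 / 2)"
    unfolding central_binomial_wallis r_def[symmetric] by (simp add: field_simps)
  \<comment> \<open>Indexed from n + 1, so that the denominator of the correction factor never
    vanishes.\<close>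
  define q where "q = (\<lambda>n. ?p (Suc n) * ((2 * real n + 3) / (2 * real n + 2)))"
  have "decseq q"
  proof (rule decseq_SucI)
    fix n
    have "(4 * real (Suc (Suc n)) ^ 2) / (4 * real (Suc (Suc n)) ^ 2 - 1) * ((2 * real (Suc n) + 3) / (2 * real (Suc n) + 2))
        \<le> (2 * real n + 3) / (2 * real n + 2)"
    proof -
      have "4 * real (Suc (Suc n)) ^ 2 - 1 = (2 * real n + 3) * (2 * real n + 5)"
        by (simp add: power2_eq_square algebra_simps)
      moreover have "2 * real (Suc n) + 3 = 2 * real n + 5" "2 * real (Suc n) + 2 = 2 * real n + 4"
        "4 * real (Suc (Suc n)) ^ 2 = (2 * real n + 4)\<^sup>2"
        by (simp_all add: power2_eq_square algebra_simps)
      \<comment> \<open>Applied with u = 2n + 4; it reduces to u(u - 2) \<le> (u - 1)^2.\<close>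
      moreover have "u\<^sup>2 / ((u - 1) * (u + 1)) * ((u + 1) / u) \<le> (u - 1) / (u - 2)" if "u > 2" for u :: real
      proof -
        have "u\<^sup>2 / ((u - 1) * (u + 1)) * ((u + 1) / u) = u / (u - 1)" using that by (simp add: power2_eq_square divide_simps)
        also have "\<dots> \<le> (u - 1) / (u - 2)" using that by (simp add: divide_simps) (simp add: algebra_simps)
        finally show ?thesis .
      qed
      from this[of "2 * real n + 4"] have "(2 * real n + 4)\<^sup>2 / ((2 * real n + 3) * (2 * real n + 5)) * ((2 * real n + 5) / (2 * real n + 4))
        \<le> (2 * real n + 3) / (2 * real n + 2)" by (simp add: algebra_simps)
      ultimately show ?thesis by (simp only:)
    qed
    hence "?p (Suc n) * ((4 * real (Suc (Suc n)) ^ 2) / (4 * real (Suc (Suc n)) ^ 2 - 1) * ((2 * real (Suc n) + 3) / (2 * real (Suc n) + 2)))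
        \<le> ?p (Suc n) * ((2 * real n + 3) / (2 * real n + 2))"
      by (intro mult_left_mono less_imp_le[OF ppos])
    thus "q (Suc n) \<le> q n" unfolding q_def pS[of "Suc n"] by (simp only: mult.assoc)
  qed
  moreover have "q \<longlonglongrightarrow> pi / 2 * 1"
    unfolding q_def
  proof (intro tendsto_mult LIMSEQ_Suc wallis)
    have "(\<lambda>n. 1 + (1 / 2) * (1 / real (Suc n))) \<longlonglongrightarrow> 1 + (1 / 2) * 0"
      by (intro tendsto_intros LIMSEQ_Suc lim_1_over_n)
    also have "(\<lambda>n. 1 + (1 / 2) * (1 / real (Suc n))) = (\<lambda>n. (2 * real n + 3) / (2 * real n + 2))"
      by (simp add: fun_eq_iff divide_simps) (simp add: algebra_simps)
    finally show "(\<lambda>n. (2 * real n + 3) / (2 * real n + 2)) \<longlonglongrightarrow> 1" by simp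
  qed
  ultimately have "pi / 2 * 1 \<le> q (n - 1)" by (rule decseq_ge)
  also have "q (n - 1) = r\<^sup>2 / (2 * real n)"
  proof -
    obtain m where m: "n = Suc m" using assms(1) by (cases n) auto
    have "q m = r\<^sup>2 / real (2 * n + 1) * ((2 * real m + 3) / (2 * real m + 2))"
      unfolding q_def m[symmetric] central_binomial_wallis r_def ..
    moreover have "real (2 * n + 1) = 2 * real m + 3" "2 * real m + 2 = 2 * real n" by (simp_all add: m)
    moreover have "2 * real m + 3 \<noteq> 0" using of_nat_0_le_iff[of m, where 'a = real] by linarith
    moreover have "R / U * (U / V) = R / V" if "U \<noteq> 0" for R U V :: real using that by simp
    moreover have "n - 1 = m" by (simp add: m)
    ultimately show ?thesis by (simp only:)
  qed
  finally show "pi * real n \<le> r\<^sup>2" using assms(1) by (simp add: field_simps)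
qed

text \<open>For b = 0 the bounds on the square of the quotient q pass to q itself, as 1 \<le> q
  \<le> q^2. Raising b by one multiplies q by 2(M + b + 1)/(2M + b + 1) = 1 + O(1/M).\<close>

lemma central_binomial_asymp:
  "(\<lambda>M. 2 ^ (2 * M + b) / real ((2 * M + b) choose M) / sqrt (pi * real M) - 1) \<in> O(\<lambda>M. 1 / real M)"
proof (induction b)
  case 0
  show ?case
  proof (rule bigoI[of _ 1])
    show "\<forall>\<^sub>F M in sequentially. norm (2 ^ (2 * M + 0) / real ((2 * M + 0) choose M) / sqrt (pi * real M) - 1) \<le> 1 * norm (1 / real M)"
      using eventually_ge_at_top[of 1]
    proof eventually_elim
      case (elim M)
      define r where "r = 4 ^ M / real ((2 * M) choose M)"
      have r: "r > 0" "pi * real M \<le> r\<^sup>2" "r\<^sup>2 \<le> pi * (real M + 1 / 2)"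
        using central_binomial_bounds[OF elim] by (simp_all add: r_def)
      define q where "q = r / sqrt (pi * real M)"
      have q0: "q > 0" using r elim by (simp add: q_def)
      have q2: "q\<^sup>2 = r\<^sup>2 / (pi * real M)" using elim by (simp add: q_def power_divide)
      have "1 \<le> q\<^sup>2" using r elim unfolding q2 by simp
      hence q1: "1 \<le> q" using q0 by (smt (verit) power_strict_mono one_power2 zero_less_numeral)
      have "q\<^sup>2 \<le> 1 + 1 / (2 * real M)" using r elim unfolding q2 by (simp add: field_simps)
      moreover have "q \<le> q\<^sup>2" using q1 q0 by (simp add: power2_eq_square)
      moreover have "1 / (2 * real M) \<le> 1 / real M" using elim by (simp add: field_simps)
      ultimately have "\<bar>q - 1\<bar> \<le> 1 / real M" using q1 by linarith
      moreover have "(2::real) ^ (2 * M + 0) = 4 ^ M" by (simp add: power_mult)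
      ultimately show ?case unfolding q_def r_def by simp
    qed
  qed
next
  case (Suc b)
  have "(\<lambda>M. 2 * (real M + real b + 1) / (2 * real M + real b + 1) - 1) \<in> O(\<lambda>M. 1 / real M)"
  proof (rule bigoI[of _ "real b + 1"])
    show "\<forall>\<^sub>F M in sequentially. norm (2 * (real M + real b + 1) / (2 * real M + real b + 1) - 1) \<le> (real b + 1) * norm (1 / real M)"
      using eventually_gt_at_top[of 0]
    proof eventually_elim
      case (elim M)
      have "2 * (real M + real b + 1) / (2 * real M + real b + 1) - 1 = (real b + 1) / (2 * real M + real b + 1)"
        by (simp add: divide_simps)
      moreover have "(real b + 1) / (2 * real M + real b + 1) \<le> (real b + 1) / real M"
        using elim by (intro divide_left_mono) auto
      ultimately show ?case by simp
    qed
  qed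
  from bigo_product_one[OF Suc this lim_1_over_n]
  have "(\<lambda>M. 2 ^ (2 * M + b) / real ((2 * M + b) choose M) / sqrt (pi * real M) * (2 * (real M + real b + 1) / (2 * real M + real b + 1)) - 1)
      \<in> O(\<lambda>M. 1 / real M)" by simp
  also have "(\<lambda>M. 2 ^ (2 * M + b) / real ((2 * M + b) choose M) / sqrt (pi * real M) * (2 * (real M + real b + 1) / (2 * real M + real b + 1)) - 1)
      = (\<lambda>M. 2 ^ (2 * M + Suc b) / real ((2 * M + Suc b) choose M) / sqrt (pi * real M) - 1)"
  proof
    fix M
    have "(M + b + 1) * ((2 * M + Suc b) choose M) = (2 * M + b + 1) * ((2 * M + b) choose M)"
      using binomial_absorb_comp[of "2 * M + Suc b" M] by simp
    hence "real (M + b + 1) * real ((2 * M + Suc b) choose M) = real (2 * M + b + 1) * real ((2 * M + b) choose M)"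
      by (metis of_nat_mult)
    hence c: "real ((2 * M + Suc b) choose M) = (2 * real M + real b + 1) * real ((2 * M + b) choose M) / (real M + real b + 1)"
      by (simp add: field_simps)
    show "2 ^ (2 * M + b) / real ((2 * M + b) choose M) / sqrt (pi * real M) * (2 * (real M + real b + 1) / (2 * real M + real b + 1)) - 1
      = 2 ^ (2 * M + Suc b) / real ((2 * M + Suc b) choose M) / sqrt (pi * real M) - 1"
    proof -
      have "p / C / q * (2 * u / v) = 2 * p / (v * C / u) / q" for p C q u v :: real by (simp add: mult_ac)
      moreover have "(2 :: real) ^ (2 * M + Suc b) = 2 * 2 ^ (2 * M + b)" by simp
      ultimately show ?thesis unfolding c by (simp only:)
    qed
  qed
  finally show ?case .
qed

text \<open>\<open>binomial_Suc_difference\<close> for the row 2M + a - 1 makes the factor 2k + a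
  times its binomial a difference in k, after which the difference moves over to h.\<close>

lemma mode_sum_by_parts:
  fixes h :: "nat \<Rightarrow> real"
  assumes a: "a \<ge> 1"
  shows "(\<Sum>k\<le>M. h k * (real (2 * k + a) * real ((2 * M + a) choose (M - k)))) =
    real (2 * M + a) * (h 0 * real ((2 * M + a - 1) choose M) + (\<Sum>k<M. (h (Suc k) - h k) * real ((2 * M + a - 1) choose (M - Suc k))))"
proof -
  define N where "N = 2 * M + a - 1"
  have N: "2 * M + a = Suc N" using a by (simp add: N_def)
  \<comment> \<open>At k = M the second neighbour would have lower index -1 and has to count as 0,
    whereas truncated subtraction would give index 0; hence the conditional.\<close>
  have "(\<Sum>k\<le>M. h k * (real (2 * k + a) * real ((2 * M + a) choose (M - k)))) =
      (\<Sum>k\<le>M. real (Suc N) * (h k * real (N choose (M - k)) - h k * (if k = M then 0 else real (N choose (M - Suc k)))))"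
  proof (rule sum.cong[OF refl])
    fix k assume "k \<in> {..M}"
    hence k: "k \<le> M" by simp
    have "real (2 * k + a) = real (Suc N) - 2 * real (M - k)" using N k by (simp add: of_nat_diff)
    hence "real (2 * k + a) * real ((2 * M + a) choose (M - k)) =
        real (Suc N) * (real (N choose (M - k)) - (if M - k = 0 then 0 else real (N choose (M - k - 1))))"
      using binomial_Suc_difference[of N "M - k"] N by (simp only: mult.commute)
    moreover have "(M - k = 0) = (k = M)" "M - k - 1 = M - Suc k" using k by auto
    ultimately show "h k * (real (2 * k + a) * real ((2 * M + a) choose (M - k))) =
      real (Suc N) * (h k * real (N choose (M - k)) - h k * (if k = M then 0 else real (N choose (M - Suc k))))"
      by (simp only: right_diff_distrib mult_ac)
  qed
  also have "\<dots> = real (Suc N) * ((\<Sum>k\<le>M. h k * real (N choose (M - k))) - (\<Sum>k\<le>M. h k * (if k = M then 0 else real (N choose (M - Suc k)))))"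
    by (simp only: sum_distrib_left[symmetric] sum_subtractf)
  also have "(\<Sum>k\<le>M. h k * (if k = M then 0 else real (N choose (M - Suc k)))) = (\<Sum>k<M. h k * real (N choose (M - Suc k)))"
    by (simp flip: lessThan_Suc_atMost)
  also have "(\<Sum>k\<le>M. h k * real (N choose (M - k))) = h 0 * real (N choose M) + (\<Sum>k<M. h (Suc k) * real (N choose (M - Suc k)))"
    by (subst sum.atMost_shift) simp
  finally show ?thesis unfolding N[symmetric] N_def[symmetric]
    by (simp add: left_diff_distrib sum_subtractf)
qed

text \<open>With a' = y + 2m + 2, the shift in k changes one factor in each of the two products, and
  (k + m + 1)(k + a') - k(k + a' - m - 1) = (m + 1)(2k + a'). So the difference is again a linear
  factor times a height polynomial, with a lowered by one.\<close>

lemma height_poly_difference: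
  "height_poly (Suc (Suc m)) y k - height_poly (Suc (Suc m)) y (k - 1) =
    real (Suc m) * ((2 * k + real (y + 2 * m + 2)) * height_poly (Suc m) (Suc y) k)"
proof -
  define A where "A = (\<Prod>r\<in>{1..m}. k + real r)"
  define B where "B = (\<Prod>r\<in>{1..m}. k + real (y + 2 * m + 2) - real r)"
  have I: "{1..<Suc (Suc m)} = {1..Suc m}" "{1..<Suc m} = {1..m}" by auto
  have a: "real (y + 2 * Suc (Suc m) - 1) = real (y + 2 * m + 2) + 1" "real (Suc y + 2 * Suc m - 1) = real (y + 2 * m + 2)"
    by simp_all
  have 1: "(\<Prod>r\<in>{1..Suc m}. k + real r) = A * (k + real m + 1)" by (simp add: A_def algebra_simps)
  have 2: "(\<Prod>r\<in>{1..Suc m}. k - 1 + real r) = k * A"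
    unfolding A_def by (subst prod.atLeast_Suc_atMost, simp, subst prod.shift_bounds_cl_Suc_ivl) (simp add: algebra_simps)
  have 3: "(\<Prod>r\<in>{1..Suc m}. k + (real (y + 2 * m + 2) + 1) - real r) = (k + real (y + 2 * m + 2)) * B"
    unfolding B_def by (subst prod.atLeast_Suc_atMost, simp, subst prod.shift_bounds_cl_Suc_ivl) (simp add: algebra_simps)
  have 4: "(\<Prod>r\<in>{1..Suc m}. k - 1 + (real (y + 2 * m + 2) + 1) - real r) = B * (k + real (y + 2 * m + 2) - real m - 1)"
    by (simp add: B_def algebra_simps)
  have h: "height_poly (Suc (Suc m)) y k = A * (k + real m + 1) * ((k + real (y + 2 * m + 2)) * B)"
    "height_poly (Suc (Suc m)) y (k - 1) = k * A * (B * (k + real (y + 2 * m + 2) - real m - 1))"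
    "height_poly (Suc m) (Suc y) k = A * B"
    unfolding height_poly_def prod.distrib I a 1 2 3 4 by (simp_all add: A_def B_def)
  show ?thesis unfolding h by (simp add: algebra_simps)
qed

text \<open>Lets the boundary term of the summation by parts be read as a difference at k = 0, so
  that it fits the pattern of the other terms.\<close>

lemma height_poly_minus_one: "height_poly (Suc (Suc m)) y (- 1) = 0"
  unfolding height_poly_def by (rule prod_zero) (auto intro!: bexI[of _ 1])

text \<open>Summation by parts lowers \<open>n\<close> by one and raises \<open>y\<close> by one.\<close>

lemma mode_sum_critical:
  "mode_sum (Suc m) y M 1 = fact m * fall (2 * M + (y + 2 * Suc m - 1)) (Suc m) * real ((2 * M + (y + m)) choose M)"
proof (induction m arbitrary: y)
  case 0
  have "mode_sum (Suc 0) y M 1 = (\<Sum>k\<le>M. 1 * (real (2 * k + (y + 1)) * real ((2 * M + (y + 1)) choose (M - k))))"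
    by (simp add: mode_sum_def mode_weight_def height_poly_def)
  also have "\<dots> = real (2 * M + (y + 1)) * real ((2 * M + y) choose M)"
    by (subst mode_sum_by_parts) simp_all
  finally show ?case by (simp add: fall_Suc)
next
  case (Suc m)
  define a where "a = y + 2 * Suc (Suc m) - 1"
  define h where "h = (\<lambda>k::nat. height_poly (Suc (Suc m)) y (real k))"
  let ?g = "\<lambda>k::nat. real (Suc m) * ((2 * real k + real (y + 2 * m + 2)) * height_poly (Suc m) (Suc y) (real k))"
  have a1: "a \<ge> 1" "2 * M + a - 1 = 2 * M + (Suc y + 2 * Suc m - 1)" by (simp_all add: a_def)
  have h0: "h 0 = ?g 0"
    using height_poly_difference[of m y 0] height_poly_minus_one[of m y] by (simp add: h_def)
  have hS: "h (Suc k) - h k = ?g (Suc k)" for k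
    using height_poly_difference[of m y "real (Suc k)"] by (simp add: h_def)
  have "mode_sum (Suc (Suc m)) y M 1 = (\<Sum>k\<le>M. h k * (real (2 * k + a) * real ((2 * M + a) choose (M - k))))"
    by (simp add: mode_sum_def mode_weight_def h_def a_def mult_ac)
  also have "\<dots> = real (2 * M + a) * (?g 0 * real ((2 * M + a - 1) choose M) + (\<Sum>k<M. ?g (Suc k) * real ((2 * M + a - 1) choose (M - Suc k))))"
    unfolding mode_sum_by_parts[OF a1(1)] h0 hS ..
  also have "?g 0 * real ((2 * M + a - 1) choose M) + (\<Sum>k<M. ?g (Suc k) * real ((2 * M + a - 1) choose (M - Suc k)))
      = (\<Sum>k\<le>M. ?g k * real ((2 * M + a - 1) choose (M - k)))"
    by (subst sum.atMost_shift) simp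
  also have "\<dots> = real (Suc m) * mode_sum (Suc m) (Suc y) M 1"
    unfolding a1(2) mode_sum_def mode_weight_def sum_distrib_left by (intro sum.cong refl) simp
  also have "\<dots> = real (Suc m) * (fact m * fall (2 * M + a - 1) (Suc m) * real ((2 * M + (Suc y + m)) choose M))"
    unfolding Suc a1(2) ..
  also have "real (2 * M + a) * \<dots> = fact (Suc m) * (real (2 * M + a) * fall (2 * M + a - 1) (Suc m)) * real ((2 * M + (y + Suc m)) choose M)"
    by (simp add: mult_ac)
  also have "real (2 * M + a) * fall (2 * M + a - 1) (Suc m) = fall (2 * M + a) (Suc (Suc m))"
    using fall_Suc_Suc[of "2 * M + a - 1" "Suc m"] a1(1) by simp
  finally show ?case by (simp add: a_def)
qed

text \<open>Rationalizing leaves a multiple of y divided by the sum of the two roots. This permits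
  replacing M by t/2 in the main term.\<close>

lemma sqrt_shift_bigo:
  "(\<lambda>M. sqrt (pi * real M) - sqrt (pi * (real (2 * M + y) / 2))) \<in> O(\<lambda>M. 1 / sqrt (real M))"
proof (rule bigoI[of _ "sqrt pi * real y"])
  show "\<forall>\<^sub>F M in sequentially. norm (sqrt (pi * real M) - sqrt (pi * (real (2 * M + y) / 2))) \<le> sqrt pi * real y * norm (1 / sqrt (real M))"
    using eventually_gt_at_top[of 0]
  proof eventually_elim
    case (elim M)
    define u v where "u = sqrt (real (2 * M + y) / 2)" and "v = sqrt (real M)"
    have v: "v > 0" using elim by (simp add: v_def)
    have uv: "v \<le> u" by (simp add: u_def v_def)
    have "(u - v) * (u + v) = u\<^sup>2 - v\<^sup>2" by (simp add: power2_eq_square algebra_simps)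
    also have "\<dots> = real y / 2" by (simp add: u_def v_def field_simps)
    finally have e: "(u - v) * (u + v) = real y / 2" .
    have "(u - v) * v \<le> (u - v) * (u + v)" using uv v by (intro mult_left_mono) auto
    hence "u - v \<le> real y / v" using e v by (simp add: field_simps)
    hence "sqrt pi * \<bar>u - v\<bar> \<le> sqrt pi * (real y / v)" using uv by (intro mult_left_mono) auto
    moreover have "sqrt (pi * real M) - sqrt (pi * (real (2 * M + y) / 2)) = - (sqrt pi * (u - v))"
      unfolding u_def v_def real_sqrt_mult by (simp add: right_diff_distrib)
    moreover have "norm (- (sqrt pi * (u - v))) = sqrt pi * \<bar>u - v\<bar>" by (simp add: abs_mult)
    moreover have "norm (1 / sqrt (real M)) = 1 / v" using v by (simp add: v_def)
    ultimately show ?case using v by simp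
  qed
qed

text \<open>The mean is 2 - 2n - y plus a constant times sqrt(pi M) Y X, where Y tends to 1 by
  Wallis and X tends to \<open>cn\<close> by the symmetric moments. Both errors are O(1/M), which
  the square root turns into O(1/sqrt M).\<close>

lemma mean_contacts_critical:
  assumes n: "n \<ge> 1"
  shows "(\<lambda>M. mean_contacts n (2 * M + y) y 2 -
    (2 powr (1 / 2 - 2 * real n) * real n * real ((2 * n) choose n) * sqrt (pi * real (2 * M + y))
      - 2 * real n - real y + 2)) \<in> O(\<lambda>M. 1 / sqrt (real M))"
proof -
  obtain m where m: "n = Suc m" using n by (cases n) auto
  define a where "a = y + 2 * n - 1"
  define b where "b = y + m"
  \<comment> \<open>The exact denominator carries a binomial from row 2M + b, which lies n rows
    above that of the numerator; the surplus factor 2^n goes into the constant.\<close>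
  have Nb: "2 * M + a = (2 * M + b) + n" for M by (simp add: a_def b_def m)
  define cn where "cn = (fact (2 * n) / (8 ^ n * fact n) :: real)"
  define G where "G = (\<lambda>M j. real ((2 * M + a) choose j) * ((real (2 * M + a) / 2 - real j)\<^sup>2 *
    poly (even_height_poly n y) ((real (2 * M + a) / 2 - real j)\<^sup>2)))"
  \<comment> \<open>The a - 1 central indices, lying between j \<le> M and its mirror image j \<ge>
    M + a.\<close>
  define mid where "mid = (\<lambda>M. (\<Sum>j\<in>{M<..<M + a}. G M j) / 2 ^ (2 * M + a))"
  define X where "X = (\<lambda>M. (even_mean 1 n y (2 * M + a) - mid M) / fall (2 * M + a) n)"
  define Y where "Y = (\<lambda>M. 2 ^ (2 * M + b) / real ((2 * M + b) choose M) / sqrt (pi * real M))"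
  define S where "S = (\<lambda>M. mode_sum n y M 1)"
  have S: "S M = fact m * fall (2 * M + a) n * real ((2 * M + b) choose M)" for M
    unfolding S_def a_def b_def m by (rule mode_sum_critical)
  have S0: "S M \<noteq> 0" for M using mean_contacts_eq(1)[OF n, of 2 y M] by (simp add: S_def)
  have twice: "2 * (\<Sum>j\<le>M. G M j) = 2 ^ (2 * M + a) * (even_mean 1 n y (2 * M + a) - mid M)" for M
  proof -
    have total: "(\<Sum>j\<le>2 * M + a. G M j) = 2 ^ (2 * M + a) * even_mean 1 n y (2 * M + a)"
      using even_mean_eq[of 1 "2 * M + a" n y] by (simp add: G_def)
    have "{..2 * M + a} = {..M} \<union> ({M<..<M + a} \<union> {M + a..2 * M + a})"
      using n by (auto simp: a_def)
    hence "(\<Sum>j\<le>2 * M + a. G M j) = (\<Sum>j\<le>M. G M j) + ((\<Sum>j\<in>{M<..<M + a}. G M j) + (\<Sum>j\<in>{M + a..2 * M + a}. G M j))"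
      using n by (simp only:) (subst sum.union_disjoint; auto simp: a_def)+
    also have "(\<Sum>j\<in>{M + a..2 * M + a}. G M j) = (\<Sum>j\<le>M. G M j)"
    proof (rule sum.reindex_bij_witness[of _ "\<lambda>j. 2 * M + a - j" "\<lambda>j. 2 * M + a - j"])
      fix j assume "j \<in> {M + a..2 * M + a}"
      hence j: "j \<le> 2 * M + a" by simp
      have "real (2 * M + a) / 2 - real (2 * M + a - j) = - (real (2 * M + a) / 2 - real j)"
        using j by (simp add: of_nat_diff field_simps)
      moreover have "(2 * M + a) choose (2 * M + a - j) = (2 * M + a) choose j"
        by (rule binomial_symmetric[OF j, symmetric])
      ultimately show "G M (2 * M + a - j) = G M j" unfolding G_def by (simp only: power2_minus)
    qed auto
    finally have "2 * (\<Sum>j\<le>M. G M j) = (\<Sum>j\<le>2 * M + a. G M j) - (\<Sum>j\<in>{M<..<M + a}. G M j)" by simp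
    thus ?thesis unfolding total mid_def by (simp add: right_diff_distrib)
  qed
  have mean: "mean_contacts n (2 * M + y) y 2 = (2 - 2 * real n - real y) + 2 * 2 ^ n / fact m * (sqrt (pi * real M) * (Y M * X M))"
    if M: "M \<ge> 1" for M
  proof -
    have "(\<Sum>k\<le>M. real k * 1 ^ (k - 1) * mode_weight n y M k) = (\<Sum>j\<le>M. real (M - j) * mode_weight n y M (M - j))"
      using sum_atMost_rev[of "\<lambda>k. real k * 1 ^ (k - 1) * mode_weight n y M k" M] by simp
    also have "\<dots> = (\<Sum>j\<le>M. 2 * G M j - real a / 2 * mode_weight n y M (M - j))"
    proof (rule sum.cong[OF refl])
      fix j assume "j \<in> {..M}"
      hence j: "j \<le> M" by simp
      define z where "z = real (2 * M + a) / 2 - real j"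
      have mw: "mode_weight n y M (M - j) = 2 * (real ((2 * M + a) choose j) * (z * poly (even_height_poly n y) (z\<^sup>2)))"
        and k: "real (M - j) = z - real a / 2"
        using mode_weight_height(1)[OF j, where n = n and y = y] mode_weight_height(2)[OF j, where n = n and y = y]
        by (simp_all only: a_def z_def)
      have "G M j = real ((2 * M + a) choose j) * (z\<^sup>2 * poly (even_height_poly n y) (z\<^sup>2))"
        by (simp only: G_def z_def)
      hence "2 * G M j = z * mode_weight n y M (M - j)" unfolding mw by (simp add: power2_eq_square)
      thus "real (M - j) * mode_weight n y M (M - j) = 2 * G M j - real a / 2 * mode_weight n y M (M - j)"
        unfolding k by (simp add: left_diff_distrib)
    qed
    also have "\<dots> = 2 * (\<Sum>j\<le>M. G M j) - real a / 2 * (\<Sum>j\<le>M. mode_weight n y M (M - j))"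
      by (simp add: sum_subtractf sum_distrib_left)
    also have "(\<Sum>j\<le>M. mode_weight n y M (M - j)) = S M"
      unfolding S_def mode_sum_def by (simp add: sum_atMost_rev[of "mode_weight n y M"])
    finally have S': "(\<Sum>k\<le>M. real k * 1 ^ (k - 1) * mode_weight n y M k) = 2 * (\<Sum>j\<le>M. G M j) - real a / 2 * S M" .
    have "mean_contacts n (2 * M + y) y 2 = 1 + 2 * (2 * (\<Sum>j\<le>M. G M j) - real a / 2 * S M) / S M"
      using mean_contacts_eq(2)[OF n, of 2 M y] S' by (simp add: S_def)
    also have "\<dots> = 1 - real a + 2 * (2 * (\<Sum>j\<le>M. G M j)) / S M"
      using S0[of M] by (simp add: field_simps)
    also have "1 - real a = 2 - 2 * real n - real y" using n by (simp add: a_def of_nat_diff)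
    also have "2 * (2 * (\<Sum>j\<le>M. G M j)) / S M = 2 * 2 ^ n / fact m * (sqrt (pi * real M) * (Y M * X M))"
    proof -
      have "sqrt (pi * real M) \<noteq> 0" using M by simp
      moreover have "2 * (2 ^ (2 * M + b) * 2 ^ n * E) / (F * L * C) = 2 * 2 ^ n / F * (s * (2 ^ (2 * M + b) / C / s * (E / L)))"
        if "s \<noteq> 0" for E F L C s :: real using that by (simp add: mult_ac)
      ultimately show ?thesis unfolding twice S X_def Y_def unfolding Nb power_add[of 2 "2 * M + b" n] by blast
    qed
    finally show ?thesis .
  qed
  have invN: "(\<lambda>M. 1 / real (2 * M + a)) \<in> O(\<lambda>M. 1 / real M)"
  proof (rule bigoI[of _ 1])
    show "\<forall>\<^sub>F M in sequentially. norm (1 / real (2 * M + a)) \<le> 1 * norm (1 / real M)"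
      using eventually_gt_at_top[of 0]
    proof eventually_elim
      case (elim M)
      hence "1 / real (2 * M + a) \<le> 1 / real M" by (intro divide_left_mono) auto
      thus ?case by simp
    qed
  qed
  \<comment> \<open>Order 1 is good enough, because this term gets divided by
    \<open>fall (2 * M + a) n\<close>, of order M^n with n \<ge> 1.\<close>
  have mid: "mid \<in> O(\<lambda>_. 1)"
  proof -
    obtain K where K: "K \<ge> 0" "\<And>z. \<bar>poly ([:0, 1:] * even_height_poly n y) z\<bar> \<le> K * (1 + \<bar>z\<bar>) ^ degree ([:0, 1:] * even_height_poly n y)"
      using poly_abs_bound[of "[:0, 1:] * even_height_poly n y"] by blast
    define d where "d = degree ([:0, 1:] * even_height_poly n y)"
    define L where "L = K * (1 + real a ^ 2) ^ d"
    have L: "L \<ge> 0" using K(1) by (simp add: L_def)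
    have "\<bar>mid M\<bar> \<le> L" for M
    proof -
      have "\<bar>\<Sum>j\<in>{M<..<M + a}. G M j\<bar> \<le> (\<Sum>j\<in>{M<..<M + a}. real ((2 * M + a) choose j) * L)"
      proof (rule order_trans[OF sum_abs sum_mono])
        fix j assume j: "j \<in> {M<..<M + a}"
        define z where "z = real (2 * M + a) / 2 - real j"
        have "z = real M + real a / 2 - real j" by (simp add: z_def add_divide_distrib)
        moreover have "real M \<le> real j" "real j \<le> real M + real a" using j by auto
        ultimately have "\<bar>z\<bar> \<le> real a" by linarith
        hence "z\<^sup>2 \<le> real a ^ 2" by (metis abs_ge_zero power2_abs power_mono)
        have "\<bar>poly ([:0, 1:] * even_height_poly n y) (z\<^sup>2)\<bar> \<le> K * (1 + \<bar>z\<^sup>2\<bar>) ^ d"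
          unfolding d_def by (rule K(2))
        also have "\<dots> \<le> L" unfolding L_def using \<open>z\<^sup>2 \<le> real a ^ 2\<close> K(1)
          by (intro mult_left_mono power_mono) auto
        finally have "real ((2 * M + a) choose j) * \<bar>poly ([:0, 1:] * even_height_poly n y) (z\<^sup>2)\<bar> \<le> real ((2 * M + a) choose j) * L"
          by (rule mult_left_mono) simp
        thus "\<bar>G M j\<bar> \<le> real ((2 * M + a) choose j) * L"
          unfolding G_def z_def[symmetric] by (simp add: abs_mult)
      qed
      also have "\<dots> \<le> (\<Sum>j\<le>2 * M + a. real ((2 * M + a) choose j) * L)"
        using L by (intro sum_mono2) auto
      also have "\<dots> = 2 ^ (2 * M + a) * L"
        unfolding sum_distrib_right[symmetric] using choose_row_sum[of "2 * M + a"]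
        by (metis of_nat_numeral of_nat_power of_nat_sum)
      finally show ?thesis by (simp add: mid_def field_simps)
    qed
    thus ?thesis by (intro bigoI[of _ L] always_eventually allI) simp
  qed
  have X: "(\<lambda>M. X M - cn) \<in> O(\<lambda>M. 1 / real M)"
  proof -
    have "(\<lambda>_. 1) \<in> O(\<lambda>M. real (2 * M + a) ^ (n - 1))"
      using bigo_compose_linear[OF power_bigo_mono[of 0 "n - 1"], of a] by simp
    hence "mid \<in> O(\<lambda>M. real (2 * M + a) ^ (n - 1))" by (rule landau_o.big_trans[OF mid])
    from sum_in_bigo(2)[OF bigo_compose_linear[OF even_mean_symmetric[OF n, of y], of a] this]
    have num: "(\<lambda>M. even_mean 1 n y (2 * M + a) - cn * fall (2 * M + a) n - mid M) \<in> O(\<lambda>M. real (2 * M + a) ^ m)"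
      by (simp add: cn_def m)
    have fp: "fall (2 * M + a) n \<noteq> 0" for M
      using S0[of M] unfolding S by simp
    have "(\<lambda>N. real N ^ n) \<in> O(\<lambda>N. fall N n)" using fall_bigtheta by (meson bigthetaD2 bigomega_iff_bigo)
    note O = bigo_compose_linear[OF this, of a]
    have "a > 0" using n by (simp add: a_def)
    hence nz: "real (2 * M + a) ^ n \<noteq> 0" for M by simp
    have "(\<lambda>M. inverse (fall (2 * M + a) n)) \<in> O(\<lambda>M. inverse (real (2 * M + a) ^ n))"
      by (rule landau_o.big.inverse[OF always_eventually always_eventually O]) (use nz fp in blast)+
    from landau_o.big.mult[OF num this]
    have "(\<lambda>M. (even_mean 1 n y (2 * M + a) - cn * fall (2 * M + a) n - mid M) * inverse (fall (2 * M + a) n))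
      \<in> O(\<lambda>M. real (2 * M + a) ^ m * inverse (real (2 * M + a) ^ n))" .
    moreover have "\<forall>\<^sub>F M in sequentially. real (2 * M + a) ^ m * inverse (real (2 * M + a) ^ n) = 1 / real (2 * M + a)"
      using eventually_gt_at_top[of 0]
    proof eventually_elim
      case (elim M)
      hence "real (2 * M + a) \<noteq> 0" by simp
      thus ?case unfolding m power_Suc by (simp only: inverse_mult_distrib) (simp add: divide_inverse)
    qed
    moreover have "(even_mean 1 n y (2 * M + a) - cn * fall (2 * M + a) n - mid M) * inverse (fall (2 * M + a) n) = X M - cn" for M
      unfolding X_def using fp[of M] by (simp add: divide_inverse left_diff_distrib)
    ultimately have "(\<lambda>M. X M - cn) \<in> O(\<lambda>M. 1 / real (2 * M + a))" by (simp add: landau_o.big.cong)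
    thus ?thesis by (rule landau_o.big_trans[OF _ invN])
  qed
  have "(\<lambda>M. Y M * X M - 1 * cn) \<in> O(\<lambda>M. 1 / real M)"
    unfolding Y_def by (rule bigo_product_one[OF central_binomial_asymp X lim_1_over_n])
  hence "(\<lambda>M. sqrt (pi * real M) * (Y M * X M - 1 * cn)) \<in> O(\<lambda>M. sqrt (pi * real M) * (1 / real M))"
    by (rule landau_o.big.mult_left)
  also have "(\<lambda>M. sqrt (pi * real M) * (1 / real M)) = (\<lambda>M. sqrt pi * (1 / sqrt (real M)))"
  proof
    fix M
    have "sqrt (real M) * (1 / real M) = 1 / sqrt (real M)"
      using sqrt_divide_self_eq[of "real M"] by (simp add: divide_inverse)
    thus "sqrt (pi * real M) * (1 / real M) = sqrt pi * (1 / sqrt (real M))"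
      by (simp only: real_sqrt_mult mult.assoc)
  qed
  also have "(\<lambda>M. sqrt pi * (1 / sqrt (real M))) \<in> O(\<lambda>M. 1 / sqrt (real M))"
    by (rule bigo_cmult) simp
  finally have main: "(\<lambda>M. sqrt (pi * real M) * (Y M * X M - 1 * cn)) \<in> O(\<lambda>M. 1 / sqrt (real M))" .
  define \<gamma> where "\<gamma> = 2 * 2 ^ n / fact m * cn"
  have \<gamma>: "2 powr (1 / 2 - 2 * real n) * real n * real ((2 * n) choose n) * sqrt (pi * real (2 * M + y))
      = \<gamma> * sqrt (pi * (real (2 * M + y) / 2))" for M
  proof -
    have "2 powr (1 / 2 - 2 * real n) = sqrt 2 / 4 ^ n"
    proof -
      have "2 powr (2 * real n) = (4 :: real) ^ n"
        using powr_realpow[of 2 "2 * n"] by (simp add: power_mult)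
      thus ?thesis by (simp add: powr_diff powr_half_sqrt)
    qed
    moreover have "real n * real ((2 * n) choose n) = fact (2 * n) / (fact n * fact m)"
    proof -
      have "real ((2 * n) choose n) = fact (2 * n) / (fact n * fact n)" by (simp add: binomial_fact)
      moreover have "(fact n :: real) = real n * fact m" by (simp add: m)
      ultimately show ?thesis using n by (simp del: fact_Suc)
    qed
    moreover have "sqrt (pi * real (2 * M + y)) = sqrt 2 * sqrt (pi * (real (2 * M + y) / 2))"
      by (simp flip: real_sqrt_mult)
    moreover have "(8 :: real) ^ n = 4 ^ n * 2 ^ n" by (simp flip: power_mult_distrib)
    moreover have "r / Q * (F / (H * K)) * (r * s) = 2 * P / K * (F / (Q * P * H)) * s"
      if "r * r = 2" "P \<noteq> 0" for r Q F H K s P :: real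
    proof -
      have "r / Q * (F / (H * K)) * (r * s) = (r * r) * (F / (Q * H * K)) * s" by (simp add: mult_ac)
      thus ?thesis using that by simp
    qed
    from this[of "sqrt 2" "2 ^ n" "4 ^ n" "fact (2 * n)" "fact n" "fact m"]
    have "sqrt 2 / 4 ^ n * (fact (2 * n) / (fact n * fact m)) * (sqrt 2 * s) = 2 * 2 ^ n / fact m * (fact (2 * n) / (4 ^ n * 2 ^ n * fact n)) * s" for s
      by simp
    ultimately show ?thesis unfolding \<gamma>_def cn_def by (simp only: mult.assoc)
  qed
  have "(\<lambda>M. 2 * 2 ^ n / fact m * (sqrt (pi * real M) * (Y M * X M - 1 * cn))
      + \<gamma> * (sqrt (pi * real M) - sqrt (pi * (real (2 * M + y) / 2)))) \<in> O(\<lambda>M. 1 / sqrt (real M))"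
    by (intro sum_in_bigo(1) bigo_cmult main sqrt_shift_bigo)
  moreover have "\<forall>\<^sub>F M in sequentially. 2 * 2 ^ n / fact m * (sqrt (pi * real M) * (Y M * X M - 1 * cn))
      + \<gamma> * (sqrt (pi * real M) - sqrt (pi * (real (2 * M + y) / 2))) = mean_contacts n (2 * M + y) y 2 -
    (2 powr (1 / 2 - 2 * real n) * real n * real ((2 * n) choose n) * sqrt (pi * real (2 * M + y))
      - 2 * real n - real y + 2)"
    using eventually_ge_at_top[of 1]
  proof eventually_elim
    case (elim M)
    have "A * (s * (W - 1 * c)) + A * c * (s - u) = (2 - N - v) + A * (s * W) - (A * c * u - N - v + 2)" for A s W c u N v :: real
      by (simp add: algebra_simps)
    thus ?case unfolding mean[OF elim] \<gamma> unfolding \<gamma>_def by blast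
  qed
  ultimately show ?thesis by (simp add: landau_o.big.in_cong)
qed

section \<open>Return from M to t in the residue class of y\<close>

lemma bigo_parity_at_top:
  fixes f g :: "nat \<Rightarrow> real"
  assumes "(\<lambda>M. f (2 * M + y)) \<in> O(\<lambda>M. g (2 * M + y))"
  shows "f \<in> O[parity_at_top y](g)"
proof -
  from assms obtain c where "\<forall>\<^sub>F M in at_top. norm (f (2 * M + y)) \<le> c * norm (g (2 * M + y))"
    by (elim landau_o.bigE)
  then obtain M0 where M0: "\<And>M. M \<ge> M0 \<Longrightarrow> norm (f (2 * M + y)) \<le> c * norm (g (2 * M + y))"
    by (auto simp: eventually_at_top_linorder)
  have "\<forall>\<^sub>F t in at_top. t \<in> {t. t mod 2 = y mod 2} \<longrightarrow> norm (f t) \<le> c * norm (g t)"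
    using eventually_ge_at_top[of "2 * M0 + y"]
  proof eventually_elim
    case (elim t)
    show ?case
    proof
      assume "t \<in> {t. t mod 2 = y mod 2}"
      hence "even (t - y)" using elim by (auto simp: mod_eq_iff_dvd_symdiff_nat mod_eq_dvd_iff_nat)
      then obtain M where "t - y = 2 * M" by (elim evenE)
      hence "t = 2 * M + y" "M \<ge> M0" using elim by auto
      thus "norm (f t) \<le> c * norm (g t)" using M0 by simp
    qed
  qed
  thus ?thesis unfolding parity_at_top_def by (intro bigoI[of _ c]) (simp add: eventually_inf_principal)
qed

lemma inverse_bigo_shift:
  "(\<lambda>M. 1 / real M) \<in> O(\<lambda>M. 1 / real (2 * M + y))"
proof (rule bigoI[of _ "real (y + 2)"])
  show "\<forall>\<^sub>F M in sequentially. norm (1 / real M) \<le> real (y + 2) * norm (1 / real (2 * M + y))"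
    using eventually_ge_at_top[of 1]
  proof eventually_elim
    case (elim M)
    have "2 * M + y \<le> (y + 2) * M" using elim by (simp add: algebra_simps)
    hence "real (2 * M + y) \<le> real (y + 2) * real M" by (simp only: of_nat_mult[symmetric] of_nat_le_iff)
    thus ?case using elim by (simp add: field_simps)
  qed
qed

lemma inverse_sqrt_bigo_shift:
  "(\<lambda>M. 1 / sqrt (real M)) \<in> O(\<lambda>M. real (2 * M + y) powr (- (1 / 2)))"
proof (rule bigoI[of _ "sqrt (real (y + 2))"])
  show "\<forall>\<^sub>F M in sequentially. norm (1 / sqrt (real M)) \<le> sqrt (real (y + 2)) * norm (real (2 * M + y) powr (- (1 / 2)))"
    using eventually_ge_at_top[of 1]
  proof eventually_elim
    case (elim M)
    have "2 * M + y \<le> (y + 2) * M" using elim by (simp add: algebra_simps)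
    hence "real (2 * M + y) \<le> real (y + 2) * real M" by (simp only: of_nat_mult[symmetric] of_nat_le_iff)
    hence "sqrt (real (2 * M + y)) \<le> sqrt (real (y + 2)) * sqrt (real M)" by (simp flip: real_sqrt_mult)
    moreover have "real (2 * M + y) powr (- (1 / 2)) = 1 / sqrt (real (2 * M + y))"
      by (simp add: powr_minus_divide powr_half_sqrt)
    moreover have "1 / u \<le> K * (1 / v)" if "v \<le> K * u" "u > 0" "v > 0" for u v K :: real
      using that by (simp add: field_simps)
    moreover have "sqrt (real (2 * M + y)) > 0" "sqrt (real M) > 0" using elim by simp_all
    ultimately have "1 / sqrt (real M) \<le> sqrt (real (y + 2)) * (real (2 * M + y) powr (- (1 / 2)))" by metis
    thus ?case by simp
  qed
qed

theorem theorem15: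
  fixes n y :: nat and \<kappa> :: real
  assumes "n \<ge> 1" and "\<kappa> > 0"
  shows "(\<kappa> < 2 \<longrightarrow>
      (\<lambda>t. mean_contacts n t y \<kappa> -
        (1 + \<kappa> *
          (\<Sum>h=0..n. real (2 * n - h) * real (n choose h) * (real_of_int (int y + int h - 2) gchoose h)
              / real ((2 * n) choose h) * (1 / (2 - \<kappa>) ^ (2 * n - h + 1))) /
          (\<Sum>h=0..n. real (n choose h) * (real_of_int (int y + int h - 2) gchoose h)
              / real ((2 * n) choose h) * (1 / (2 - \<kappa>) ^ (2 * n - h)))))
      \<in> O[parity_at_top y](\<lambda>t. 1 / real t)) \<and>
    (\<kappa> = 2 \<longrightarrow>
      (\<lambda>t. mean_contacts n t y 2 -
        (2 powr (1 / 2 - 2 * real n) * real n * real ((2 * n) choose n) * sqrt (pi * real t)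
          - 2 * real n - real y + 2))
      \<in> O[parity_at_top y](\<lambda>t. real t powr (- (1 / 2)))) \<and>
    (\<kappa> > 2 \<longrightarrow>
      (\<lambda>t. mean_contacts n t y \<kappa> -
        ((\<kappa> - 2) / (\<kappa> - 1) * (real t / 2)
          + \<kappa> * ((2 - \<kappa>) * real y + 4 * real n - 2) / (2 * (\<kappa> - 1) * (\<kappa> - 2)) + 1))
      \<in> O[parity_at_top y](\<lambda>t. 1 / real t))"
proof (intro conjI impI; rule bigo_parity_at_top)
  assume "\<kappa> < 2"
  have "real (2 * n - h) * real (n choose h) * (real_of_int (int y + int h - 2) gchoose h) / real ((2 * n) choose h)
      = real (2 * n - h) * asymp_coeff n y h" for h
    by (simp add: asymp_coeff_def)
  with landau_o.big_trans[OF mean_contacts_weak[OF assms(1,2) \<open>\<kappa> < 2\<close>, of y] inverse_bigo_shift[of y]]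
  show "(\<lambda>M. mean_contacts n (2 * M + y) y \<kappa> -
        (1 + \<kappa> *
          (\<Sum>h=0..n. real (2 * n - h) * real (n choose h) * (real_of_int (int y + int h - 2) gchoose h)
              / real ((2 * n) choose h) * (1 / (2 - \<kappa>) ^ (2 * n - h + 1))) /
          (\<Sum>h=0..n. real (n choose h) * (real_of_int (int y + int h - 2) gchoose h)
              / real ((2 * n) choose h) * (1 / (2 - \<kappa>) ^ (2 * n - h)))))
      \<in> O(\<lambda>M. 1 / real (2 * M + y))"
    by (simp only: asymp_coeff_def)
next
  show "(\<lambda>M. mean_contacts n (2 * M + y) y 2 -
        (2 powr (1 / 2 - 2 * real n) * real n * real ((2 * n) choose n) * sqrt (pi * real (2 * M + y))
          - 2 * real n - real y + 2))
      \<in> O(\<lambda>M. real (2 * M + y) powr (- (1 / 2)))"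
    by (rule landau_o.big_trans[OF mean_contacts_critical[OF assms(1)] inverse_sqrt_bigo_shift])
next
  assume "\<kappa> > 2"
  \<comment> \<open>The supercritical error is expressed in N = 2M + a, which is at least t = 2M +
    y.\<close>
  have "(\<lambda>M. 1 / real (2 * M + (y + 2 * n - 1))) \<in> O(\<lambda>M. 1 / real (2 * M + y))"
  proof (rule bigoI[of _ 1])
    show "\<forall>\<^sub>F M in sequentially. norm (1 / real (2 * M + (y + 2 * n - 1))) \<le> 1 * norm (1 / real (2 * M + y))"
      using eventually_gt_at_top[of 0]
    proof eventually_elim
      case (elim M)
      have "2 * M + y \<le> 2 * M + (y + 2 * n - 1)" using assms(1) by simp
      hence "real (2 * M + y) \<le> real (2 * M + (y + 2 * n - 1))" by (simp only: of_nat_le_iff)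
      moreover have "real (2 * M + y) > 0" using elim by simp
      ultimately have "1 / real (2 * M + (y + 2 * n - 1)) \<le> 1 / real (2 * M + y)" by (intro divide_left_mono) auto
      thus ?case by simp
    qed
  qed
  from landau_o.big_trans[OF mean_contacts_strong[OF assms(1) \<open>\<kappa> > 2\<close>] this]
  show "(\<lambda>M. mean_contacts n (2 * M + y) y \<kappa> -
        ((\<kappa> - 2) / (\<kappa> - 1) * (real (2 * M + y) / 2)
          + \<kappa> * ((2 - \<kappa>) * real y + 4 * real n - 2) / (2 * (\<kappa> - 1) * (\<kappa> - 2)) + 1))
      \<in> O(\<lambda>M. 1 / real (2 * M + y))" .
qed

end
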